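(* Let $\alpha\in(1,2)$ and let $\xi:\mathbb{R}^2\to\mathbb{R}$ be smooth, $1$-periodic in both variables, with vanishing average over $[0,1)^2$. For every $x\in\mathbb{R}^2$ there exist (1) $\mathbf\Pi_x:\mathbb{R}^2\times\mathbb{R}^2\to\mathsf T^*$ such that for every multi-index $\beta$, $\mathbf\Pi_{x\beta}(\cdot,y)$ is a polynomial in $y$ with periodic coefficients, and (2) $P_x:\mathbb{R}^2\to\mathbb{R}[[\mathsf z_k,\mathsf z_{\mathbf n}]]$ such that for every $\beta$, $P_{x\beta}$ is a polynomial, which are related by $$(D_2-D_1^2)\mathbf\Pi_x+P_x=\mathbf\Pi_x^-,\qquad \mathbf\Pi_x^-:=\sum_{k\ge0}\mathsf z_k\mathbf\Pi_x^kD_1^2\mathbf\Pi_x+\xi\mathsf 1,$$ $$\text{for all }\beta,\quad D^{\mathbf n}\mathbf\Pi_{x\beta}(x,x)=0\ \text{ if }|\mathbf n|<|\beta|,$$ and, in addition, satisfy $$\text{for all }\mathbf n\ne\mathbf 0,\quad \mathbf\Pi_{xe_{\mathbf n}}(\cdot,y)=(y-x)^{\mathbf n},$$ $$\text{for }\beta\text{ not purely polynomial},\quad\deg\mathbf\Pi_{x\beta}<|\beta|,$$ $$\text{for }\beta\text{ populated and not purely polynomial},\quad\deg P_{x\beta}<|\beta|-2.$$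
   Context: $\mathbb{N}_0=\{0,1,2,\dots\}$. A multi-index $\beta$ assigns to each $k\in\mathbb{N}_0$ a number $\beta(k)\in\mathbb{N}_0$ and to each $\mathbf n\in\mathbb{N}_0^2\setminus\{\mathbf 0\}$ a number $\beta(\mathbf n)\in\mathbb{N}_0$, all but finitely many equal to $0$; $e_k,e_{\mathbf n}$ are the unit multi-indices. "$\mathbf n\ne\mathbf 0$" means $\mathbf n\in\mathbb{N}_0^2\setminus\{\mathbf 0\}$; $|\mathbf n|:=n_1+2n_2$, $y^{\mathbf n}:=y_1^{n_1}y_2^{n_2}$. Set $$[\beta]:=\sum_{k\ge0}k\beta(k)-\sum_{\mathbf n\ne\mathbf 0}\beta(\mathbf n),\qquad|\beta|:=\alpha\sum_{k\ge0}k\beta(k)+\sum_{\mathbf n\ne\mathbf 0}(|\mathbf n|-\alpha)\beta(\mathbf n)+\alpha$$ (the homogeneity). $\beta$ is purely polynomial if $\beta=e_{\mathbf n}$ for some $\mathbf n\ne\mathbf 0$, and populated if it is purely polynomial or $[\beta]\ge0$. $\mathbb{R}[[\mathsf z_k,\mathsf z_{\mathbf n}]]$ is the algebra of formal power series in the variables $\mathsf z_k$ ($k\ge0$), $\mathsf z_{\mathbf n}$ ($\mathbf n\ne\mathbf 0$): its elements are families $\pi=(\pi_\beta)_\beta$ of reals, with product $(\pi\pi')_\beta=\sum_{\gamma+\gamma'=\beta}\pi_\gamma\pi'_{\gamma'}$ and unit $\mathsf 1$, $\mathsf 1_\beta=\delta_\beta^0$. $\mathsf T^*:=\{\pi:\pi_\beta\ne0\Rightarrow\beta\text{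 populated}\}$. Identities are understood component-wise in $\beta$. The first argument $x'$ of $\mathbf\Pi_x(x',y)$ is the periodic variable, the second argument $y$ the polynomial variable; the base point $x$ is a parameter. Periodic means $1$-periodic in each of the two variables, and periodic coefficients are smooth. $D_i:=\frac{\partial}{\partial x_i'}+\frac{\partial}{\partial y_i}$, $D^{\mathbf n}:=D_1^{n_1}D_2^{n_2}$ for $\mathbf n\in\mathbb{N}_0^2$, and $\xi=\xi(x')$. For $U(x',y)=\sum_{\mathbf n}U_{\mathbf n}(x')y^{\mathbf n}$ (finite sum), $\deg U:=\max\{|\mathbf n|:U_{\mathbf n}\not\equiv0\}$, with $\deg0=-\infty$. *)

theory Defs
  imports "HOL-Analysis.Analysis" "HOL-Library.Poly_Mapping"
begin

subsection \<open>Multi-indices\<close>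

typedef nzpair = "{n :: nat \<times> nat. n \<noteq> (0, 0)}"
  morphisms pair_of Abs_nzpair
  by (rule exI[of _ "(1, 0)"]) simp

datatype zvar = VK nat | VN nzpair

type_synonym mindex = "zvar \<Rightarrow>\<^sub>0 nat"

definition unitK :: "nat \<Rightarrow> mindex" where
  "unitK k = Poly_Mapping.single (VK k) 1"

definition unitN :: "nzpair \<Rightarrow> mindex" where
  "unitN n = Poly_Mapping.single (VN n) 1"

definition wdeg :: "nat \<times> nat \<Rightarrow> nat" where
  "wdeg n = fst n + 2 * snd n"

text \<open>\<^const>\<open>Sum_any\<close> is the sum over all indices of a finitely supported family.\<close>

definition bracket :: "mindex \<Rightarrow> int" where
  "bracket \<beta> = Sum_any (\<lambda>k. int k * int (Poly_Mapping.lookup \<beta> (VK k)))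
             - Sum_any (\<lambda>n. int (Poly_Mapping.lookup \<beta> (VN n)))"

definition homog :: "real \<Rightarrow> mindex \<Rightarrow> real" where
  "homog \<alpha> \<beta> = \<alpha> * Sum_any (\<lambda>k. real k * real (Poly_Mapping.lookup \<beta> (VK k)))
             + Sum_any (\<lambda>n. (real (wdeg (pair_of n)) - \<alpha>) * real (Poly_Mapping.lookup \<beta> (VN n))) + \<alpha>"

definition purely_polynomial :: "mindex \<Rightarrow> bool" where
  "purely_polynomial \<beta> \<longleftrightarrow> (\<exists>n. \<beta> = unitN n)"

definition populated :: "mindex \<Rightarrow> bool" where
  "populated \<beta> \<longleftrightarrow> purely_polynomial \<beta> \<or> bracket \<beta> \<ge> 0"

lemma finite_lookup_VK: "finite {k. Poly_Mapping.lookup (\<beta> :: mindex) (VK k) \<noteq> 0}"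
proof -
  have "finite (VK -` {v. Poly_Mapping.lookup \<beta> v \<noteq> 0})"
    by (rule finite_vimageI) (auto simp: inj_def)
  then show ?thesis by (simp add: vimage_def)
qed

lemma finite_lookup_VN: "finite {n. Poly_Mapping.lookup (\<beta> :: mindex) (VN n) \<noteq> 0}"
proof -
  have "finite (VN -` {v. Poly_Mapping.lookup \<beta> v \<noteq> 0})"
    by (rule finite_vimageI) (auto simp: inj_def)
  then show ?thesis by (simp add: vimage_def)
qed


subsection \<open>Formal power series\<close>

type_synonym pseries = "mindex \<Rightarrow> real"

definition ps_times :: "pseries \<Rightarrow> pseries \<Rightarrow> pseries" where
  "ps_times \<pi> \<pi>' = (\<lambda>\<beta>. \<Sum>(\<gamma>, \<gamma>') \<in> {(\<gamma>, \<gamma>'). \<gamma> + \<gamma>' = \<beta>}. \<pi> \<gamma> * \<pi>' \<gamma>')"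

definition ps_one :: pseries where
  "ps_one = (\<lambda>\<beta>. if \<beta> = 0 then 1 else 0)"

primrec ps_power :: "pseries \<Rightarrow> nat \<Rightarrow> pseries" where
  "ps_power \<pi> 0 = ps_one"
| "ps_power \<pi> (Suc k) = ps_times \<pi> (ps_power \<pi> k)"

definition ps_z :: "nat \<Rightarrow> pseries" where
  "ps_z k = (\<lambda>\<beta>. if \<beta> = unitK k then 1 else 0)"

definition Tstar :: "pseries set" where
  "Tstar = {\<pi>. \<forall>\<beta>. \<pi> \<beta> \<noteq> 0 \<longrightarrow> populated \<beta>}"

lemma finite_decompositions: "finite {(\<gamma>, \<gamma>'). \<gamma> + \<gamma>' = (\<beta> :: mindex)}"
proof -
  let ?A = "{v. Poly_Mapping.lookup \<beta> v \<noteq> 0}"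
  let ?B = "{..Max (Poly_Mapping.lookup \<beta> ` ?A)}"
  let ?F = "{f. \<forall>v. (v \<in> ?A \<longrightarrow> f v \<in> ?B) \<and> (v \<notin> ?A \<longrightarrow> f v = 0)}"
  let ?G = "{\<gamma>. \<forall>v. Poly_Mapping.lookup \<gamma> v \<le> Poly_Mapping.lookup \<beta> v}"
  have finA: "finite ?A"
    by simp
  have finF: "finite ?F"
    by (rule finite_set_of_finite_funs) (use finA in auto)
  have sub: "Poly_Mapping.lookup ` ?G \<subseteq> ?F"
  proof clarsimp
    fix \<gamma> :: mindex and v
    assume le: "\<forall>v. Poly_Mapping.lookup \<gamma> v \<le> Poly_Mapping.lookup \<beta> v"
    have "Poly_Mapping.lookup \<gamma> v \<le> Max (Poly_Mapping.lookup \<beta> ` ?A)" if "0 < Poly_Mapping.lookup \<beta> v"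
    proof -
      have "Poly_Mapping.lookup \<beta> v \<le> Max (Poly_Mapping.lookup \<beta> ` ?A)"
        by (rule Max_ge) (use finA that in auto)
      with le show ?thesis using order_trans by blast
    qed
    moreover have "Poly_Mapping.lookup \<gamma> v = 0" if "Poly_Mapping.lookup \<beta> v = 0"
      using le[rule_format, of v] that by simp
    ultimately show "(0 < Poly_Mapping.lookup \<beta> v \<longrightarrow> Poly_Mapping.lookup \<gamma> v \<le> Max (Poly_Mapping.lookup \<beta> ` {v. 0 < Poly_Mapping.lookup \<beta> v})) \<and>
        (Poly_Mapping.lookup \<beta> v = 0 \<longrightarrow> Poly_Mapping.lookup \<gamma> v = 0)"
      by simp
  qed
  have "finite ?G"
    by (rule finite_imageD[OF finite_subset[OF sub finF]]) (auto simp: inj_on_def Poly_Mapping.lookup_inject)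
  then have "finite (?G \<times> ?G)"
    by simp
  then show ?thesis
    by (rule finite_subset[rotated]) (auto simp: Poly_Mapping.lookup_add)
qed

lemma ps_times_z_support:
  assumes "ps_times (ps_z k) \<pi> \<beta> \<noteq> 0"
  shows "Poly_Mapping.lookup \<beta> (VK k) \<noteq> 0"
proof -
  obtain z where z: "z \<in> {(\<gamma>, \<gamma>'). \<gamma> + \<gamma>' = \<beta>}"
      "(case z of (\<gamma>, \<gamma>') \<Rightarrow> ps_z k \<gamma> * \<pi> \<gamma>') \<noteq> 0"
    using assms unfolding ps_times_def by (rule sum.not_neutral_contains_not_neutral)
  then show ?thesis
    by (cases z) (auto simp: ps_z_def unitK_def Poly_Mapping.lookup_add split: if_splits)
qed

lemma finite_z_support: "finite {k. ps_times (ps_z k) (\<pi> k) \<beta> \<noteq> 0}"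
  by (rule finite_subset[OF _ finite_lookup_VK[of \<beta>]]) (use ps_times_z_support in auto)


subsection \<open>Smooth and periodic functions on the plane\<close>

type_synonym plane = "real \<times> real"

primrec ck_fun :: "nat \<Rightarrow> (plane \<Rightarrow> real) \<Rightarrow> bool" where
  "ck_fun 0 f \<longleftrightarrow> continuous_on UNIV f"
| "ck_fun (Suc k) f \<longleftrightarrow> (\<forall>x. f differentiable (at x)) \<and>
     (\<forall>v. ck_fun k (\<lambda>x. frechet_derivative f (at x) v))"

definition smooth :: "(plane \<Rightarrow> real) \<Rightarrow> bool" where
  "smooth f \<longleftrightarrow> (\<forall>k. ck_fun k f)"

definition periodic :: "(plane \<Rightarrow> real) \<Rightarrow> bool" where
  "periodic f \<longleftrightarrow> (\<forall>x. f (x + (1, 0)) = f x \<and> f (x + (0, 1)) = f x)"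


subsection \<open>Polynomials in \<open>y\<close> with coefficients depending on \<open>x'\<close>\<close>

definition monom2 :: "plane \<Rightarrow> nat \<times> nat \<Rightarrow> real" where
  "monom2 y n = fst y ^ fst n * snd y ^ snd n"

definition expands :: "(plane \<Rightarrow> plane \<Rightarrow> real) \<Rightarrow> (nat \<times> nat \<Rightarrow> plane \<Rightarrow> real) \<Rightarrow> bool" where
  "expands U c \<longleftrightarrow> finite {n. c n \<noteq> (\<lambda>_. 0)} \<and>
     (\<forall>x' y. U x' y = (\<Sum>n \<in> {n. c n \<noteq> (\<lambda>_. 0)}. c n x' * monom2 y n))"

definition periodic_polynomial :: "(plane \<Rightarrow> plane \<Rightarrow> real) \<Rightarrow> bool" where
  "periodic_polynomial U \<longleftrightarrow> (\<exists>c. expands U c \<and> (\<forall>n. smooth (c n) \<and> periodic (c n)))"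

text \<open>The following are only meaningful if \<open>U\<close> has an expansion, which is then unique
  (\<open>ycoeffs_eq\<close> below). Polynomials on the plane have one (\<open>real_polynomial_function_expands\<close>).\<close>

definition ycoeffs :: "(plane \<Rightarrow> plane \<Rightarrow> real) \<Rightarrow> nat \<times> nat \<Rightarrow> plane \<Rightarrow> real" where
  "ycoeffs U = (THE c. expands U c)"

definition ydeg :: "(plane \<Rightarrow> plane \<Rightarrow> real) \<Rightarrow> ereal" where
  "ydeg U = (let S = {n. ycoeffs U n \<noteq> (\<lambda>_. 0)} in
     if S = {} then -\<infinity> else ereal (real (Max (wdeg ` S))))"

lemma expands_unique:
  assumes c: "expands U c" and d: "expands U d"
  shows "c = d"
proof -
  let ?C = "{n. c n \<noteq> (\<lambda>_. 0)}" and ?D = "{n. d n \<noteq> (\<lambda>_. 0)}"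
  have fin: "finite (?C \<union> ?D)"
    using c d by (simp add: expands_def)
  define N where "N = Max (insert 0 (fst ` (?C \<union> ?D) \<union> snd ` (?C \<union> ?D)))"
  have le: "fst n \<le> N \<and> snd n \<le> N" if "n \<in> ?C \<union> ?D" for n
    unfolding N_def using fin that by (auto intro!: Max_ge simp del: Un_iff)
  have sub: "?C \<union> ?D \<subseteq> {..N} \<times> {..N}"
    using le by (force simp: mem_Times_iff)
  have eq: "(\<Sum>i\<le>N. (\<Sum>j\<le>N. c (i, j) x' * v ^ j) * u ^ i)
          = (\<Sum>i\<le>N. (\<Sum>j\<le>N. d (i, j) x' * v ^ j) * u ^ i)" for x' u v
  proof -
    have expand: "U x' (u, v) = (\<Sum>i\<le>N. (\<Sum>j\<le>N. b (i, j) x' * v ^ j) * u ^ i)"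
      if b: "expands U b" and bsub: "{n. b n \<noteq> (\<lambda>_. 0)} \<subseteq> {..N} \<times> {..N}" for b
    proof -
      have "U x' (u, v) = (\<Sum>n \<in> {n. b n \<noteq> (\<lambda>_. 0)}. b n x' * monom2 (u, v) n)"
        using b unfolding expands_def by blast
      also have "\<dots> = (\<Sum>n \<in> {..N} \<times> {..N}. b n x' * monom2 (u, v) n)"
        by (rule sum.mono_neutral_left) (use bsub in auto)
      also have "\<dots> = (\<Sum>i\<le>N. \<Sum>j\<le>N. b (i, j) x' * monom2 (u, v) (i, j))"
        by (simp add: sum.cartesian_product)
      also have "\<dots> = (\<Sum>i\<le>N. (\<Sum>j\<le>N. b (i, j) x' * v ^ j) * u ^ i)"
        by (auto simp: monom2_def sum_distrib_left mult_ac intro!: sum.cong)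
      finally show ?thesis .
    qed
    show ?thesis
      using expand[OF c] expand[OF d] sub by simp
  qed
  have "c (i, j) x' = d (i, j) x'" for i j x'
  proof (cases "i \<le> N \<and> j \<le> N")
    case True
    have "(\<Sum>j\<le>N. c (i, j) x' * v ^ j) = (\<Sum>j\<le>N. d (i, j) x' * v ^ j)" for v
      using eq[of x' v] True
        polyfun_eq_coeffs[of "\<lambda>i. \<Sum>j\<le>N. c (i, j) x' * v ^ j" N "\<lambda>i. \<Sum>j\<le>N. d (i, j) x' * v ^ j"]
      by auto
    then show ?thesis
      using True polyfun_eq_coeffs[of "\<lambda>j. c (i, j) x'" N "\<lambda>j. d (i, j) x'"] by auto
  next
    case False
    then have "(i, j) \<notin> ?C \<union> ?D"
      using le by fastforce
    then show ?thesis by simp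
  qed
  then show ?thesis by (auto simp: fun_eq_iff)
qed

lemma ycoeffs_eq: "expands U c \<Longrightarrow> ycoeffs U = c"
  unfolding ycoeffs_def using expands_unique by blast

lemma real_polynomial_function_expands:
  assumes "real_polynomial_function (p :: plane \<Rightarrow> real)"
  shows "\<exists>c. expands (\<lambda>_ y. p y) c"
proof -
  have "\<exists>F (c :: nat \<times> nat \<Rightarrow> real). finite F \<and> (\<forall>y. p y = (\<Sum>n\<in>F. c n * monom2 y n))"
    using assms
  proof (induction rule: real_polynomial_function.induct)
    case (linear f)
    then interpret bounded_linear f .
    have eq: "f y = (\<Sum>n\<in>{(1, 0), (0, 1)}. (if n = (1, 0) then f (1, 0) else f (0, 1)) * monom2 y n)" for y
    proof -
      have "y = fst y *\<^sub>R (1, 0) + snd y *\<^sub>R (0, 1)"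
        by (simp add: prod_eq_iff)
      then have "f y = fst y * f (1, 0) + snd y * f (0, 1)"
        by (metis add scaleR real_scaleR_def)
      then show ?thesis
        by (simp add: monom2_def)
    qed
    show ?case
      by (intro exI[of _ "{(1, 0), (0, 1)}"]
          exI[of _ "\<lambda>n. if n = (1, 0) then f (1, 0) else f (0, 1)"] conjI allI eq finite.intros)
  next
    case (const a)
    show ?case
      by (intro exI[of _ "{(0, 0)}"] exI[of _ "\<lambda>_. a"]) (simp add: monom2_def)
  next
    case (add f g)
    then obtain F G a b where F: "finite F" "\<And>y. f y = (\<Sum>n\<in>F. a n * monom2 y n)"
      and G: "finite G" "\<And>y. g y = (\<Sum>n\<in>G. b n * monom2 y n)"
      by auto
    let ?c = "\<lambda>n. (if n \<in> F then a n else 0) + (if n \<in> G then b n else 0)"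
    have "f y + g y = (\<Sum>n\<in>F \<union> G. ?c n * monom2 y n)" for y
    proof -
      have "f y = (\<Sum>n\<in>F \<union> G. (if n \<in> F then a n else 0) * monom2 y n)"
        unfolding F(2) by (rule sum.mono_neutral_cong_left) (use F G in auto)
      moreover have "g y = (\<Sum>n\<in>F \<union> G. (if n \<in> G then b n else 0) * monom2 y n)"
        unfolding G(2) by (rule sum.mono_neutral_cong_left) (use F G in auto)
      ultimately show ?thesis
        by (simp only: sum.distrib[symmetric] distrib_right)
    qed
    then show ?case
      using F(1) G(1) by (intro exI[of _ "F \<union> G"] exI[of _ ?c] conjI allI) blast+
  next
    case (mult f g)
    then obtain F G a b where F: "finite F" "\<And>y. f y = (\<Sum>n\<in>F. a n * monom2 y n)"
      and G: "finite G" "\<And>y. g y = (\<Sum>n\<in>G. b n * monom2 y n)"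
      by auto
    let ?h = "\<lambda>(m, n). (fst m + fst n, snd m + snd n)"
    let ?c = "\<lambda>k. \<Sum>(m, n)\<in>{z \<in> F \<times> G. ?h z = k}. a m * b n"
    have "f y * g y = (\<Sum>k\<in>?h ` (F \<times> G). ?c k * monom2 y k)" for y
    proof -
      have "f y * g y = (\<Sum>(m, n)\<in>F \<times> G. (a m * monom2 y m) * (b n * monom2 y n))"
        unfolding F(2) G(2) by (simp add: sum_product sum.cartesian_product)
      also have "\<dots> = (\<Sum>z\<in>F \<times> G. (case z of (m, n) \<Rightarrow> a m * b n) * monom2 y (?h z))"
        by (rule sum.cong) (auto simp: monom2_def power_add mult_ac)
      also have "\<dots> = (\<Sum>k\<in>?h ` (F \<times> G). \<Sum>z\<in>{z \<in> F \<times> G. ?h z = k}.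
          (case z of (m, n) \<Rightarrow> a m * b n) * monom2 y (?h z))"
        by (rule sum.image_gen) (use F G in simp)
      also have "\<dots> = (\<Sum>k\<in>?h ` (F \<times> G). ?c k * monom2 y k)"
        unfolding sum_distrib_right by (intro sum.cong refl) auto
      finally show ?thesis .
    qed
    then show ?case
      using F(1) G(1) by (intro exI[of _ "?h ` (F \<times> G)"] exI[of _ ?c] conjI allI) blast+
  qed
  then obtain F c where F: "finite F" "\<And>y. p y = (\<Sum>n\<in>F. c n * monom2 y n)"
    by auto
  let ?c = "\<lambda>n (_ :: plane). if n \<in> F then c n else 0"
  have "{n. ?c n \<noteq> (\<lambda>_. 0)} \<subseteq> F"
    by auto
  moreover have "(\<Sum>n\<in>F. c n * monom2 y n)
      = (\<Sum>n\<in>{n. ?c n \<noteq> (\<lambda>_. 0)}. ?c n x' * monom2 y n)" for x' y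
    by (rule sum.mono_neutral_cong_right) (use F in \<open>auto simp: fun_eq_iff\<close>)
  ultimately have "expands (\<lambda>_ y. p y) ?c"
    unfolding expands_def using F finite_subset by auto
  then show ?thesis by blast
qed


subsection \<open>Derivatives\<close>

definition pd1 :: "(plane \<Rightarrow> real) \<Rightarrow> plane \<Rightarrow> real" where
  "pd1 f p = deriv (\<lambda>t. f (t, snd p)) (fst p)"

definition pd2 :: "(plane \<Rightarrow> real) \<Rightarrow> plane \<Rightarrow> real" where
  "pd2 f p = deriv (\<lambda>t. f (fst p, t)) (snd p)"

definition D1 :: "(plane \<Rightarrow> plane \<Rightarrow> real) \<Rightarrow> plane \<Rightarrow> plane \<Rightarrow> real" where
  "D1 U x' y = pd1 (\<lambda>z. U z y) x' + pd1 (\<lambda>z. U x' z) y"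

definition D2 :: "(plane \<Rightarrow> plane \<Rightarrow> real) \<Rightarrow> plane \<Rightarrow> plane \<Rightarrow> real" where
  "D2 U x' y = pd2 (\<lambda>z. U z y) x' + pd2 (\<lambda>z. U x' z) y"

definition Dn :: "nat \<times> nat \<Rightarrow> (plane \<Rightarrow> plane \<Rightarrow> real) \<Rightarrow> plane \<Rightarrow> plane \<Rightarrow> real" where
  "Dn n U = (D1 ^^ fst n) ((D2 ^^ snd n) U)"


subsection \<open>The right-hand side of the model equation\<close>

definition component :: "(plane \<Rightarrow> plane \<Rightarrow> pseries) \<Rightarrow> mindex \<Rightarrow> plane \<Rightarrow> plane \<Rightarrow> real" where
  "component \<Pi>\<^sub>x \<beta> x' y = \<Pi>\<^sub>x x' y \<beta>"

text \<open>The series over \<open>k\<close> is a finite sum in each component, by \<open>finite_z_support\<close>.\<close>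

definition Pi_minus ::
  "(plane \<Rightarrow> real) \<Rightarrow> (plane \<Rightarrow> plane \<Rightarrow> pseries) \<Rightarrow> plane \<Rightarrow> plane \<Rightarrow> pseries" where
  "Pi_minus \<xi> \<Pi>\<^sub>x x' y = (\<lambda>\<beta>.
     Sum_any (\<lambda>k. ps_times (ps_z k)
       (ps_times (ps_power (\<Pi>\<^sub>x x' y) k) (\<lambda>\<gamma>. D1 (D1 (component \<Pi>\<^sub>x \<gamma>)) x' y)) \<beta>)
     + \<xi> x' * ps_one \<beta>)"

end

theory Submission
  imports Defs "HOL-Library.Periodic_Fun"
begin

text \<open>
  The components \<open>\<Pi>\<^sub>x\<^sub>\<beta>\<close> are built by recursion on \<open>\<Sum>\<^sub>k \<beta>(k)\<close>: every term of the nonlinearity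
  carries a factor \<open>z\<^sub>k\<close>, so its \<open>\<beta>\<close>-component only involves smaller multi-indices. The
  point is the degree bookkeeping. Split a polynomial in \<open>y\<close> with periodic coefficients into the part
  with mean-free coefficients and the part with constant coefficients. The invariant is that for
  \<open>\<Pi>\<^sub>x\<^sub>\<beta>\<close> the former has degree at most \<open>\<bar>\<beta>\<bar> - \<alpha>\<close> and the latter degree less than \<open>\<bar>\<beta>\<bar>\<close> (at most
  \<open>\<bar>\<beta>\<bar>\<close> if \<open>\<beta>\<close> is purely polynomial, when there is no mean-free part). A constant coefficient in
  \<open>\<Pi>\<^sup>k D\<^sub>1\<^sup>2 \<Pi>\<close> arises either from constant coefficients only, and then \<open>D\<^sub>1\<^sup>2\<close> lowers the degree by 2,
  or from at least two mean-free factors, which costs \<open>2\<alpha> > 2\<close>. Hence the right-hand side is the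
  sum of a mean-free part of degree at most \<open>\<bar>\<beta>\<bar> - \<alpha>\<close> and a polynomial of degree less than
  \<open>\<bar>\<beta>\<bar> - 2\<close>. The heat equation is solved exactly for the mean-free part, coefficient by
  coefficient from the top degree down, by Fourier series on the torus; subtracting the Taylor
  polynomial at \<open>x\<close> enforces the vanishing order, and \<open>P\<^sub>x\<^sub>\<beta>\<close> absorbs the remaining polynomial.
\<close>

subsection \<open>Smooth periodic functions\<close>

text \<open>On the torus the heat operator annihilates constants and reaches only mean-free
  functions, so averages are the sole obstruction to an exact solution, and they are what
  \<open>P\<close>, a function of y alone, can take. The price is that the averages of the
  right-hand side must have degree below |\<beta>| - 2, although its mean-free part may reach
  |\<beta>| - \<alpha> > |\<beta>| - 2; this forces two separate degree counts. The allowance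
  |\<beta>| - \<alpha> is calibrated at \<beta> = 0, where the homogeneity is \<alpha> and \<xi> has
  degree 0; there \<alpha> - 2 < 0 leaves no room for an average of \<xi>. Strictness survives
  products by counting. In the \<beta>-component of z_k \<Pi>^k D_1^2 \<Pi> the numbers [\<gamma>] +
  1 of the k + 1 factors add up to [\<beta>] + 1. If [\<beta>] \<ge> 0, some factor is therefore not
  purely polynomial and its strict inequality passes to the product. If [\<beta>] < 0, a nonzero
  product has purely polynomial factors only.\<close>

definition dir_deriv :: "plane \<Rightarrow> (plane \<Rightarrow> real) \<Rightarrow> plane \<Rightarrow> real" where
  "dir_deriv v f = (\<lambda>x. frechet_derivative f (at x) v)"

lemma smooth_differentiable: "smooth f \<Longrightarrow> f differentiable (at x)"
  unfolding smooth_def using ck_fun.simps(2)[of 0 f] by blast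

lemma smooth_has_derivative: "smooth f \<Longrightarrow> (f has_derivative (\<lambda>v. dir_deriv v f x)) (at x)"
  using smooth_differentiable[of f x] unfolding dir_deriv_def
    by (simp add: frechet_derivative_works)

lemma dir_deriv_eq: "(f has_derivative f') (at x) \<Longrightarrow> dir_deriv v f x = f' v"
  unfolding dir_deriv_def by (metis frechet_derivative_at)

lemma smooth_dir_deriv: "smooth f \<Longrightarrow> smooth (dir_deriv v f)"
  unfolding smooth_def dir_deriv_def using ck_fun.simps(2) by blast

lemma smooth_continuous_on: "smooth f \<Longrightarrow> continuous_on S f"
  by (meson continuous_at_imp_continuous_on differentiable_imp_continuous_within
    smooth_differentiable)

text \<open>By induction on the order: a set of differentiable functions closed under all
  directional derivatives lies in every C^k class at once. Smoothness of a whole family is thus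
  reduced to a single differentiation.\<close>

lemma smooth_coinduct:
  assumes "f \<in> S" and "\<And>g x. g \<in> S \<Longrightarrow> g differentiable (at x)"
    and "\<And>g v. g \<in> S \<Longrightarrow> dir_deriv v g \<in> S"
  shows "smooth f"
proof -
  have "ck_fun k g" if "g \<in> S" for g k
    using that
  proof (induction k arbitrary: g)
    case 0
    then show ?case
      using assms(2) by (auto
        intro!: continuous_at_imp_continuous_on differentiable_imp_continuous_within)
  next
    case (Suc k)
    then show ?case using assms(2,3) unfolding dir_deriv_def by auto
  qed
  then show ?thesis using assms(1) by (simp add: smooth_def)
qed

lemma dir_deriv_add: "smooth f \<Longrightarrow> smooth g \<Longrightarrow> dir_deriv v (\<lambda>x. f x + g x)
  = (\<lambda>x. dir_deriv v f x + dir_deriv v g x)"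
  by (rule ext, rule dir_deriv_eq, intro has_derivative_add smooth_has_derivative)

lemma dir_deriv_mult: "smooth f \<Longrightarrow> smooth g \<Longrightarrow>
    dir_deriv v (\<lambda>x. f x * g x) = (\<lambda>x. f x * dir_deriv v g x + dir_deriv v f x * g x)"
  by (rule ext, rule dir_deriv_eq, intro has_derivative_mult smooth_has_derivative)

lemma dir_deriv_const: "dir_deriv v (\<lambda>_. c) = (\<lambda>_. 0)"
  by (rule ext, rule dir_deriv_eq) (rule has_derivative_const)

lemma smooth_const [simp]: "smooth (\<lambda>_. c)"
  by (rule smooth_coinduct[where S = "range (\<lambda>c _. c)"]) (auto simp: dir_deriv_const)

text \<open>Finite sums of products are closed under differentiation, unlike single products, which
  makes \<open>smooth_coinduct\<close> applicable.\<close>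

inductive prodsum :: "(plane \<Rightarrow> real) \<Rightarrow> bool" where
  zero: "prodsum (\<lambda>_. 0)"
| step: "prodsum h \<Longrightarrow> smooth f \<Longrightarrow> smooth g \<Longrightarrow> prodsum (\<lambda>x. h x + f x * g x)"

lemma prodsum_differentiable: "prodsum h \<Longrightarrow> h differentiable (at x)"
  by (induction rule: prodsum.induct)
    (assumption | rule differentiable_const differentiable_add differentiable_mult
      smooth_differentiable)+

lemma prodsum_dir_deriv: "prodsum h \<Longrightarrow> prodsum (dir_deriv v h)"
proof (induction rule: prodsum.induct)
  case zero
  then show ?case by (simp add: dir_deriv_const prodsum.zero)
next
  case (step h f g)
  have "dir_deriv v (\<lambda>x. h x + f x * g x)
    = (\<lambda>x. (dir_deriv v h x + f x * dir_deriv v g x) + dir_deriv v f x * g x)" (is "_ = ?r")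
  proof
    fix x
    have h: "(h has_derivative (\<lambda>v. dir_deriv v h x)) (at x)"
      using prodsum_differentiable[OF step.hyps(1)] unfolding dir_deriv_def
        by (simp add: frechet_derivative_works)
    have "((\<lambda>x. h x + f x * g x) has_derivative (\<lambda>v. dir_deriv v h x +
      (f x * dir_deriv v g x + dir_deriv v f x * g x))) (at x)"
      using step.hyps by (intro has_derivative_add h has_derivative_mult smooth_has_derivative)
    then show "dir_deriv v (\<lambda>x. h x + f x * g x) x = ?r x" by (simp add: dir_deriv_eq)
  qed
  moreover have "prodsum ?r"
    by (intro prodsum.step step.IH step.hyps smooth_dir_deriv)
  ultimately show ?case by simp
qed

lemma prodsum_smooth: "prodsum h \<Longrightarrow> smooth h"
  by (rule smooth_coinduct[where S =
    "Collect prodsum"]) (auto intro: prodsum_differentiable prodsum_dir_deriv)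

lemma smooth_mult: "smooth f \<Longrightarrow> smooth g \<Longrightarrow> smooth (\<lambda>x. f x * g x)"
  using prodsum_smooth[OF prodsum.step[OF prodsum.zero]] by simp

lemma smooth_add: "smooth f \<Longrightarrow> smooth g \<Longrightarrow> smooth (\<lambda>x. f x + g x)"
  using prodsum_smooth[OF prodsum.step[OF prodsum.step[OF prodsum.zero, of f "\<lambda>_. 1"], of g
    "\<lambda>_. 1"]] by simp

lemma smooth_cmult: "smooth f \<Longrightarrow> smooth (\<lambda>x. c * f x)"
  by (rule smooth_mult) simp

lemma smooth_diff: "smooth f \<Longrightarrow> smooth g \<Longrightarrow> smooth (\<lambda>x. f x - g x)"
  using smooth_add[of f "\<lambda>x. - 1 * g x"] smooth_cmult[of g "-1"] by simp

lemma dir_deriv_cmult: "smooth f \<Longrightarrow> dir_deriv v (\<lambda>x. c * f x) = (\<lambda>x. c * dir_deriv v f x)"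
  using dir_deriv_mult[of "\<lambda>_. c" f v] by (simp add: dir_deriv_const)

lemma dir_deriv_diff: "smooth f \<Longrightarrow> smooth g \<Longrightarrow> dir_deriv v (\<lambda>x. f x - g x)
  = (\<lambda>x. dir_deriv v f x - dir_deriv v g x)"
  by (rule ext, rule dir_deriv_eq, intro has_derivative_diff smooth_has_derivative)

lemma has_derivative_pd1:
  fixes f :: "plane \<Rightarrow> real"
  assumes "(f has_derivative f') (at p)"
  shows "((\<lambda>t. f (t, snd p)) has_field_derivative f' (1, 0)) (at (fst p))"
proof -
  have "((\<lambda>t. f (t, snd p)) has_derivative (\<lambda>h. f' (h, 0))) (at (fst p))"
    by (rule has_derivative_compose[of "\<lambda>t. (t, snd p)" "\<lambda>h. (h, 0)" "fst p" UNIV f f'])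
      (use assms in \<open>auto intro!: derivative_eq_intros\<close>)
  moreover have "(\<lambda>h. f' (h, 0)) = (*) (f' (1, 0))"
    using linear_scale[OF has_derivative_linear[OF assms], of _ "(1, 0)"]
      by (intro ext) (metis mult.commute mult.right_neutral mult_zero_right real_scaleR_def
        scaleR_Pair)
  ultimately show ?thesis by (simp only: has_field_derivative_def)
qed

lemma has_derivative_pd2:
  fixes f :: "plane \<Rightarrow> real"
  assumes "(f has_derivative f') (at p)"
  shows "((\<lambda>t. f (fst p, t)) has_field_derivative f' (0, 1)) (at (snd p))"
proof -
  have "((\<lambda>t. f (fst p, t)) has_derivative (\<lambda>h. f' (0, h))) (at (snd p))"
    by (rule has_derivative_compose[of "\<lambda>t. (fst p, t)" "\<lambda>h. (0, h)" "snd p" UNIV f f'])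
      (use assms in \<open>auto intro!: derivative_eq_intros\<close>)
  moreover have "(\<lambda>h. f' (0, h)) = (*) (f' (0, 1))"
    using linear_scale[OF has_derivative_linear[OF assms], of _ "(0, 1)"]
      by (intro ext) (metis mult.commute mult.right_neutral mult_zero_right real_scaleR_def
        scaleR_Pair)
  ultimately show ?thesis by (simp only: has_field_derivative_def)
qed

lemma smooth_pd1_has_derivative: "smooth f \<Longrightarrow> ((\<lambda>t. f (t, b)) has_field_derivative pd1 f (a, b))
  (at a)"
  using has_derivative_pd1[OF smooth_has_derivative, of f "(a, b)"]
  unfolding pd1_def by (metis DERIV_imp_deriv fst_conv snd_conv)

lemma smooth_pd2_has_derivative: "smooth f \<Longrightarrow> ((\<lambda>t. f (a, t)) has_field_derivative pd2 f (a, b))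
  (at b)"
  using has_derivative_pd2[OF smooth_has_derivative, of f "(a, b)"]
  unfolding pd2_def by (metis DERIV_imp_deriv fst_conv snd_conv)

lemma pd1_eq_dir_deriv: "smooth f \<Longrightarrow> pd1 f = dir_deriv (1, 0) f"
  unfolding pd1_def by (rule ext) (intro DERIV_imp_deriv has_derivative_pd1 smooth_has_derivative)

lemma pd2_eq_dir_deriv: "smooth f \<Longrightarrow> pd2 f = dir_deriv (0, 1) f"
  unfolding pd2_def by (rule ext) (intro DERIV_imp_deriv has_derivative_pd2 smooth_has_derivative)

lemma smooth_pd1: "smooth f \<Longrightarrow> smooth (pd1 f)"
  by (simp add: pd1_eq_dir_deriv smooth_dir_deriv)

lemma smooth_pd2: "smooth f \<Longrightarrow> smooth (pd2 f)"
  by (simp add: pd2_eq_dir_deriv smooth_dir_deriv)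

lemma periodic_shift: "periodic f \<Longrightarrow> f (a + 1, b) = f (a, b)" "periodic f \<Longrightarrow> f (a, b + 1) = f (a, b)"
  unfolding periodic_def by (metis add_Pair add.right_neutral)+

lemma periodicI:
  assumes "\<And>a b. f (a + 1, b) = f (a, b)" and "\<And>a b. f (a, b + 1) = f (a, b)"
  shows "periodic f"
  unfolding periodic_def using assms by (simp add: split_paired_all)

lemma periodic_arith [simp]:
  "periodic (\<lambda>_. c)"
  "periodic f \<Longrightarrow> periodic g \<Longrightarrow> periodic (\<lambda>x. f x + g x)"
  "periodic f \<Longrightarrow> periodic g \<Longrightarrow> periodic (\<lambda>x. f x - g x)"
  "periodic f \<Longrightarrow> periodic g \<Longrightarrow> periodic (\<lambda>x. f x * g x)"
  by (simp_all add: periodic_def)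

lemma deriv_shift: "deriv g (a + c) = deriv (\<lambda>t. g (t + c)) (a :: real)"
  unfolding deriv_def by (simp add: DERIV_shift)

lemma periodic_pd1: "periodic f \<Longrightarrow> periodic (pd1 f)"
  by (rule periodicI) (simp_all add: pd1_def deriv_shift periodic_shift)

lemma periodic_pd2: "periodic f \<Longrightarrow> periodic (pd2 f)"
  by (rule periodicI) (simp_all add: pd2_def deriv_shift periodic_shift)

subsection \<open>Integrals over the torus\<close>

abbreviation cell :: "plane set" where "cell \<equiv> cbox (0, 0) (1, 1)"

definition mean :: "(plane \<Rightarrow> real) \<Rightarrow> real" where
  "mean f = integral cell f"

lemma content_cell [simp]: "Henstock_Kurzweil_Integration.content cell = 1"
  by (simp add: content_Pair)

text \<open>Fubini, then the fundamental theorem of calculus over one period. The general target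
  space serves the real \<open>mean\<close> and the complex \<open>fourier\<close> alike.\<close>

lemma integral_partial1_zero:
  fixes g :: "plane \<Rightarrow> 'a::euclidean_space"
  assumes "continuous_on cell g'"
    and "\<And>a b. ((\<lambda>t. g (t, b)) has_vector_derivative g' (a, b)) (at a)"
    and "\<And>b. g (1, b) = g (0, b)"
  shows "integral cell g' = 0"
proof -
  have "integral cell g' = integral (cbox 0 1) (\<lambda>a. integral (cbox 0 1) (\<lambda>b. g' (a, b)))"
    by (rule integral_prod_continuous[OF assms(1)])
  also have "\<dots> = integral (cbox 0 1) (\<lambda>b. integral (cbox 0 1) (\<lambda>a. g' (a, b)))"
    by (rule integral_swap_continuous) (simp add: assms(1))
  also have "\<dots> = integral (cbox 0 (1::real)) (\<lambda>_. 0)"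
  proof (rule Henstock_Kurzweil_Integration.integral_cong)
    fix b :: real
    have "((\<lambda>a. g' (a, b)) has_integral g (1, b) - g (0, b)) {0..1}"
      by (rule fundamental_theorem_of_calculus) (auto
        intro: has_vector_derivative_at_within assms(2))
    then show "integral (cbox 0 1) (\<lambda>a. g' (a, b)) = 0"
      using assms(3) by (simp add: integral_unique)
  qed
  finally show ?thesis by simp
qed

lemma integral_partial2_zero:
  fixes g :: "plane \<Rightarrow> 'a::euclidean_space"
  assumes "continuous_on cell g'"
    and "\<And>a b. ((\<lambda>t. g (a, t)) has_vector_derivative g' (a, b)) (at b)"
    and "\<And>a. g (a, 1) = g (a, 0)"
  shows "integral cell g' = 0"
proof -
  have "integral cell g' = integral (cbox 0 1) (\<lambda>a. integral (cbox 0 1) (\<lambda>b. g' (a, b)))"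
    by (rule integral_prod_continuous[OF assms(1)])
  also have "\<dots> = integral (cbox 0 (1::real)) (\<lambda>_. 0)"
  proof (rule Henstock_Kurzweil_Integration.integral_cong)
    fix a :: real
    have "((\<lambda>b. g' (a, b)) has_integral g (a, 1) - g (a, 0)) {0..1}"
      by (rule fundamental_theorem_of_calculus) (auto
        intro: has_vector_derivative_at_within assms(2))
    then show "integral (cbox 0 1) (\<lambda>b. g' (a, b)) = 0"
      using assms(3) by (simp add: integral_unique)
  qed
  finally show ?thesis by simp
qed

lemma smooth_integrable: "smooth f \<Longrightarrow> f integrable_on cell"
  by (intro integrable_continuous smooth_continuous_on)

lemma mean_const [simp]: "mean (\<lambda>_. c) = c"
  by (simp add: mean_def)

lemma mean_add: "smooth f \<Longrightarrow> smooth g \<Longrightarrow> mean (\<lambda>x. f x + g x) = mean f + mean g"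
  unfolding mean_def by (intro integral_add smooth_integrable)

lemma mean_diff: "smooth f \<Longrightarrow> smooth g \<Longrightarrow> mean (\<lambda>x. f x - g x) = mean f - mean g"
  unfolding mean_def by (intro integral_diff smooth_integrable)

lemma mean_cmult: "mean (\<lambda>x. c * f x) = c * mean f"
  unfolding mean_def by simp

lemma mean_pd1: "smooth f \<Longrightarrow> periodic f \<Longrightarrow> mean (pd1 f) = 0"
  unfolding mean_def
  by (rule integral_partial1_zero[where g = f])
    (use periodic_shift(1)[of f 0] in \<open>auto intro: smooth_continuous_on smooth_pd1
      simp: has_real_derivative_iff_has_vector_derivative[symmetric] smooth_pd1_has_derivative\<close>)

lemma mean_pd2: "smooth f \<Longrightarrow> periodic f \<Longrightarrow> mean (pd2 f) = 0"
  unfolding mean_def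
  by (rule integral_partial2_zero[where g = f])
    (use periodic_shift(2)[of f _ 0] in \<open>auto intro: smooth_continuous_on smooth_pd2
      simp: has_real_derivative_iff_has_vector_derivative[symmetric] smooth_pd2_has_derivative\<close>)

text \<open>The closed cell is compact and suits the integration theorems; it differs from the
  half-open cell in the average condition on \<xi> by pieces of two lines, a null set.\<close>

lemma mean_half_open: "mean f = integral ({0..<1} \<times> {0..<1}) f"
proof -
  let ?N = "{x :: plane. x \<bullet> (1, 0) = 1} \<union> {x. x \<bullet> (0, 1) = 1}"
  have N: "negligible ?N"
    by (intro negligible_Un negligible_standard_hyperplane) (auto simp: Basis_prod_def)
  show ?thesis
    unfolding mean_def
    by (rule integral_spike_set; rule negligible_subset[OF N]) (auto simp: cbox_Pair_eq)
qed

subsection \<open>Fourier coefficients\<close>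

text \<open>An enumeration of all frequencies makes Fourier series ordinary series over \<^typ>\<open>nat\<close>.\<close>

definition freq :: "nat \<Rightarrow> int \<times> int" where
  "freq k = map_prod int_decode int_decode (prod_decode k)"

definition freq1 :: "nat \<Rightarrow> real" where "freq1 k = of_int (fst (freq k))"
definition freq2 :: "nat \<Rightarrow> real" where "freq2 k = of_int (snd (freq k))"

definition phase :: "nat \<Rightarrow> plane \<Rightarrow> real" where
  "phase k x = 2 * pi * (freq1 k * fst x + freq2 k * snd x)"

definition weight :: "nat \<Rightarrow> real" where
  "weight k = 1 + (freq1 k)\<^sup>2 + (freq2 k)\<^sup>2"

lemma freq_surj: "\<exists>k. freq k = (m, n)"
  by (rule exI[of _ "prod_encode (int_encode m, int_encode n)"]) (simp add: freq_def)

lemma freq_inj: "freq j = freq k \<Longrightarrow> j = k"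
  by (metis freq_def map_prod_simp prod.inject prod_decode_inverse int_decode_inverse surj_pair)

lemma weight_ge_1: "weight k \<ge> 1"
  by (simp add: weight_def)

lemma int_encode_le: "real (int_encode m) \<le> 2 * \<bar>of_int m\<bar>"
proof (cases "0 \<le> m")
  case True
  then show ?thesis by (simp add: int_encode_def sum_encode_def)
next
  case False
  then have "int_encode m = 2 * nat (- m - 1) + 1"
    by (simp add: int_encode_def sum_encode_def)
  moreover have "real (nat (- m - 1)) = - of_int m - 1"
    using False by (simp add: of_nat_nat)
  ultimately show ?thesis using False by simp
qed

text \<open>The Cantor pairing gives k + 1 \<le> (a + b + 1)^2, and \<open>int_encode\<close> at
  most doubles absolute values, so the index grows at most quadratically in the frequency. The
  constant 12 comes from the sum-of-squares identity at the end.\<close>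

lemma index_le_weight: "real k + 1 \<le> 12 * weight k"
proof -
  obtain a b where ab: "prod_decode k = (a, b)" by force
  define p where "p = \<bar>freq1 k\<bar>"
  define q where "q = \<bar>freq2 k\<bar>"
  have k: "k = triangle (a + b) + a"
    using prod_decode_inverse[of k] unfolding ab by (simp add: prod_encode_def)
  have "2 * triangle (a + b) \<le> (a + b) * Suc (a + b)"
    by (simp add: triangle_def)
  then have "k + 1 \<le> (a + b + 1)\<^sup>2"
    using k by (simp add: power2_eq_square algebra_simps)
  then have "real (k + 1) \<le> real ((a + b + 1)\<^sup>2)"
    by (rule of_nat_mono)
  then have 1: "real k + 1 \<le> (real a + real b + 1)\<^sup>2"
    by (simp add: add.commute add.left_commute)
  have "real a \<le> 2 * p" "real b \<le> 2 * q"
    using int_encode_le[of "int_decode a"] int_encode_le[of "int_decode b"]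
    by (simp_all add: p_def q_def freq1_def freq2_def freq_def ab)
  then have "(real a + real b + 1)\<^sup>2 \<le> (2 * p + 2 * q + 1)\<^sup>2"
    by (intro power_mono) auto
  also have "\<dots> \<le> 12 * (1 + p\<^sup>2 + q\<^sup>2)"
  proof -
    have "12 * (1 + p\<^sup>2 + q\<^sup>2) - (2 * p + 2 * q + 1)\<^sup>2 = (2*p - 2*q)\<^sup>2 + (2*p - 1)\<^sup>2 +
      (2*q - 1)\<^sup>2 + 9"
      by (simp add: power2_eq_square algebra_simps)
    then show ?thesis by (smt (verit) zero_le_power2)
  qed
  finally show ?thesis using 1 by (simp add: weight_def p_def q_def)
qed

section \<open>Rapidly decreasing coefficient sequences\<close>

definition rapid :: "(nat \<Rightarrow> complex) \<Rightarrow> bool" where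
  "rapid a \<longleftrightarrow> (\<forall>N. \<exists>C. \<forall>k. norm (a k) * weight k ^ N \<le> C)"

text \<open>Since \<open>weight k\<close> is at least (k + 1) / 12, decay of order two in the weight
  already gives a majorant C / (k + 1)^2; 144 is the square of 12.\<close>

lemma rapid_summable:
  assumes "rapid a"
  shows "summable (\<lambda>k. norm (a k))"
proof -
  obtain C where C: "\<And>k. norm (a k) * weight k ^ 2 \<le> C"
    using assms unfolding rapid_def by blast
  have "norm (a k) \<le> 144 * C * inverse (real (Suc k) ^ 2)" for k
  proof -
    have "norm (a k) * real (Suc k) ^ 2 \<le> norm (a k) * (12 * weight k) ^ 2"
      using index_le_weight[of k] by (intro mult_left_mono power_mono) auto
    also have "\<dots> \<le> 144 * C"
      using C[of k] by (simp add: power_mult_distrib)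
    finally show ?thesis by (simp add: field_simps del: of_nat_Suc)
  qed
  moreover have "summable (\<lambda>k. 144 * C * inverse (real (Suc k) ^ 2))"
    using summable_Suc_iff[of "\<lambda>k. inverse (real k ^ 2)"] inverse_power_summable[of 2, where 'a
      = real]
    by (intro summable_mult) simp
  ultimately show ?thesis
    using summable_comparison_test'[of "\<lambda>k. 144 * C * inverse (real (Suc k) ^ 2)" 0
      "\<lambda>k. norm (a k)"]
    by (simp only: le0 real_norm_def abs_norm_cancel True_implies_equals)
qed

text \<open>Multipliers of polynomial growth preserve rapid decay; M = 1 is used for one derivative
  and M = 0 for division by the symbol of the heat operator.\<close>

lemma rapid_dominated:
  assumes "rapid a" and "\<And>k. norm (b k) \<le> D * weight k ^ M * norm (a k)" and "D \<ge> 0"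
  shows "rapid b"
  unfolding rapid_def
proof
  fix N
  obtain C where C: "\<And>k. norm (a k) * weight k ^ (M + N) \<le> C"
    using assms(1) unfolding rapid_def by blast
  have "norm (b k) * weight k ^ N \<le> D * C" for k
  proof -
    have "norm (b k) * weight k ^ N \<le> (D * weight k ^ M * norm (a k)) * weight k ^ N"
      using weight_ge_1[of k] by (intro mult_right_mono assms(2)) auto
    also have "\<dots> = D * (norm (a k) * weight k ^ (M + N))"
      by (simp add: power_add mult_ac)
    also have "\<dots> \<le> D * C"
      by (intro mult_left_mono C assms(3))
    finally show ?thesis .
  qed
  then show "\<exists>C. \<forall>k. norm (b k) * weight k ^ N \<le> C" by blast
qed

lemma freq_le_weight: "\<bar>freq1 k\<bar> \<le> weight k" "\<bar>freq2 k\<bar> \<le> weight k"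
proof -
  have "\<bar>t\<bar> \<le> 1 + t\<^sup>2" for t :: real
  proof -
    have "0 \<le> (\<bar>t\<bar> - 1)\<^sup>2" by (rule zero_le_power2)
    then have "2 * \<bar>t\<bar> \<le> 1 + t\<^sup>2" by (simp add: power2_diff)
    then show ?thesis by (rule order_trans[rotated]) simp
  qed
  from this[of "freq1 k"] this[of "freq2 k"] show "\<bar>freq1 k\<bar> \<le> weight k" "\<bar>freq2 k\<bar> \<le> weight k"
    using zero_le_power2[of "freq1 k"] zero_le_power2[of "freq2 k"] unfolding weight_def
      by linarith+
qed

lemma phase_le: "\<bar>phase k v\<bar> \<le> 4 * pi * norm v * weight k"
proof -
  have "\<bar>freq1 k * fst v + freq2 k * snd v\<bar> \<le> weight k * norm v + weight k * norm v"
    by (rule order_trans[OF abs_triangle_ineq], unfold abs_mult,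
      intro add_mono mult_mono freq_le_weight)
      (use weight_ge_1[of k] norm_fst_le[of "fst v" "snd v"] norm_snd_le[of "snd v"
        "fst v"] in auto)
  then show ?thesis
    by (simp add: phase_def abs_mult)
qed

lemma cis_phase_periodic:
  "cis (c * phase k (a + 1, b)) = cis (c * phase k (a, b))"
  "cis (c * phase k (a, b + 1)) = cis (c * phase k (a, b))"
  if "c \<in> \<int>"
proof -
  from that obtain i where c: "c = of_int i" by (auto elim: Ints_cases)
  have "c * phase k (a + 1, b) = c * phase k (a, b) + 2 * pi * (c * freq1 k)"
    "c * phase k (a, b + 1) = c * phase k (a, b) + 2 * pi * (c * freq2 k)"
    by (simp_all add: phase_def algebra_simps)
  moreover have "cis (2 * pi * (c * freq1 k)) = 1" "cis (2 * pi * (c * freq2 k)) = 1"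
    unfolding c freq1_def freq2_def by (auto intro!: cis_multiple_2pi)
  ultimately show "cis (c * phase k (a + 1, b)) = cis (c * phase k (a, b))"
    "cis (c * phase k (a, b + 1)) = cis (c * phase k (a, b))"
    by (simp_all add: cis_mult[symmetric])
qed

lemmas cis_phase_shift = cis_phase_periodic[of 1, simplified]
  and cis_neg_phase_shift = cis_phase_periodic[of "-1", simplified]

lemma continuous_on_phase [continuous_intros]: "continuous_on S (phase k)"
  unfolding phase_def by (intro continuous_intros)

section \<open>Fourier coefficients under differentiation\<close>

definition fourier :: "(plane \<Rightarrow> complex) \<Rightarrow> nat \<Rightarrow> complex" where
  "fourier f k = integral cell (\<lambda>x. f x * cis (- phase k x))"

lemma fourier_integrable:
  "continuous_on cell f \<Longrightarrow> (\<lambda>x. f x * cis (- phase k x)) integrable_on cell"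
  by (intro integrable_continuous continuous_intros)

lemma fourier_bound:
  assumes "continuous_on cell f" and "\<And>x. x \<in> cell \<Longrightarrow> norm (f x) \<le> B"
  shows "norm (fourier f k) \<le> B"
proof -
  have "0 \<le> B"
    using order_trans[OF norm_ge_zero assms(2)[of "(0, 0)"]] by (simp add: cbox_Pair_eq)
  then show ?thesis
    using has_integral_bound[OF _ integrable_integral[OF fourier_integrable[OF assms(1), of k]],
      of B] assms(2)
    by (simp add: fourier_def norm_mult)
qed

lemma smooth_continuous_of_real:
  "smooth f \<Longrightarrow> continuous_on S (\<lambda>x. complex_of_real (f x))"
  by (intro continuous_intros smooth_continuous_on)

lemma has_vector_derivative_cis_affine:
  "((\<lambda>t. cis (c * t + d)) has_vector_derivative (c *\<^sub>R (\<i> * cis (c * t + d)))) (at t)"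
  unfolding has_vector_derivative_def by (auto intro!: derivative_eq_intros)

text \<open>Integration by parts: f times the conjugate character is periodic, so its derivative
  integrates to zero.\<close>

lemma fourier_pd1:
  assumes "smooth f" and "periodic f"
  shows "fourier (\<lambda>x. of_real (pd1 f x)) k = 2 * pi * \<i> * freq1 k * fourier (\<lambda>x. of_real (f x)) k"
proof -
  let ?g = "\<lambda>x. complex_of_real (f x) * cis (- phase k x)"
  let ?g1 = "\<lambda>x. complex_of_real (pd1 f x) * cis (- phase k x)"
  let ?g' = "\<lambda>x. ?g1 x - (2 * pi * \<i> * freq1 k) * ?g x"
  have "integral cell ?g' = 0"
  proof (rule integral_partial1_zero[where g = ?g])
    show "continuous_on cell ?g'"
      by (intro continuous_intros smooth_continuous_of_real smooth_pd1 assms)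
  next
    fix a b
    have "((\<lambda>t. complex_of_real (f (t, b))) has_vector_derivative of_real (pd1 f (a, b))) (at a)"
      using smooth_pd1_has_derivative[OF assms(1)] by (intro has_vector_derivative_of_real)
    moreover have "((\<lambda>t. cis (- phase k (t, b))) has_vector_derivative
        (- (2 * pi * freq1 k)) *\<^sub>R (\<i> * cis (- phase k (a, b)))) (at a)"
      using has_vector_derivative_cis_affine[of "- (2 * pi * freq1 k)"
        "- (2 * pi * (freq2 k * b))" a]
      by (simp add: phase_def algebra_simps)
    ultimately have "((\<lambda>t. ?g (t, b)) has_vector_derivative of_real (f (a, b)) * ((-
      (2 * pi * freq1 k)) *\<^sub>R (\<i> * cis (- phase k (a, b))))
        + of_real (pd1 f (a, b)) * cis (- phase k (a, b))) (at a)"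
      by (rule has_vector_derivative_mult)
    then show "((\<lambda>t. ?g (t, b)) has_vector_derivative ?g' (a, b)) (at a)"
      by (simp add: scaleR_conv_of_real algebra_simps)
  next
    fix b
    show "?g (1, b) = ?g (0, b)"
      using periodic_shift(1)[OF assms(2), of 0 b] cis_neg_phase_shift(1)[of k 0 b] by simp
  qed
  moreover have "integral cell ?g' = integral cell ?g1 - integral cell (\<lambda>x.
    (2 * pi * \<i> * freq1 k) * ?g x)"
    by (intro integral_diff integrable_continuous continuous_intros smooth_continuous_of_real
      smooth_pd1 assms)
  ultimately show ?thesis
    by (simp add: fourier_def)
qed

lemma fourier_pd2:
  assumes "smooth f" and "periodic f"
  shows "fourier (\<lambda>x. of_real (pd2 f x)) k = 2 * pi * \<i> * freq2 k * fourier (\<lambda>x. of_real (f x)) k"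
proof -
  let ?g = "\<lambda>x. complex_of_real (f x) * cis (- phase k x)"
  let ?g1 = "\<lambda>x. complex_of_real (pd2 f x) * cis (- phase k x)"
  let ?g' = "\<lambda>x. ?g1 x - (2 * pi * \<i> * freq2 k) * ?g x"
  have "integral cell ?g' = 0"
  proof (rule integral_partial2_zero[where g = ?g])
    show "continuous_on cell ?g'"
      by (intro continuous_intros smooth_continuous_of_real smooth_pd2 assms)
  next
    fix a b
    have "((\<lambda>t. complex_of_real (f (a, t))) has_vector_derivative of_real (pd2 f (a, b))) (at b)"
      using smooth_pd2_has_derivative[OF assms(1)] by (intro has_vector_derivative_of_real)
    moreover have "((\<lambda>t. cis (- phase k (a, t))) has_vector_derivative
        (- (2 * pi * freq2 k)) *\<^sub>R (\<i> * cis (- phase k (a, b)))) (at b)"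
      using has_vector_derivative_cis_affine[of "- (2 * pi * freq2 k)"
        "- (2 * pi * (freq1 k * a))" b]
      by (simp add: phase_def algebra_simps)
    ultimately have "((\<lambda>t. ?g (a, t)) has_vector_derivative of_real (f (a, b)) * ((-
      (2 * pi * freq2 k)) *\<^sub>R (\<i> * cis (- phase k (a, b))))
        + of_real (pd2 f (a, b)) * cis (- phase k (a, b))) (at b)"
      by (rule has_vector_derivative_mult)
    then show "((\<lambda>t. ?g (a, t)) has_vector_derivative ?g' (a, b)) (at b)"
      by (simp add: scaleR_conv_of_real algebra_simps)
  next
    fix a
    show "?g (a, 1) = ?g (a, 0)"
      using periodic_shift(2)[OF assms(2), of a 0] cis_neg_phase_shift(2)[of k a 0] by simp
  qed
  moreover have "integral cell ?g' = integral cell ?g1 - integral cell (\<lambda>x.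
    (2 * pi * \<i> * freq2 k) * ?g x)"
    by (intro integral_diff integrable_continuous continuous_intros smooth_continuous_of_real
      smooth_pd2 assms)
  ultimately show ?thesis
    by (simp add: fourier_def)
qed

text \<open>Multiplies the \<open>k\<close>-th Fourier coefficient by \<^term>\<open>weight k\<close>, so that its iterates yield rapid
  decay.\<close>

definition bessel :: "(plane \<Rightarrow> real) \<Rightarrow> plane \<Rightarrow> real" where
  "bessel f x = f x - (1 / (4 * pi\<^sup>2)) * (pd1 (pd1 f) x + pd2 (pd2 f) x)"

lemma bessel_smooth: "smooth f \<Longrightarrow> smooth (bessel f)"
  unfolding bessel_def by (intro smooth_diff smooth_cmult smooth_add smooth_pd1 smooth_pd2)

lemma bessel_periodic: "periodic f \<Longrightarrow> periodic (bessel f)"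
  unfolding bessel_def by (intro periodic_arith periodic_pd1 periodic_pd2)

lemma fourier_bessel:
  assumes "smooth f" and "periodic f"
  shows "fourier (\<lambda>x. of_real (bessel f x)) k = weight k * fourier (\<lambda>x. of_real (f x)) k"
proof -
  let ?c = "complex_of_real (1 / (4 * pi\<^sup>2))"
  note sm = assms smooth_pd1 smooth_pd2 periodic_pd1 periodic_pd2
  have "fourier (\<lambda>x. of_real (bessel f x)) k
      = integral cell (\<lambda>x. of_real (f x) * cis (- phase k x)
          - ?c * (of_real (pd1 (pd1 f) x) * cis (- phase k x) + of_real (pd2 (pd2 f) x) * cis
            (- phase k x)))"
    unfolding fourier_def bessel_def
      by (simp only: of_real_diff of_real_mult of_real_add ring_distribs mult.assoc)
  also have "\<dots> = integral cell (\<lambda>x. of_real (f x) * cis (- phase k x))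
      - integral cell (\<lambda>x. ?c * (of_real (pd1 (pd1 f) x) * cis (- phase k x) + of_real (pd2
        (pd2 f) x) * cis (- phase k x)))"
    by (intro integral_diff integrable_continuous continuous_intros smooth_continuous_of_real sm)
  also have "\<dots> = fourier (\<lambda>x. of_real (f x)) k
      - ?c * integral cell (\<lambda>x. of_real (pd1 (pd1 f) x) * cis (- phase k x) + of_real (pd2
        (pd2 f) x) * cis (- phase k x))"
    by (simp only: fourier_def integral_mult_right)
  also have "integral cell (\<lambda>x. of_real (pd1 (pd1 f) x) * cis (- phase k x) + of_real (pd2
    (pd2 f) x) * cis (- phase k x))
     = fourier (\<lambda>x. of_real (pd1 (pd1 f) x)) k + fourier (\<lambda>x. of_real (pd2 (pd2 f) x)) k"
    unfolding fourier_def
      by (intro integral_add integrable_continuous continuous_intros smooth_continuous_of_real sm)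
  also have "\<dots> = - (4 * pi\<^sup>2) * ((freq1 k)\<^sup>2 + (freq2 k)\<^sup>2) * fourier (\<lambda>x. of_real (f x)) k"
    by (simp add: fourier_pd1 fourier_pd2 sm power2_eq_square algebra_simps)
  finally show ?thesis
    by (simp add: weight_def algebra_simps add_divide_distrib)
qed

text \<open>The N-th iterate of \<open>bessel\<close> multiplies the coefficients by
  \<open>weight k ^ N\<close>; being continuous it is bounded on the cell, and so are its
  coefficients because the cell has volume 1.\<close>

lemma rapid_fourier:
  assumes "smooth f" and "periodic f"
  shows "rapid (fourier (\<lambda>x. of_real (f x)))"
  unfolding rapid_def
proof
  fix N
  let ?g = "(bessel ^^ N) f"
  have g: "smooth ?g \<and> periodic ?g \<and>
      (\<forall>k. fourier (\<lambda>x. of_real (?g x)) k = weight k ^ N * fourier (\<lambda>x. of_real (f x)) k)"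
    by (induction N) (auto simp: assms bessel_smooth bessel_periodic fourier_bessel)
  then have "continuous_on cell ?g" by (simp add: smooth_continuous_on)
  then have "compact (?g ` cell)" by (intro compact_continuous_image) auto
  then obtain B where B: "\<And>x. x \<in> cell \<Longrightarrow> norm (?g x) \<le> B"
    using compact_imp_bounded bounded_iff by (metis imageI)
  have "norm (fourier (\<lambda>x. of_real (f x)) k) * weight k ^ N \<le> B" for k
  proof -
    have "norm (fourier (\<lambda>x. complex_of_real (?g x)) k) \<le> B"
      using g B by (intro fourier_bound smooth_continuous_of_real) auto
    then show ?thesis
      using g weight_ge_1[of k] by (simp add: norm_mult norm_power mult.commute)
  qed
  then show "\<exists>C. \<forall>k. norm (fourier (\<lambda>x. complex_of_real (f x)) k) * weight k ^ N \<le> C" by blast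
qed

subsection \<open>Fourier inversion\<close>

lemma shift_int:
  assumes "\<And>a b. f (a + 1, b) = f (a :: real, b :: real)" and "\<And>a b. f (a, b + 1) = f (a, b)"
  shows "f (a + of_int m, b + of_int n) = f (a, b)"
proof -
  interpret p1: periodic_fun_simple' "\<lambda>a. f (a, b + of_int n)"
    by unfold_locales (rule assms(1))
  interpret p2: periodic_fun_simple' "\<lambda>b. f (a, b)"
    by unfold_locales (rule assms(2))
  show ?thesis
    using p1.plus_of_int[of a m] p2.plus_of_int[of b n] by simp
qed

lemma shift_to_cell:
  assumes "\<And>a b. f (a + 1, b) = f (a :: real, b :: real)" and "\<And>a b. f (a, b + 1) = f (a, b)"
  obtains y where "y \<in> cell" and "f x = f y"
proof
  let ?y = "(frac (fst x), frac (snd x))"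
  show "?y \<in> cell"
    by (simp add: cbox_Pair_eq frac_ge_0 less_imp_le[OF frac_lt_1])
  show "f x = f ?y"
    using shift_int[OF assms, of "frac (fst x)" "\<lfloor>fst x\<rfloor>" "frac (snd x)" "\<lfloor>snd x\<rfloor>"]
    by (simp add: frac_def)
qed

section \<open>Density of trigonometric polynomials and uniqueness of coefficients\<close>

definition torus :: "plane \<Rightarrow> complex \<times> complex" where
  "torus x = (cis (2 * pi * fst x), cis (2 * pi * snd x))"

lemma continuous_on_torus: "continuous_on S torus"
  unfolding torus_def by (intro continuous_intros)

lemma cis_2pi_eqD:
  assumes "cis (2 * pi * s) = cis (2 * pi * t)"
  obtains m :: int where "s = t + of_int m"
proof -
  have "sin (2 * pi * s) = sin (2 * pi * t) \<and> cos (2 * pi * s) = cos (2 * pi * t)"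
    using assms by (simp add: complex_eq_iff)
  then obtain m :: int where "2 * pi * s = 2 * pi * t + 2 * pi * m"
    unfolding sin_cos_eq_iff by blast
  then have "2 * pi * s = 2 * pi * (t + m)" by (simp add: algebra_simps)
  then show ?thesis using that
    by (metis mult_cancel_left pi_neq_zero zero_neq_numeral mult_eq_0_iff)
qed

text \<open>R picks any preimage in the cell; two preimages differ by integers, so periodicity makes
  the choice irrelevant. Continuity holds because the preimage under R of a closed set is the image
  under \<open>torus\<close> of a compact set, hence closed.\<close>

lemma periodic_factors_through_torus:
  fixes r :: "plane \<Rightarrow> real"
  assumes "continuous_on cell r" and "periodic r"
  obtains R where "continuous_on (torus ` cell) R" and "\<And>x. x \<in> cell \<Longrightarrow> R (torus x) = r x"
proof
  let ?R = "\<lambda>z. r (SOME x. x \<in> cell \<and> torus x = z)"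
  show eq: "?R (torus x) = r x" if "x \<in> cell" for x
  proof -
    define y where "y = (SOME y. y \<in> cell \<and> torus y = torus x)"
    have "torus y = torus x"
      unfolding y_def using someI[of "\<lambda>y. y \<in> cell \<and> torus y = torus x" x] that by auto
    then obtain m n :: int where "fst y = fst x + m" "snd y = snd x + n"
      unfolding torus_def by (metis Pair_inject cis_2pi_eqD)
    then have "y = (fst x + m, snd x + n)" by (simp add: prod_eq_iff)
    then have "r y = r x"
      using shift_int[of r "fst x" m "snd x" n] periodic_shift[OF assms(2)] by simp
    then show ?thesis unfolding y_def .
  qed
  have comp: "compact (torus ` A)" if "compact A" for A
    by (intro compact_continuous_image continuous_on_torus that)
  have "closed (?R -` B \<inter> torus ` cell)" if "closed B" for B
  proof -
    have "?R -` B \<inter> torus ` cell = torus ` (r -` B \<inter> cell)"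
      using eq by auto
    moreover have "closed (r -` B \<inter> cell)"
      using iffD1[OF continuous_on_closed_vimage[OF closed_cbox] assms(1)] that by blast
    then have "compact (r -` B \<inter> cell)"
      using closed_Int_compact[OF _ compact_cbox, of "r -` B \<inter> cell" "(0, 0)" "(1, 1)"]
        by (simp add: Int_assoc)
    ultimately show ?thesis by (simp add: comp compact_imp_closed)
  qed
  then show "continuous_on (torus ` cell) ?R"
    using compact_imp_closed[OF comp[OF compact_cbox]] by (subst continuous_on_closed_vimage) auto
qed

text \<open>The negative phase makes the integral of h times such a polynomial a linear combination
  of Fourier coefficients of h.\<close>

inductive trigpoly :: "(plane \<Rightarrow> complex) \<Rightarrow> bool" where
  zero: "trigpoly (\<lambda>_. 0)"
| step: "trigpoly p \<Longrightarrow> trigpoly (\<lambda>x. p x + c * cis (- phase k x))"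

lemma trigpoly_add: "trigpoly p \<Longrightarrow> trigpoly q \<Longrightarrow> trigpoly (\<lambda>x. q x + p x)"
proof (induction rule: trigpoly.induct)
  case (step p c k)
  from trigpoly.step[OF step.IH[OF step.prems], of c k]
  show ?case by (simp add: add.assoc)
qed simp

lemma trigpoly_cis: "trigpoly (\<lambda>x. c * cis (- phase k x))"
  using trigpoly.step[OF trigpoly.zero] by simp

lemma cis_phase_mult:
  obtains l where "\<And>x. cis (- phase j x) * cis (- phase k x) = cis (- phase l x)"
proof -
  obtain l where l: "freq l = (fst (freq j) + fst (freq k), snd (freq j) + snd (freq k))"
    using freq_surj by blast
  show ?thesis
    by (rule that[of l]) (simp add: cis_mult phase_def freq1_def freq2_def l algebra_simps)
qed

lemma trigpoly_mult_cis: "trigpoly p \<Longrightarrow> trigpoly (\<lambda>x. p x * (c * cis (- phase k x)))"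
proof (induction rule: trigpoly.induct)
  case (step p d j)
  obtain l where "\<And>x. cis (- phase j x) * cis (- phase k x) = cis (- phase l x)"
    using cis_phase_mult by blast
  then have "(\<lambda>x. (p x + d * cis (- phase j x)) * (c * cis (- phase k x)))
      = (\<lambda>x. p x * (c * cis (- phase k x)) + (d * c) * cis (- phase l x))"
    by (simp add: fun_eq_iff algebra_simps)
  then show ?case using trigpoly.step[OF step.IH] by simp
qed (simp add: trigpoly.zero)

lemma trigpoly_mult: "trigpoly q \<Longrightarrow> trigpoly p \<Longrightarrow> trigpoly (\<lambda>x. p x * q x)"
proof (induction rule: trigpoly.induct)
  case (step q c k)
  from trigpoly_add[OF trigpoly_mult_cis[OF step.prems, of c k] step.IH[OF step.prems]]
  show ?case by (simp add: algebra_simps)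
qed (simp add: trigpoly.zero)

lemma cis_phase_zero_freq:
  obtains k where "\<And>x. cis (- phase k x) = 1"
proof -
  obtain k where "freq k = (0, 0)" using freq_surj by blast
  then show ?thesis using that[of k] by (simp add: phase_def freq1_def freq2_def)
qed

lemma trigpoly_const: "trigpoly (\<lambda>_. c)"
proof -
  obtain k where "\<And>x. cis (- phase k x) = 1" using cis_phase_zero_freq by blast
  then show ?thesis using trigpoly_cis[of c k] by simp
qed

lemma trigpoly_sin_cos:
  fixes m n :: int
  defines "t \<equiv> \<lambda>x :: plane. 2 * pi * (of_int m * fst x + of_int n * snd x)"
  shows "trigpoly (\<lambda>x. of_real (cos (t x)))" and "trigpoly (\<lambda>x. of_real (sin (t x)))"
proof -
  obtain j k where "freq j = (m, n)" "freq k = (- m, - n)"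
    using freq_surj by metis
  then have jk: "cis (- phase j x) = cis (- t x)" "cis (- phase k x) = cis (t x)" for x
    by (simp_all add: t_def phase_def freq1_def freq2_def algebra_simps)
  have "(\<lambda>x. complex_of_real (cos (t x))) = (\<lambda>x. 1 / 2 * cis (- phase j x) + 1 / 2 * cis
    (- phase k x))"
    "(\<lambda>x. complex_of_real (sin (t x))) = (\<lambda>x. \<i> / 2 * cis (- phase j x) + - \<i> / 2 * cis
      (- phase k x))"
    unfolding jk by (auto simp: fun_eq_iff complex_eq_iff)
  then show "trigpoly (\<lambda>x. of_real (cos (t x)))" "trigpoly (\<lambda>x. of_real (sin (t x)))"
    by (simp_all only: trigpoly_add trigpoly_cis)
qed

lemma trigpoly_torus:
  assumes "real_polynomial_function p"
  shows "trigpoly (\<lambda>x. of_real (p (torus x)))"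
  using assms
proof (induction rule: real_polynomial_function.induct)
  case (linear f)
  interpret bounded_linear f by fact
  \<comment> \<open>The four real coordinates of a point of the torus are the cosines and sines of
    its two angles.\<close>
  have dec: "f (z, w) = Re z * f (1, 0) + Im z * f (\<i>, 0) + (Re w * f (0, 1) + Im w * f (0, \<i>))"
    for z w
  proof -
    have "(z, w) = Re z *\<^sub>R (1, 0) + Im z *\<^sub>R (\<i>, 0) + (Re w *\<^sub>R (0, 1) + Im w *\<^sub>R (0, \<i>))"
      by (simp add: complex_eq_iff)
    then show ?thesis by (simp only: add scaleR real_scaleR_def)
  qed
  have "(\<lambda>x. complex_of_real (f (torus x))) =
      (\<lambda>x. of_real (cos (2 * pi * fst x)) * of_real (f (1, 0)) + of_real (sin
        (2 * pi * fst x)) * of_real (f (\<i>, 0))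
        + (of_real (cos (2 * pi * snd x)) * of_real (f (0, 1)) + of_real (sin
          (2 * pi * snd x)) * of_real (f (0, \<i>))))"
    using dec[of "cis (2 * pi * fst x)" "cis (2 * pi * snd x)" for x]
    by (simp only: torus_def cis.simps of_real_add of_real_mult)
  moreover have "trigpoly \<dots>"
    using trigpoly_sin_cos[of 1 0] trigpoly_sin_cos[of 0 1]
    by (intro trigpoly_add trigpoly_mult trigpoly_const) simp_all
  ultimately show ?case by simp
qed (simp_all add: trigpoly_const trigpoly_add trigpoly_mult)

lemma continuous_on_trigpoly: "trigpoly p \<Longrightarrow> continuous_on S p"
  by (induction rule: trigpoly.induct) (intro continuous_intros | assumption)+

lemma integral_trigpoly_zero:
  assumes "trigpoly p" and h: "continuous_on cell h" and "\<And>k. fourier h k = 0"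
  shows "integral cell (\<lambda>x. h x * p x) = 0"
  using assms(1)
proof (induction rule: trigpoly.induct)
  case (step p c k)
  have "integral cell (\<lambda>x. h x * (p x + c * cis (- phase k x)))
      = integral cell (\<lambda>x. h x * p x + c * (h x * cis (- phase k x)))"
    by (simp add: algebra_simps)
  also have "\<dots> = integral cell (\<lambda>x. h x * p x) + integral cell (\<lambda>x. c * (h x * cis (- phase k x)))"
    by (intro integral_add integrable_continuous continuous_intros h continuous_on_trigpoly
      step.hyps)
  also have "\<dots> = 0"
    using step.IH assms(3)[of k] by (simp add: fourier_def)
  finally show ?case .
qed simp

lemma continuous_on_cell_bounded:
  fixes h :: "plane \<Rightarrow> 'a::real_normed_vector"
  assumes "continuous_on cell h"
  obtains B where "B > 0" and "\<And>x. x \<in> cell \<Longrightarrow> norm (h x) \<le> B"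
  using compact_imp_bounded[OF compact_continuous_image[OF assms compact_cbox]]
  unfolding bounded_pos by auto

text \<open>Stone--Weierstrass on the torus, whose real polynomials pull back to trigonometric
  polynomials.\<close>

lemma integral_periodic_zero:
  fixes r :: "plane \<Rightarrow> real"
  assumes h: "continuous_on cell h" and "\<And>k. fourier h k = 0"
    and r: "continuous_on cell r" "periodic r"
  shows "integral cell (\<lambda>x. h x * of_real (r x)) = 0"
proof -
  obtain B where B: "B > 0" "\<And>x. x \<in> cell \<Longrightarrow> norm (h x) \<le> B"
    using continuous_on_cell_bounded[OF h] by blast
  obtain R where R: "continuous_on (torus ` cell) R" "\<And>x. x \<in> cell \<Longrightarrow> R (torus x) = r x"
    using periodic_factors_through_torus[OF r] by blast
  have small: "norm (integral cell (\<lambda>x. h x * of_real (r x))) \<le> e" if "e > 0" for e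
  proof -
    have eB: "0 < e / B" using that B(1) by simp
    obtain p where p: "real_polynomial_function p" "\<And>z. z \<in> torus ` cell \<Longrightarrow> \<bar>R z - p z\<bar> < e / B"
      using Stone_Weierstrass_real_polynomial_function[OF compact_continuous_image[OF
        continuous_on_torus compact_cbox] R(1)
          eB] by blast
    note tp = trigpoly_torus[OF p(1)]
    let ?d = "\<lambda>x. h x * (complex_of_real (r x) - of_real (p (torus x)))"
    have int: "?d integrable_on cell"
      by (intro integrable_continuous continuous_intros h r continuous_on_trigpoly[OF tp])
    have "integral cell (\<lambda>x. h x * of_real (r x))
      = integral cell ?d + integral cell (\<lambda>x. h x * of_real (p (torus x)))"
      by (subst integral_add[symmetric])
        (auto simp: algebra_simps
          intro!: integrable_continuous continuous_intros h r continuous_on_trigpoly[OF tp])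
    also have "\<dots> = integral cell ?d"
      using integral_trigpoly_zero[OF tp h assms(2)] by simp
    also have "norm \<dots> \<le> e * Henstock_Kurzweil_Integration.content cell"
    proof (rule has_integral_bound[OF _ integrable_integral[OF int]])
      fix x assume x: "x \<in> cell"
      have "norm (?d x) = norm (h x) * \<bar>R (torus x) - p (torus x)\<bar>"
        using R(2)[OF x] by (simp add: norm_mult flip: of_real_diff)
      also have "\<dots> \<le> B * (e / B)"
        using B p(2)[of "torus x"] x by (intro mult_mono) auto
      finally show "norm (?d x) \<le> e" using B(1) by simp
    qed (use that in simp)
    finally show ?thesis by simp
  qed
  have "norm (integral cell (\<lambda>x. h x * of_real (r x))) \<le> 0"
    by (rule field_le_epsilon) (simp only: add_0 small)
  then show ?thesis by simp
qed

text \<open>h is tested against its own real and imaginary parts: with R one of them, the integral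
  of \<open>R (h x) * R (h x)\<close> vanishes, and a continuous nonnegative function with zero
  integral is zero. Periodicity carries this from the cell to the plane.\<close>

lemma fourier_unique:
  assumes h: "continuous_on cell h" and zero: "\<And>k. fourier h k = 0"
    and per: "\<And>a b. h (a + 1, b) = h (a, b)" "\<And>a b. h (a, b + 1) = h (a, b)"
  shows "h x = 0"
proof -
  have key: "R (h y) = 0" if y: "y \<in> cell" and R: "bounded_linear R"
    "\<And>z t. R (z * of_real t) = R z * (t :: real)" for y R
  proof -
    have c: "continuous_on cell (\<lambda>x. R (h x))"
      by (intro bounded_linear.continuous_on[OF R(1)] h)
    have "periodic (\<lambda>x. R (h x))"
      by (rule periodicI) (simp_all add: per)
    from integral_periodic_zero[OF h zero c this]
    have "R (integral cell (\<lambda>x. h x * of_real (R (h x)))) = 0"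
      by (simp add: linear_0[OF bounded_linear.linear[OF R(1)]])
    moreover have "(\<lambda>x. h x * of_real (R (h x))) integrable_on cell"
      by (intro integrable_continuous continuous_intros h c)
    note integral_linear[OF this R(1)]
    ultimately have "integral cell (\<lambda>x. R (h x) * R (h x)) = 0"
      by (simp add: o_def R(2))
    moreover have "box (0, 0) (1, 1 :: real) \<noteq> ({} :: plane set)"
      by (auto simp: box_ne_empty Basis_prod_def)
    ultimately have "\<forall>x\<in>cell. R (h x) * R (h x) = 0"
      by (subst (asm) integral_cbox_eq_0_iff) (auto intro!: continuous_intros c)
    then show ?thesis using y by simp
  qed
  have "h y = 0" if "y \<in> cell" for y
    using key[OF that bounded_linear_Re] key[OF that bounded_linear_Im]
      by (simp add: complex_eq_iff)
  then show ?thesis using shift_to_cell[of h x] per by metis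
qed

section \<open>Orthogonality, inversion and smoothness of Fourier series\<close>

lemma fourier_one:
  "fourier (\<lambda>_. 1) k = (if freq k = (0, 0) then 1 else 0)"
proof -
  have "pd1 (\<lambda>_. 1) = (\<lambda>_. 0)" "pd2 (\<lambda>_. 1) = (\<lambda>_. 0)"
    by (simp_all add: pd1_def pd2_def fun_eq_iff)
  \<comment> \<open>The derivatives of 1 vanish, so the multiplier rules kill every coefficient off
    the zero frequency without evaluating an integral.\<close>
  then have "freq1 k * fourier (\<lambda>_. 1) k = 0" "freq2 k * fourier (\<lambda>_. 1) k = 0"
    using fourier_pd1[of "\<lambda>_. 1" k] fourier_pd2[of "\<lambda>_. 1" k] by (auto simp: fourier_def)
  moreover have "fourier (\<lambda>_. 1) k = 1" if "freq k = (0, 0)"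
  proof -
    have "(\<lambda>x. cis (- phase k x)) = (\<lambda>x. 1)"
      using that by (simp add: phase_def freq1_def freq2_def)
    then show ?thesis by (simp add: fourier_def)
  qed
  ultimately show ?thesis
    by (auto simp: freq1_def freq2_def prod_eq_iff)
qed

lemma fourier_cis: "fourier (\<lambda>x. cis (phase j x)) k = (if j = k then 1 else 0)"
proof -
  obtain l where l: "freq l = (fst (freq k) - fst (freq j), snd (freq k) - snd (freq j))"
    using freq_surj by blast
  have "fourier (\<lambda>x. cis (phase j x)) k = fourier (\<lambda>_. 1) l"
    unfolding fourier_def
    by (simp add: cis_mult phase_def freq1_def freq2_def l algebra_simps)
  then show ?thesis
    using freq_inj[of j k] by (auto simp: fourier_one l prod_eq_iff)
qed

lemma fourier_uniform_limit:
  assumes "uniform_limit cell G g sequentially" and "\<And>n. continuous_on cell (G n)"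
  shows "(\<lambda>n. fourier (G n) k) \<longlonglongrightarrow> fourier g k"
proof (rule tendstoI)
  fix e :: real assume "e > 0"
  have g: "continuous_on cell g"
    by (rule uniform_limit_theorem[OF _ assms(1)]) (simp_all add: assms(2))
  have "\<forall>\<^sub>F n in sequentially. \<forall>x\<in>cell. dist (G n x) (g x) < e / 2"
    using assms(1) \<open>e > 0\<close> unfolding uniform_limit_iff by (meson half_gt_zero)
  then show "\<forall>\<^sub>F n in sequentially. dist (fourier (G n) k) (fourier g k) < e"
  proof eventually_elim
    case (elim n)
    have "fourier (G n) k - fourier g k = fourier (\<lambda>x. G n x - g x) k"
      unfolding fourier_def left_diff_distrib
      by (intro integral_diff[symmetric] fourier_integrable assms(2) g)
    also have "norm \<dots> \<le> e / 2"
      using elim by (intro fourier_bound continuous_intros assms(2) g) (auto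
        simp: dist_norm less_imp_le)
    finally show ?case using \<open>e > 0\<close> by (simp add: dist_norm)
  qed
qed

lemma fourier_sum:
  "fourier (\<lambda>x. \<Sum>i<n. a i * cis (phase i x)) k = (if k < n then a k else 0)"
proof -
  have "fourier (\<lambda>x. \<Sum>i<n. a i * cis (phase i x)) k = (\<Sum>i<n. a i * fourier (\<lambda>x. cis (phase i x)) k)"
    unfolding fourier_def sum_distrib_right mult.assoc
    by (subst integral_sum) (auto intro!: integrable_continuous continuous_intros)
  also have "\<dots> = (if k < n then a k else 0)"
    by (simp add: fourier_cis if_distrib[of "\<lambda>t. _ * t"] cong: if_cong)
  finally show ?thesis .
qed

text \<open>Taking real parts termwise yields a real function for every coefficient sequence, so no
  conjugate symmetry has to be tracked.\<close>

definition fourier_series :: "(nat \<Rightarrow> complex) \<Rightarrow> plane \<Rightarrow> real" where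
  "fourier_series a x = suminf (\<lambda>k. Re (a k * cis (phase k x)))"

text \<open>Rapid decay makes the series converge uniformly to a continuous g; coefficients pass to
  the uniform limit, so f and g share them and \<open>fourier_unique\<close> applies to the
  difference.\<close>

lemma fourier_inversion:
  assumes "smooth f" and "periodic f"
  shows "f x = fourier_series (fourier (\<lambda>x. of_real (f x))) x"
proof -
  define a where "a = fourier (\<lambda>x. of_real (f x))"
  define g where "g = (\<lambda>x. suminf (\<lambda>k. a k * cis (phase k x)))"
  have sa: "summable (\<lambda>k. norm (a k))"
    unfolding a_def by (intro rapid_summable rapid_fourier assms)
  then have summ: "summable (\<lambda>k. a k * cis (phase k x))" for x
    by (intro summable_norm_cancel[where f = "\<lambda>k. a k * cis (phase k x)"]) (simp add: norm_mult)
  have lim: "uniform_limit cell (\<lambda>n x. \<Sum>k<n. a k * cis (phase k x)) g sequentially"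
    unfolding g_def by (rule Weierstrass_m_test[where M =
      "\<lambda>k. norm (a k)"]) (simp_all add: norm_mult sa)
  have cont: "continuous_on cell (\<lambda>x. \<Sum>k<n. a k * cis (phase k x))" for n
    by (intro continuous_intros)
  have g: "continuous_on cell g"
    by (rule uniform_limit_theorem[OF _ lim]) (simp_all add: cont)
  have "fourier g k = a k" for k
  proof (rule LIMSEQ_unique[OF fourier_uniform_limit[OF lim cont]])
    show "(\<lambda>n. fourier (\<lambda>x. \<Sum>k<n. a k * cis (phase k x)) k) \<longlonglongrightarrow> a k"
      by (rule tendsto_eventually) (auto simp: fourier_sum eventually_sequentially
        intro!: exI[of _ "Suc k"])
  qed
  have "of_real (f x) - g x = 0"
  proof (rule fourier_unique)
    show "continuous_on cell (\<lambda>x. of_real (f x) - g x)"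
      by (intro continuous_intros smooth_continuous_of_real assms g)
    show "fourier (\<lambda>x. of_real (f x) - g x) k = 0" for k
    proof -
      have "fourier (\<lambda>x. of_real (f x) - g x) k = a k - fourier g k"
        unfolding a_def fourier_def left_diff_distrib
        by (intro integral_diff fourier_integrable smooth_continuous_of_real assms g)
      then show ?thesis using \<open>fourier g k = a k\<close> by simp
    qed
  qed (simp_all add: g_def cis_phase_shift periodic_shift assms)
  then have "f x = Re (g x)" by (metis Re_complex_of_real eq_iff_diff_eq_0)
  also have "\<dots> = fourier_series a x"
    unfolding g_def fourier_series_def using bounded_linear.suminf[OF bounded_linear_Re summ]
      by simp
  finally show ?thesis unfolding a_def .
qed

lemma abs_Re_mult_cis_le: "\<bar>Re (z * cis t)\<bar> \<le> norm z"
  by (rule order_trans[OF abs_Re_le_cmod]) (simp add: norm_mult)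

lemma fourier_series_sums: "rapid a \<Longrightarrow> (\<lambda>k. Re (a k * cis (phase k x))) sums fourier_series a x"
  unfolding fourier_series_def
  by (intro summable_sums summable_comparison_test'[OF rapid_summable[of a], of 0])
    (simp_all only: real_norm_def abs_Re_mult_cis_le)

lemma abs_weight: "\<bar>weight k\<bar> = weight k"
  using weight_ge_1[of k] by simp

text \<open>Termwise differentiation: up to a constant, \<open>weight k * norm (a k)\<close> is a
  summable majorant of the differentiated terms, uniform in x and linear in v. The derivative is
  again a series of this kind, which is the closure that \<open>smooth_coinduct\<close> asks
  for.\<close>

lemma fourier_series_has_derivative:
  assumes "rapid a"
  shows "(fourier_series a has_derivative (\<lambda>v. fourier_series (\<lambda>k. \<i> * phase k v * a k) x)) (at x)"
proof -
  define M where "M = (\<lambda>k. 4 * pi * (weight k * norm (a k)))"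
  let ?f' = "\<lambda>k x v. Re (\<i> * phase k v * a k * cis (phase k x))"
  have rM: "rapid (\<lambda>k. of_real (weight k) * a k)"
    by (rule rapid_dominated[OF assms, of _ 1 1]) (simp_all add: norm_mult abs_weight)
  then have M: "summable M"
    using rapid_summable[OF rM] unfolding M_def
    by (intro summable_mult) (simp add: norm_mult abs_weight)
  have bound: "norm (?f' k x v) \<le> norm v * M k" for k x v
  proof -
    have "norm (?f' k x v) \<le> \<bar>phase k v\<bar> * norm (a k)"
      unfolding real_norm_def by (rule order_trans[OF abs_Re_le_cmod]) (simp add: norm_mult)
    also have "\<dots> \<le> (4 * pi * norm v * weight k) * norm (a k)"
      by (intro mult_right_mono phase_le) simp
    finally show ?thesis by (simp add: M_def mult_ac)
  qed
  have summ: "summable (\<lambda>k. ?f' k x v)" for x v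
    by (rule summable_comparison_test'[OF summable_mult[OF M, of "norm v"], of 0]) (rule bound)
  have "\<exists>g. \<forall>x\<in>UNIV. (\<lambda>k. Re (a k * cis (phase k x))) sums g x \<and>
      (g has_derivative (\<lambda>v. fourier_series (\<lambda>k. \<i> * phase k v * a k) x)) (at x within UNIV)"
  proof (rule has_derivative_series[where f' = ?f'])
    show "((\<lambda>x. Re (a k * cis (phase k x))) has_derivative ?f' k x) (at x within UNIV)" for k x
      unfolding phase_def
      by (auto intro!: derivative_eq_intros simp: fun_eq_iff algebra_simps)
  next
    fix e :: real assume "e > 0"
    then obtain N where N: "\<And>n. n \<ge> N \<Longrightarrow> norm (suminf (\<lambda>k. M (k + n))) < e"
      using suminf_exist_split[OF _ M] by blast
    have "norm ((\<Sum>k<n. ?f' k x v) - fourier_series (\<lambda>k. \<i> * phase k v * a k) x) \<le> e * norm v" if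
      "n \<ge> N" for n x v
    proof -
      have "fourier_series (\<lambda>k. \<i> * phase k v * a k) x
        = suminf (\<lambda>k. ?f' (k + n) x v) + (\<Sum>k<n. ?f' k x v)"
        unfolding fourier_series_def by (rule suminf_split_initial_segment[OF summ])
      then have "norm ((\<Sum>k<n. ?f' k x v) - fourier_series (\<lambda>k. \<i> * phase k v * a k) x)
        = norm (suminf (\<lambda>k. ?f' (k + n) x v))"
        by simp
      also have "\<dots> \<le> suminf (\<lambda>k. norm (?f' (k + n) x v))"
        by (intro summable_norm summable_comparison_test'[OF summable_mult[OF
          summable_ignore_initial_segment[OF M, of n], of "norm v"], of 0])
          (use bound in simp)
      also have "\<dots> \<le> suminf (\<lambda>k. norm v * M (k + n))"
        by (intro suminf_le bound summable_mult summable_ignore_initial_segment[OF M]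
            summable_comparison_test'[OF summable_mult[OF summable_ignore_initial_segment[OF M, of
              n], of "norm v"], of 0])
          (use bound in simp)
      also have "\<dots> = norm v * suminf (\<lambda>k. M (k + n))"
        by (intro suminf_mult summable_ignore_initial_segment M)
      also have "\<dots> \<le> norm v * e"
        using N[OF that] by (intro mult_left_mono) auto
      finally show ?thesis by (simp add: mult.commute)
    qed
    then show "\<forall>\<^sub>F n in sequentially. \<forall>x\<in>UNIV. \<forall>v. norm ((\<Sum>k<n. ?f' k x v) - fourier_series
      (\<lambda>k. \<i> * phase k v * a k) x) \<le> e * norm v"
      unfolding eventually_sequentially by blast
  qed (use fourier_series_sums[OF assms, of x] in auto)
  then obtain g where g: "\<And>x. (\<lambda>k. Re (a k * cis (phase k x))) sums g x"
      "\<And>x. (g has_derivative (\<lambda>v. fourier_series (\<lambda>k. \<i> * phase k v * a k) x)) (at x)"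
    by auto
  have "g = fourier_series a"
    using sums_unique2[OF g(1) fourier_series_sums[OF assms]] by (rule ext)
  then show ?thesis using g(2) by simp
qed

lemma rapid_phase: "rapid a \<Longrightarrow> rapid (\<lambda>k. \<i> * phase k v * a k)"
  by (rule rapid_dominated[where M = 1 and D = "4 * pi * norm v"])
    (auto simp: norm_mult intro!: mult_right_mono phase_le)

lemma smooth_fourier_series:
  assumes "rapid a"
  shows "smooth (fourier_series a)"
proof (rule smooth_coinduct[where S = "fourier_series ` Collect rapid"])
  fix g v x
  assume "g \<in> fourier_series ` Collect rapid"
  then obtain a where a: "rapid a" "g = fourier_series a" by auto
  show "g differentiable (at x)"
    using fourier_series_has_derivative[OF a(1)] unfolding a differentiable_def by blast
  have "dir_deriv v g = fourier_series (\<lambda>k. \<i> * phase k v * a k)"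
    unfolding a by (rule ext, rule dir_deriv_eq, rule fourier_series_has_derivative[OF a(1)])
  then show "dir_deriv v g \<in> fourier_series ` Collect rapid"
    using rapid_phase[OF a(1)] by auto
qed (use assms in auto)

lemma periodic_fourier_series: "periodic (fourier_series a)"
  by (rule periodicI) (simp_all add: fourier_series_def cis_phase_shift)

lemma pd_fourier_series:
  assumes "rapid a"
  shows "pd1 (fourier_series a) = fourier_series (\<lambda>k. \<i> * (2 * pi * freq1 k) * a k)"
    and "pd2 (fourier_series a) = fourier_series (\<lambda>k. \<i> * (2 * pi * freq2 k) * a k)"
  by (auto simp: pd1_eq_dir_deriv pd2_eq_dir_deriv smooth_fourier_series assms dir_deriv_eq[OF
    fourier_series_has_derivative[OF assms]] fun_eq_iff phase_def)

subsection \<open>The heat equation on the torus\<close>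

text \<open>Divide the coefficients by the symbol (2 pi m)^2 + 2 pi i n. It vanishes only at the
  zero mode, where f has coefficient \<open>mean f = 0\<close>; elsewhere its modulus is at least 1,
  so there are no small divisors and rapid decay persists.\<close>

lemma periodic_heat_solution:
  assumes f: "smooth f" "periodic f" "mean f = 0"
  obtains u where "smooth u" and "periodic u" and "mean u = 0"
    and "\<And>x. pd2 u x - pd1 (pd1 u) x = f x"
proof -
  define a where "a = fourier (\<lambda>x. of_real (f x))"
  define symb where "symb k = (2 * pi * freq1 k)\<^sup>2 + \<i> * (2 * pi * freq2 k)" for k
  define b where "b k = a k / symb k" for k \<comment> \<open>\<open>0\<close> at the zero mode, where \<open>a\<close> vanishes too\<close>
  have ra: "rapid a"
    unfolding a_def by (intro rapid_fourier f)
  have a0: "a k = 0" if "symb k = 0" for k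
  proof -
    have "freq1 k = 0" "freq2 k = 0"
      using that by (auto simp: symb_def complex_eq_iff)
    then have "a k = integral cell (\<lambda>x. of_real (f x))"
      by (simp add: a_def fourier_def phase_def)
    also have "\<dots> = of_real (mean f)"
      using integral_linear[OF smooth_integrable[OF f(1)] bounded_linear_of_real]
        by (simp add: o_def mean_def)
    finally show ?thesis using f(3) by simp
  qed
  have symb_ge_1: "1 \<le> norm (symb k)" if "symb k \<noteq> 0" for k
  proof (cases "freq1 k = 0")
    case True
    then have "\<bar>freq2 k\<bar> \<ge> 1"
      using that unfolding freq1_def freq2_def symb_def by auto
    then have "1 * 1 \<le> (2 * pi) * \<bar>freq2 k\<bar>"
      using pi_ge_two by (intro mult_mono) auto
    then show ?thesis
      using abs_Im_le_cmod[of "symb k"] by (simp add: symb_def abs_mult)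
  next
    case False
    then have "\<bar>freq1 k\<bar> \<ge> 1"
      unfolding freq1_def by (metis Ints_nonzero_abs_ge1 Ints_of_int)
    then have "1 * 1 \<le> (2 * pi) * \<bar>freq1 k\<bar>"
      using pi_ge_two by (intro mult_mono) auto
    then have "1 \<le> (2 * pi * freq1 k)\<^sup>2"
      using one_le_power[of "2 * pi * \<bar>freq1 k\<bar>" 2] by (simp add: power_mult_distrib)
    then show ?thesis
      using abs_Re_le_cmod[of "symb k"] by (simp add: symb_def power2_eq_square)
  qed
  have rb: "rapid b"
  proof (rule rapid_dominated[OF ra, of _ 1 0])
    show "norm (b k) \<le> 1 * weight k ^ 0 * norm (a k)" for k
    proof (cases "symb k = 0")
      case False
      have "norm (a k) * 1 \<le> norm (a k) * norm (symb k)"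
        by (intro mult_left_mono symb_ge_1 False) simp
      then show ?thesis
        using False by (simp add: b_def norm_divide divide_le_eq)
    qed (simp add: b_def)
  qed simp
  \<comment> \<open>Subtracting the mean secures \<open>mean u = 0\<close> without integrating the
    series; derivatives do not see it.\<close>
  define u where "u x = fourier_series b x - mean (fourier_series b)" for x
  have sm: "smooth (fourier_series b)" by (rule smooth_fourier_series[OF rb])
  have u: "smooth u" "periodic u" "mean u = 0"
    unfolding u_def by (auto intro!: smooth_diff sm periodic_arith periodic_fourier_series
      simp: mean_diff sm)
  have du: "pd1 u = pd1 (fourier_series b)" "pd2 u = pd2 (fourier_series b)"
    unfolding u_def pd1_eq_dir_deriv[OF u(1), unfolded u_def] pd2_eq_dir_deriv[OF u(1), unfolded
      u_def] pd1_eq_dir_deriv[OF sm] pd2_eq_dir_deriv[OF sm]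
    by (simp_all add: dir_deriv_diff sm dir_deriv_const)
  let ?b1 = "\<lambda>k. \<i> * (2 * pi * freq1 k) * b k"
  let ?b2 = "\<lambda>k. \<i> * (2 * pi * freq2 k) * b k"
  let ?b11 = "\<lambda>k. \<i> * (2 * pi * freq1 k) * ?b1 k"
  have r: "rapid ?b1" "rapid ?b2"
    using rapid_phase[OF rb, of "(1, 0)"] rapid_phase[OF rb, of "(0, 1)"]
      by (simp_all add: phase_def)
  then have r11: "rapid ?b11"
    using rapid_phase[OF r(1), of "(1, 0)"] by (simp add: phase_def)
  have "pd2 u x - pd1 (pd1 u) x = f x" for x
  proof -
    have "(\<lambda>k. Re (?b2 k * cis (phase k x)) - Re (?b11 k * cis (phase k x)))
      sums (pd2 u x - pd1 (pd1 u) x)"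
      unfolding du pd_fourier_series[OF rb] pd_fourier_series[OF r(1)]
        by (intro sums_diff fourier_series_sums r r11)
    moreover have "Re (?b2 k * cis (phase k x)) - Re (?b11 k * cis (phase k x))
      = Re (a k * cis (phase k x))" for k
    proof -
      have "?b2 k - ?b11 k = symb k * b k"
        by (simp add: symb_def power2_eq_square algebra_simps)
      also have "\<dots> = a k"
        using a0 by (simp add: b_def)
      finally show ?thesis by (metis left_diff_distrib minus_complex.sel(1))
    qed
    ultimately have "(\<lambda>k. Re (a k * cis (phase k x))) sums (pd2 u x - pd1 (pd1 u) x)" by simp
    then show ?thesis
      using sums_unique2[OF _ fourier_series_sums[OF ra]] fourier_inversion[OF f(1,2)] a_def
        by metis
  qed
  with u that show ?thesis by blast
qed

subsection \<open>Polynomials with periodic coefficients\<close>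

definition periodic_funs :: "(plane \<Rightarrow> real) set" where
  "periodic_funs = {f. smooth f \<and> periodic f}"
definition mean_free_funs :: "(plane \<Rightarrow> real) set" where
  "mean_free_funs = {f. smooth f \<and> periodic f \<and> mean f = 0}"
definition const_funs :: "(plane \<Rightarrow> real) set" where
  "const_funs = range (\<lambda>c _. c)"

text \<open>The closure needed for polynomials with coefficients in K to be stable under linear
  combinations, D1 and D2. Products are left out because the mean-free functions are not closed
  under them.\<close>

definition coeff_space :: "(plane \<Rightarrow> real) set \<Rightarrow> bool" where
  "coeff_space K \<longleftrightarrow> K \<subseteq> periodic_funs \<and> (\<lambda>_. 0) \<in> K \<and> (\<forall>f\<in>K. \<forall>g\<in>K. (\<lambda>x. f x + g x) \<in> K) \<and>
     (\<forall>f\<in>K. \<forall>c. (\<lambda>x. c * f x) \<in> K) \<and> (\<forall>f\<in>K. pd1 f \<in> K \<and> pd2 f \<in> K)"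

lemma pd_const [simp]: "pd1 (\<lambda>_. c) = (\<lambda>_. 0)" "pd2 (\<lambda>_. c) = (\<lambda>_. 0)"
  by (simp_all add: pd1_def pd2_def fun_eq_iff)

lemma coeff_space_periodic_funs: "coeff_space periodic_funs"
  unfolding coeff_space_def periodic_funs_def
  by (auto intro: smooth_add smooth_cmult smooth_pd1 smooth_pd2 periodic_pd1 periodic_pd2)

lemma coeff_space_mean_free_funs: "coeff_space mean_free_funs"
  unfolding coeff_space_def periodic_funs_def mean_free_funs_def
  by (auto intro: smooth_add smooth_cmult smooth_pd1 smooth_pd2 periodic_pd1 periodic_pd2
      simp: mean_add mean_cmult mean_pd1 mean_pd2)

lemma coeff_space_const_funs: "coeff_space const_funs"
  unfolding coeff_space_def periodic_funs_def const_funs_def by auto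

lemma mean_free_funs_subset: "mean_free_funs \<subseteq> periodic_funs" and const_funs_subset:
  "const_funs \<subseteq> periodic_funs"
  using coeff_space_mean_free_funs coeff_space_const_funs by (auto simp: coeff_space_def)

text \<open>The bound r is real because it will be a homogeneity minus a real offset; for r < 0 only
  the zero polynomial remains, so negative bounds need no separate treatment.\<close>

inductive per_poly :: "(plane \<Rightarrow> real) set \<Rightarrow> real \<Rightarrow> (plane \<Rightarrow> plane \<Rightarrow> real) \<Rightarrow> bool" for K r where
  zero: "per_poly K r (\<lambda>_ _. 0)"
| step: "per_poly K r U \<Longrightarrow> f \<in> K \<Longrightarrow> real (wdeg n) \<le> r \<Longrightarrow> per_poly K r
  (\<lambda>x' y. U x' y + f x' * monom2 y n)"

lemma per_poly_monom: "f \<in> K \<Longrightarrow> real (wdeg n) \<le> r \<Longrightarrow> per_poly K r (\<lambda>x' y. f x' * monom2 y n)"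
  using per_poly.step[OF per_poly.zero] by simp

lemma per_poly_add: "per_poly K r V \<Longrightarrow> per_poly K r U \<Longrightarrow> per_poly K r (\<lambda>x' y. U x' y + V x' y)"
proof (induction rule: per_poly.induct)
  case (step V f n)
  from per_poly.step[OF step.IH[OF step.prems] step.hyps(2,3)] show ?case
    by (simp add: add.assoc)
qed simp

lemma per_poly_mono: "per_poly K r U \<Longrightarrow> K \<subseteq> K' \<Longrightarrow> r \<le> r' \<Longrightarrow> per_poly K' r' U"
  by (induction rule: per_poly.induct) (auto intro!: per_poly.intros)

lemma per_poly_cmult:
  assumes "coeff_space K" and "per_poly K r U"
  shows "per_poly K r (\<lambda>x' y. c * U x' y)"
  using assms(2)
proof (induction rule: per_poly.induct)
  case (step U f n)
  have "(\<lambda>x. c * f x) \<in> K" using assms(1) step.hyps by (auto simp: coeff_space_def)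
  from per_poly.step[OF step.IH this step.hyps(3)] show ?case
    by (simp add: algebra_simps)
qed (simp add: per_poly.zero)

lemma per_poly_diff: "coeff_space K \<Longrightarrow> per_poly K r U \<Longrightarrow> per_poly K r V
  \<Longrightarrow> per_poly K r (\<lambda>x' y. U x' y - V x' y)"
  using per_poly_add[OF per_poly_cmult[of K r V "-1"], of U] by simp

lemma per_poly_mult_monom:
  assumes "\<And>f g. f \<in> K \<Longrightarrow> g \<in> K' \<Longrightarrow> (\<lambda>x. f x * g x) \<in> K''" and "per_poly K r U"
    and "g \<in> K'" and "real (wdeg m) \<le> r'"
  shows "per_poly K'' (r + r') (\<lambda>x' y. U x' y * (g x' * monom2 y m))"
  using assms(2)
proof (induction rule: per_poly.induct)
  case (step U f n)
  let ?n = "(fst n + fst m, snd n + snd m)"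
  have "per_poly K'' (r + r') (\<lambda>x' y. U x' y * (g x' * monom2 y m) + (f x' * g x') * monom2 y ?n)"
    using step.hyps(3) assms(4)
      by (intro per_poly.step[OF step.IH assms(1)] step.hyps assms(3)) (simp add: wdeg_def)
  then show ?case
    by (simp add: monom2_def power_add algebra_simps)
qed (simp add: per_poly.zero)

lemma per_poly_mult:
  assumes "\<And>f g. f \<in> K \<Longrightarrow> g \<in> K' \<Longrightarrow> (\<lambda>x. f x * g x) \<in> K''" and "per_poly K r U" and "per_poly K' r' V"
  shows "per_poly K'' (r + r') (\<lambda>x' y. U x' y * V x' y)"
  using assms(3)
proof (induction rule: per_poly.induct)
  case (step V g m)
  from per_poly_add[OF per_poly_mult_monom[OF assms(1,2) step.hyps(2,3)] step.IH]
  show ?case by (simp add: algebra_simps)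
qed (simp add: per_poly.zero)

lemma per_poly_mult_periodic: "per_poly periodic_funs r U \<Longrightarrow> per_poly periodic_funs r' V
  \<Longrightarrow> per_poly periodic_funs (r + r') (\<lambda>x' y. U x' y * V x' y)"
  by (rule per_poly_mult[where K = periodic_funs and K' = periodic_funs]) (auto
    simp: periodic_funs_def intro: smooth_mult)

lemma per_poly_mult_const: "per_poly const_funs r U \<Longrightarrow> per_poly const_funs r' V
  \<Longrightarrow> per_poly const_funs (r + r') (\<lambda>x' y. U x' y * V x' y)"
  by (rule per_poly_mult[where K = const_funs and K' = const_funs]) (auto simp: const_funs_def)

lemma per_poly_mult_mean_free_const: "per_poly mean_free_funs r U \<Longrightarrow> per_poly const_funs r' V
  \<Longrightarrow> per_poly mean_free_funs (r + r') (\<lambda>x' y. U x' y * V x' y)"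
  by (rule per_poly_mult[where K = mean_free_funs and K' = const_funs])
    (use coeff_space_mean_free_funs in \<open>auto simp: const_funs_def coeff_space_def mult.commute\<close>)

lemma per_poly_const: "0 \<le> r \<Longrightarrow> per_poly const_funs r (\<lambda>_ _. c)"
  using per_poly_monom[of "\<lambda>_. c" const_funs "(0, 0)" r]
    by (simp add: const_funs_def wdeg_def monom2_def)

lemma per_poly_const_indep: "per_poly const_funs r U \<Longrightarrow> U a y = U b y"
  by (induction rule: per_poly.induct) (auto simp: const_funs_def)

subsection \<open>Derivatives of polynomials with periodic coefficients\<close>

lemma smooth_fst_snd: "smooth fst" "smooth snd"
proof -
  have fd: "dir_deriv v fst = (\<lambda>_. fst v)" "dir_deriv v snd = (\<lambda>_. snd v)" for v
    by (auto simp: fun_eq_iff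
      intro!: dir_deriv_eq bounded_linear_imp_has_derivative bounded_linear_fst bounded_linear_snd)
  show "smooth fst"
    by (rule smooth_coinduct[where S = "insert fst (range (\<lambda>c _. c))"])
      (auto simp: fd dir_deriv_const intro: bounded_linear_imp_differentiable bounded_linear_fst)
  show "smooth snd"
    by (rule smooth_coinduct[where S = "insert snd (range (\<lambda>c _. c))"])
      (auto simp: fd dir_deriv_const intro: bounded_linear_imp_differentiable bounded_linear_snd)
qed

lemma smooth_power: "smooth f \<Longrightarrow> smooth (\<lambda>x. f x ^ n)"
  by (induction n) (auto intro: smooth_mult)

lemma smooth_monom2: "smooth (\<lambda>y. monom2 (y - x) n)"
  unfolding monom2_def
  by (simp add: smooth_mult smooth_power smooth_diff smooth_fst_snd)

lemma smooth_monom2_0: "smooth (\<lambda>y. monom2 y n)"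
  using smooth_monom2[of "0" n] by simp

definition regular :: "(plane \<Rightarrow> plane \<Rightarrow> real) \<Rightarrow> bool" where
  "regular U \<longleftrightarrow> (\<forall>x' y. smooth (\<lambda>z. U z y) \<and> smooth (\<lambda>z. U x' z))"

lemma per_poly_regular: "per_poly periodic_funs r U \<Longrightarrow> regular U"
  by (induction rule: per_poly.induct)
    (auto simp: regular_def periodic_funs_def intro!: smooth_add smooth_mult smooth_monom2_0)

lemma D_add:
  assumes "regular U" and "regular V"
  shows "D1 (\<lambda>x' y. U x' y + V x' y) = (\<lambda>x' y. D1 U x' y + D1 V x' y)"
    and "D2 (\<lambda>x' y. U x' y + V x' y) = (\<lambda>x' y. D2 U x' y + D2 V x' y)"
  using assms by (auto simp: D1_def D2_def fun_eq_iff regular_def pd1_eq_dir_deriv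
    pd2_eq_dir_deriv smooth_add dir_deriv_add)

lemma D_cmult:
  assumes "regular U"
  shows "D1 (\<lambda>x' y. c * U x' y) = (\<lambda>x' y. c * D1 U x' y)"
    and "D2 (\<lambda>x' y. c * U x' y) = (\<lambda>x' y. c * D2 U x' y)"
  using assms by (auto simp: D1_def D2_def fun_eq_iff regular_def pd1_eq_dir_deriv
    pd2_eq_dir_deriv smooth_cmult dir_deriv_cmult distrib_left)

lemma D_zero [simp]: "D1 (\<lambda>_ _. 0) = (\<lambda>_ _. 0)" "D2 (\<lambda>_ _. 0) = (\<lambda>_ _. 0)"
  by (simp_all add: D1_def D2_def fun_eq_iff)

text \<open>Truncated subtraction is harmless: the factor in front is zero when the exponent
  is.\<close>

lemma pd_monom2:
  "pd1 (\<lambda>y. monom2 (y - x) n) y = real (fst n) * monom2 (y - x) (fst n - 1, snd n)"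
  "pd2 (\<lambda>y. monom2 (y - x) n) y = real (snd n) * monom2 (y - x) (fst n, snd n - 1)"
  unfolding pd1_def pd2_def monom2_def by (auto intro!: DERIV_imp_deriv derivative_eq_intros)

lemma D_term:
  assumes "smooth f"
  shows "D1 (\<lambda>x' y. f x' * monom2 (y - x) n)
      = (\<lambda>x' y. pd1 f x' * monom2 (y - x) n + (real (fst n) * f x') * monom2 (y - x)
        (fst n - 1, snd n))"
    and "D2 (\<lambda>x' y. f x' * monom2 (y - x) n)
      = (\<lambda>x' y. pd2 f x' * monom2 (y - x) n + (real (snd n) * f x') * monom2 (y - x)
        (fst n, snd n - 1))"
proof -
  have A: "pd1 (\<lambda>x. f x * c) = (\<lambda>x. pd1 f x * c)" "pd2 (\<lambda>x. f x * c) = (\<lambda>x. pd2 f x * c)" for c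
    using assms by (simp_all add: pd1_eq_dir_deriv pd2_eq_dir_deriv smooth_mult dir_deriv_mult
      dir_deriv_const)
  have B: "pd1 (\<lambda>y. c * monom2 (y - x) n) = (\<lambda>y. c * pd1 (\<lambda>y. monom2 (y - x) n) y)"
    "pd2 (\<lambda>y. c * monom2 (y - x) n) = (\<lambda>y. c * pd2 (\<lambda>y. monom2 (y - x) n) y)" for c
    by (simp_all add: pd1_eq_dir_deriv pd2_eq_dir_deriv smooth_cmult smooth_monom2 dir_deriv_cmult)
  show "D1 (\<lambda>x' y. f x' * monom2 (y - x) n)
      = (\<lambda>x' y. pd1 f x' * monom2 (y - x) n + (real (fst n) * f x') * monom2 (y - x)
        (fst n - 1, snd n))"
    "D2 (\<lambda>x' y. f x' * monom2 (y - x) n)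
      = (\<lambda>x' y. pd2 f x' * monom2 (y - x) n + (real (snd n) * f x') * monom2 (y - x)
        (fst n, snd n - 1))"
    unfolding D1_def D2_def A B pd_monom2 by (simp_all add: mult_ac)
qed

lemmas D_term_0 = D_term[where x = 0, simplified]

lemma regular_term: "smooth f \<Longrightarrow> regular (\<lambda>x' y. f x' * monom2 y n)"
  by (auto simp: regular_def intro!: smooth_mult smooth_monom2_0)

lemma per_poly_D:
  assumes K: "coeff_space K" and "per_poly K r U"
  shows "per_poly K r (D1 U)" and "per_poly K r (D2 U)"
proof -
  have "per_poly K r (D1 U) \<and> per_poly K r (D2 U)"
    using assms(2)
  proof (induction rule: per_poly.induct)
    case (step U f n)
    have f: "smooth f" "regular U"
      using K step.hyps per_poly_regular[OF per_poly_mono[of K r U]]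
        by (auto simp: coeff_space_def periodic_funs_def)
    have c: "pd1 f \<in> K" "pd2 f \<in> K" "(\<lambda>x. c * f x) \<in> K" for c
      using K step.hyps by (auto simp: coeff_space_def)
    have "real (wdeg (fst n - Suc 0, snd n)) \<le> r" "real (wdeg (fst n, snd n - Suc 0)) \<le> r"
      using step.hyps(3) by (auto simp: wdeg_def)
    then show ?case
      unfolding D_add[OF f(2) regular_term[OF f(1)]] D_term_0[OF f(1)]
      by (intro conjI per_poly_add per_poly_monom c step.IH[THEN conjunct1] step.IH[THEN
        conjunct2] step.hyps)
  qed (simp add: per_poly.zero)
  then show "per_poly K r (D1 U)" "per_poly K r (D2 U)" by auto
qed

text \<open>A derivative can only fall on the monomial, so the weighted degree drops by 1 or 2.
  Monomials without the differentiated variable contribute zero, so the lowered bound may be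
  negative.\<close>

lemma per_poly_D_const:
  assumes "per_poly const_funs r U"
  shows "per_poly const_funs (r - 1) (D1 U)" and "per_poly const_funs (r - 2) (D2 U)"
proof -
  have "per_poly const_funs (r - 1) (D1 U) \<and> per_poly const_funs (r - 2) (D2 U)"
    using assms
  proof (induction rule: per_poly.induct)
    case (step U f n)
    have f: "smooth f" "regular U" "pd1 f = (\<lambda>_. 0)" "pd2 f = (\<lambda>_. 0)"
      using step.hyps per_poly_regular[OF per_poly_mono[OF _ const_funs_subset order_refl]]
        by (auto simp: const_funs_def)
    have c: "(\<lambda>x. c * f x) \<in> const_funs" for c
      using step.hyps by (auto simp: const_funs_def)
    have "per_poly const_funs (r - 1) (\<lambda>x' y. (real (fst n) * f x') * monom2 y (fst n - 1, snd n))"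
    proof (cases "fst n = 0")
      case False
      then show ?thesis using step.hyps(3) by (intro per_poly_monom c) (simp add: wdeg_def)
    qed (simp add: per_poly.zero)
    moreover have "per_poly const_funs (r - 2) (\<lambda>x' y. (real (snd n) * f x') * monom2 y
      (fst n, snd n - 1))"
    proof (cases "snd n = 0")
      case False
      then show ?thesis using step.hyps(3) by (intro per_poly_monom c) (simp add: wdeg_def)
    qed (simp add: per_poly.zero)
    ultimately show ?case
      unfolding D_add[OF f(2) regular_term[OF f(1)]] D_term_0[OF f(1)] f(3,4)
      using step.IH by (simp add: per_poly_add)
  qed (simp add: per_poly.zero)
  then show "per_poly const_funs (r - 1) (D1 U)" "per_poly const_funs (r - 2) (D2 U)" by auto
qed

lemma per_poly_shift_monom2: "per_poly const_funs (real (wdeg n)) (\<lambda>_ y. monom2 (y - x) n)"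
proof -
  have power: "per_poly const_funs (real (m * k)) (\<lambda>_ y. f y ^ k)" if
    "per_poly const_funs (real m) (\<lambda>_ y. f y)" for f :: "plane \<Rightarrow> real" and m k
  proof (induction k)
    case (Suc k)
    from per_poly_mult_const[OF that Suc.IH] show ?case by (simp add: algebra_simps)
  qed (simp add: per_poly_const)
  have one: "(\<lambda>_. 1) \<in> const_funs" by (simp add: const_funs_def)
  have "per_poly const_funs (real 1) (\<lambda>_ y. fst y + - fst x)"
    by (intro per_poly_add per_poly_const) (use per_poly_monom[OF one, of
      "(1, 0)" 1] in \<open>simp_all add: wdeg_def monom2_def\<close>)
  moreover have "per_poly const_funs (real 2) (\<lambda>_ y. snd y + - snd x)"
    by (intro per_poly_add per_poly_const) (use per_poly_monom[OF one, of
      "(0, 1)" 2] in \<open>simp_all add: wdeg_def monom2_def\<close>)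
  ultimately have "per_poly const_funs (real (1 * fst n) + real (2 * snd n)) (\<lambda>_ y.
    (fst y + - fst x) ^ fst n * (snd y + - snd x) ^ snd n)"
    by (intro per_poly_mult_const power)
  then show ?thesis by (simp add: wdeg_def monom2_def)
qed

subsection \<open>The heat operator\<close>

definition heat :: "(plane \<Rightarrow> plane \<Rightarrow> real) \<Rightarrow> plane \<Rightarrow> plane \<Rightarrow> real" where
  "heat U x' y = D2 U x' y - D1 (D1 U) x' y"

lemma heat_add:
  assumes "per_poly periodic_funs r U" and "per_poly periodic_funs r' V"
  shows "heat (\<lambda>x' y. U x' y + V x' y) = (\<lambda>x' y. heat U x' y + heat V x' y)"
  using assms[THEN per_poly_regular] assms[THEN per_poly_D(1)[OF coeff_space_periodic_funs], THEN
    per_poly_regular]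
  by (simp add: heat_def[abs_def] D_add algebra_simps)

lemma heat_cmult:
  assumes "per_poly periodic_funs r U"
  shows "heat (\<lambda>x' y. c * U x' y) = (\<lambda>x' y. c * heat U x' y)"
  using assms[THEN per_poly_regular] assms[THEN per_poly_D(1)[OF coeff_space_periodic_funs], THEN
    per_poly_regular]
  by (simp add: heat_def[abs_def] D_cmult right_diff_distrib)

lemma heat_zero [simp]: "heat (\<lambda>_ _. 0) = (\<lambda>_ _. 0)"
  by (simp add: heat_def fun_eq_iff)

lemma per_poly_D1_D1_const: "per_poly const_funs r U \<Longrightarrow> per_poly const_funs (r - 2) (D1 (D1 U))"
  using per_poly_D_const(1)[OF per_poly_D_const(1)[of r U]] by (simp add: algebra_simps)

lemma per_poly_heat_const: "per_poly const_funs r U \<Longrightarrow> per_poly const_funs (r - 2) (heat U)"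
  unfolding heat_def[abs_def]
    by (intro per_poly_diff coeff_space_const_funs per_poly_D_const(2) per_poly_D1_D1_const)

lemma per_poly_mean_free_imp_periodic: "per_poly mean_free_funs r U \<Longrightarrow> per_poly periodic_funs r U"
  by (erule per_poly_mono[OF _ mean_free_funs_subset order_refl])

lemma per_poly_const_imp_periodic: "per_poly const_funs r U \<Longrightarrow> per_poly periodic_funs r U"
  by (erule per_poly_mono[OF _ const_funs_subset order_refl])

lemma mean_free_cmult: "f \<in> mean_free_funs \<Longrightarrow> (\<lambda>x. c * f x) \<in> mean_free_funs"
  using coeff_space_mean_free_funs by (auto simp: coeff_space_def)

lemma heat_term:
  assumes "smooth u"
  shows "heat (\<lambda>x' y. u x' * monom2 y (a, b)) = (\<lambda>x' y. (pd2 u x' - pd1 (pd1 u) x') * monom2 y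
    (a, b)
    + ((real b * u x') * monom2 y (a, b - 1)
    + ((- 2 * real a * pd1 u x') * monom2 y (a - 1, b)
    + (- real a * real (a - 1) * u x') * monom2 y (a - 2, b))))"
proof -
  have sm: "smooth (pd1 u)" "smooth (\<lambda>x. real a * u x)"
    by (simp_all add: assms smooth_pd1 smooth_cmult)
  have pd: "pd1 (\<lambda>x. real a * u x) = (\<lambda>x. real a * pd1 u x)"
    by (simp add: pd1_eq_dir_deriv assms sm dir_deriv_cmult)
  have "D1 (D1 (\<lambda>x' y. u x' * monom2 y (a, b))) = (\<lambda>x' y.
     (pd1 (pd1 u) x' * monom2 y (a, b) + (real a * pd1 u x') * monom2 y (a - 1, b)) +
     ((real a * pd1 u x') * monom2 y (a - 1, b) + (real (a - 1) * (real a * u x')) * monom2 y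
       (a - 1 - 1, b)))"
    using D_add(1)[OF regular_term regular_term, OF sm] by (simp add: D_term_0 assms sm pd)
  then show ?thesis
    by (simp add: heat_def fun_eq_iff D_term_0 assms algebra_simps numeral_2_eq_2)
qed

text \<open>Solving for the coefficient of \<open>y\<^sup>n\<close> leaves an error of lower degree with mean-free
  coefficients.\<close>

lemma heat_solve_term:
  "f \<in> mean_free_funs \<Longrightarrow> \<exists>U. per_poly mean_free_funs (real (wdeg n)) U \<and> heat U
    = (\<lambda>x' y. f x' * monom2 y n)"
proof (induction "wdeg n" arbitrary: f n rule: less_induct)
  case less
  obtain a b where n: "n = (a, b)" by force
  obtain u where u: "smooth u" "periodic u" "mean u = 0" "\<And>x. pd2 u x - pd1 (pd1 u) x = f x"
    using periodic_heat_solution[of f] less.prems by (auto simp: mean_free_funs_def)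
  have uK: "u \<in> mean_free_funs" "pd1 u \<in> mean_free_funs"
    using u coeff_space_mean_free_funs
      by (auto simp: coeff_space_def mean_free_funs_def smooth_pd1 periodic_pd1 mean_pd1)
  \<comment> \<open>If a or b is too small for the truncated exponent to lower the degree, the
    prefactor c is zero; hence the degree hypothesis is asked only for nonzero c.\<close>
  have lower: "\<exists>U. per_poly mean_free_funs (real (wdeg n)) U \<and> heat U
    = (\<lambda>x' y. (c * g x') * monom2 y m)"
    if "g \<in> mean_free_funs" "c \<noteq> 0 \<Longrightarrow> wdeg m < wdeg n" for c g m
  proof (cases "c = 0")
    case True
    then show ?thesis by (intro exI[of _ "\<lambda>_ _. 0"]) (simp add: per_poly.zero)
  next
    case False
    from less.hyps[OF that(2)[OF this] mean_free_cmult[OF that(1), of c]] obtain U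
      where U: "per_poly mean_free_funs (real (wdeg m)) U"
        "heat U = (\<lambda>x' y. (c * g x') * monom2 y m)" by blast
    have "per_poly mean_free_funs (real (wdeg n)) U"
      by (rule per_poly_mono[OF U(1)]) (use that(2)[OF False] in auto)
    with U(2) show ?thesis by blast
  qed
  obtain U1 where U1: "per_poly mean_free_funs (real (wdeg n)) U1"
    "heat U1 = (\<lambda>x' y. (real b * u x') * monom2 y (a, b - 1))"
    using lower[of u "real b" "(a, b - 1)"] uK by (auto simp: n wdeg_def)
  obtain U2 where U2: "per_poly mean_free_funs (real (wdeg n)) U2"
    "heat U2 = (\<lambda>x' y. (- 2 * real a * pd1 u x') * monom2 y (a - 1, b))"
    using lower[of "pd1 u" "- 2 * real a" "(a - 1, b)"] uK by (auto simp: n wdeg_def)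
  obtain U3 where U3: "per_poly mean_free_funs (real (wdeg n)) U3"
    "heat U3 = (\<lambda>x' y. (- real a * real (a - 1) * u x') * monom2 y (a - 2, b))"
    using lower[of u "- real a * real (a - 1)" "(a - 2, b)"] uK by (auto simp: n wdeg_def)
  let ?W = "\<lambda>x' y. u x' * monom2 y n"
  let ?V = "\<lambda>x' y. U1 x' y + (U2 x' y + U3 x' y)"
  let ?U = "\<lambda>x' y. ?W x' y + - 1 * ?V x' y"
  have U0: "per_poly mean_free_funs (real (wdeg n)) ?W" by (intro per_poly_monom uK) simp
  have V: "per_poly mean_free_funs (real (wdeg n)) ?V" by (intro per_poly_add U1 U2 U3)
  have "heat ?V = (\<lambda>x' y. heat U1 x' y + (heat U2 x' y + heat U3 x' y))"
    using heat_add[OF per_poly_mean_free_imp_periodic[OF U1(1)] per_poly_mean_free_imp_periodic[OF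
      per_poly_add[OF U3(1) U2(1)]]]
      heat_add[OF per_poly_mean_free_imp_periodic[OF U2(1)] per_poly_mean_free_imp_periodic[OF
        U3(1)]] by simp
  moreover have "heat ?U = (\<lambda>x' y. heat ?W x' y + - 1 * heat ?V x' y)"
    using heat_add[OF per_poly_mean_free_imp_periodic[OF U0] per_poly_mean_free_imp_periodic[OF
      per_poly_cmult[OF coeff_space_mean_free_funs V, of "- 1"]]]
      heat_cmult[OF per_poly_mean_free_imp_periodic[OF V], of "- 1"] by simp
  ultimately have "heat ?U = (\<lambda>x' y. f x' * monom2 y n)"
    by (simp add: U1(2) U2(2) U3(2) n heat_term[OF u(1)] u(4))
  moreover have "per_poly mean_free_funs (real (wdeg n)) ?U"
    using per_poly_add[OF per_poly_cmult[OF coeff_space_mean_free_funs V, of "- 1"] U0] by simp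
  ultimately show ?case by blast
qed

lemma heat_solve:
  assumes "per_poly mean_free_funs r F"
  obtains U where "per_poly mean_free_funs r U" and "heat U = F"
proof -
  have "\<exists>U. per_poly mean_free_funs r U \<and> heat U = F"
    using assms
  proof (induction rule: per_poly.induct)
    case zero
    show ?case by (intro exI[of _ "\<lambda>_ _. 0"]) (simp add: per_poly.zero)
  next
    case (step F f n)
    then obtain U where U: "per_poly mean_free_funs r U" "heat U = F" by blast
    obtain V where V: "per_poly mean_free_funs (real (wdeg n)) V"
      "heat V = (\<lambda>x' y. f x' * monom2 y n)"
      using heat_solve_term[OF step.hyps(2)] by blast
    have V': "per_poly mean_free_funs r V" by (rule per_poly_mono[OF V(1) order_refl step.hyps(3)])
    have "heat (\<lambda>x' y. U x' y + V x' y) = (\<lambda>x' y. F x' y + f x' * monom2 y n)"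
      using heat_add[OF per_poly_mean_free_imp_periodic[OF U(1)]
        per_poly_mean_free_imp_periodic[OF V']] U(2) V(2) by simp
    with per_poly_add[OF V' U(1)] show ?case by blast
  qed
  with that show ?thesis by blast
qed

subsection \<open>Taylor polynomials\<close>

lemma per_poly_Dn:
  assumes "coeff_space K" and "per_poly K r U"
  shows "per_poly K r (Dn n U)"
proof -
  have D2: "per_poly K r ((D2 ^^ k) U)" for k
    by (induction k) (simp_all add: assms per_poly_D)
  have "per_poly K r ((D1 ^^ j) ((D2 ^^ k) U))" for j k
    by (induction j) (simp_all add: D2 assms per_poly_D)
  then show ?thesis unfolding Dn_def by blast
qed

lemma Dn_add:
  assumes "per_poly periodic_funs r U" and "per_poly periodic_funs r V"
  shows "Dn n (\<lambda>x' y. U x' y + V x' y) = (\<lambda>x' y. Dn n U x' y + Dn n V x' y)"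
proof -
  have per_poly: "per_poly periodic_funs r (Dn (j, k) U)"
    "per_poly periodic_funs r (Dn (j, k) V)" for j k
    using assms by (simp_all add: per_poly_Dn[OF coeff_space_periodic_funs])
  have D2: "(D2 ^^ k) (\<lambda>x' y. U x' y + V x' y) = (\<lambda>x' y. (D2 ^^ k) U x' y + (D2 ^^ k) V x' y)" for k
  proof (induction k)
    case (Suc k)
    then show ?case
      using per_poly[of 0 k] by (simp add: D_add(2) per_poly_regular Dn_def)
  qed simp
  have "(D1 ^^ j) ((D2 ^^ k) (\<lambda>x' y. U x' y + V x' y))
    = (\<lambda>x' y. (D1 ^^ j) ((D2 ^^ k) U) x' y + (D1 ^^ j) ((D2 ^^ k) V) x' y)" for j k
  proof (induction j)
    case (Suc j)
    then show ?case
      using per_poly[of j k] by (simp add: D_add(1) per_poly_regular Dn_def)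
  qed (simp add: D2)
  then show ?thesis by (simp add: Dn_def)
qed

text \<open>The falling factorials also use truncated subtraction: for j > a the factor with i = a
  is zero, so the formula stays right although the exponent a - j is cut off at 0; likewise for k
  and b.\<close>

lemma Dn_shift_monom2:
  "Dn (j, k) (\<lambda>_ y. c * monom2 (y - x) (a, b))
    = (\<lambda>_ y. c * (\<Prod>i<j. real (a - i)) * (\<Prod>i<k. real (b - i)) * monom2 (y - x) (a - j, b - k))"
proof -
  have "(D2 ^^ k) (\<lambda>_ y. c * monom2 (y - x) (a, b))
    = (\<lambda>_ y. c * (\<Prod>i<k. real (b - i)) * monom2 (y - x) (a, b - k))"
  proof (induction k)
    case (Suc k)
    then show ?case
      using D_term(2)[OF smooth_const, of "c * (\<Prod>i<k. real (b - i))" x "(a, b - k)"]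
        by (simp add: mult_ac)
  qed simp
  moreover have "(D1 ^^ j) (\<lambda>_ y. d * monom2 (y - x) (a, l))
    = (\<lambda>_ y. d * (\<Prod>i<j. real (a - i)) * monom2 (y - x) (a - j, l))" for d l
  proof (induction j)
    case (Suc j)
    then show ?case
      using D_term(1)[OF smooth_const, of "d * (\<Prod>i<j. real (a - i))" x "(a - j, l)"]
        by (simp add: mult_ac)
  qed simp
  ultimately show ?thesis unfolding Dn_def by (simp only: fst_conv snd_conv) (simp only: mult_ac)
qed

text \<open>At the base point derivatives and shifted monomials are dual up to nonzero factors: too
  few derivatives leave a positive power of y - x, too many produce a zero factor.\<close>

lemma Dn_shift_monom2_base:
  "m \<noteq> n \<Longrightarrow> Dn m (\<lambda>_ y. c * monom2 (y - x) n) x x = 0"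
  "c \<noteq> 0 \<Longrightarrow> Dn n (\<lambda>_ y. c * monom2 (y - x) n) x x \<noteq> 0"
proof -
  obtain a b j k where mn: "m = (j, k)" "n = (a, b)" by force
  show "Dn m (\<lambda>_ y. c * monom2 (y - x) n) x x = 0" if "m \<noteq> n"
  proof -
    have "j < a \<or> j > a \<or> k < b \<or> k > b" using that mn by auto
    then show ?thesis unfolding mn Dn_shift_monom2
      by (auto simp: monom2_def power_0_left)
  qed
  show "Dn n (\<lambda>_ y. c * monom2 (y - x) n) x x \<noteq> 0" if "c \<noteq> 0"
    unfolding mn Dn_shift_monom2 using that by (auto simp: monom2_def)
qed

lemma taylor_polynomial:
  assumes "finite N" and "\<And>n. n \<in> N \<Longrightarrow> real (wdeg n) \<le> t"
  shows "\<exists>T. per_poly const_funs t T \<and> (\<forall>n. Dn n T x x = (if n \<in> N then d n else 0))"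
  using assms
proof (induction N rule: finite_induct)
  case empty
  have "Dn n (\<lambda>_ _. 0) = (\<lambda>_ _. 0)" for n
    using Dn_shift_monom2[of "fst n" "snd n" 0 x 0 0] by simp
  then show ?case by (intro exI[of _ "\<lambda>_ _. 0"]) (simp add: per_poly.zero)
next
  case (insert m N)
  then obtain T where T: "per_poly const_funs t T" "\<And>n. Dn n T x x = (if n \<in> N then d n else 0)"
    by auto
  let ?w = "Dn m (\<lambda>_ y. 1 * monom2 (y - x) m) x x"
  \<comment> \<open>Among the derivatives at x, the added monomial changes the m-th alone, so the
    conditions already met are kept.\<close>
  define c where "c = d m / ?w"
  let ?M = "\<lambda>_ y. c * monom2 (y - x) m"
  have M: "per_poly const_funs t ?M"
    by (rule per_poly_mono[OF per_poly_cmult[OF coeff_space_const_funs per_poly_shift_monom2]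
      order_refl insert.prems]) simp
  have "Dn m ?M x x = c * ?w"
    using Dn_shift_monom2[of "fst m" "snd m" 1 x "fst m" "snd m"]
    by (cases m) (simp add: Dn_shift_monom2)
  then have "Dn m ?M x x = d m"
    using Dn_shift_monom2_base(2)[of 1 m x] by (simp add: c_def)
  moreover have "Dn n (\<lambda>x' y. T x' y + ?M x' y) x x = Dn n T x x + Dn n ?M x x" for n
    using Dn_add[OF per_poly_const_imp_periodic[OF T(1)] per_poly_const_imp_periodic[OF M]] by simp
  ultimately have "Dn n (\<lambda>x' y. T x' y + ?M x' y) x x = (if n \<in> insert m N then d n else 0)" for n
    using Dn_shift_monom2_base(1)[of n m c x] T(2)[of n] insert.hyps by auto
  with per_poly_add[OF M T(1)] show ?case by blast
qed

lemma finite_wdeg_le: "finite {n. real (wdeg n) \<le> t}"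
proof (rule finite_subset)
  show "{n. real (wdeg n) \<le> t} \<subseteq> {..nat \<lfloor>t\<rfloor>} \<times> {..nat \<lfloor>t\<rfloor>}"
    by (auto simp: wdeg_def le_nat_floor)
qed simp

lemma taylor_remainder:
  assumes "per_poly periodic_funs r U"
  obtains T t where "per_poly const_funs t T" and "t < h" and "\<And>n. real (wdeg n) < h
    \<Longrightarrow> Dn n (\<lambda>x' y. U x' y + - 1 * T x' y) x x = 0"
proof -
  \<comment> \<open>The largest integer strictly below h: every weighted degree below h is at most
    t, while t itself keeps the strict inequality.\<close>
  define t where "t = real_of_int (\<lceil>h\<rceil> - 1)"
  define N where "N = {n. real (wdeg n) \<le> t}"
  have "\<exists>T. per_poly const_funs t T \<and> (\<forall>n. Dn n T x x = (if n \<in> N then Dn n U x x else 0))"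
    by (rule taylor_polynomial) (simp_all add: N_def finite_wdeg_le)
  then obtain T where T: "per_poly const_funs t T"
    "\<And>n. Dn n T x x = (if n \<in> N then Dn n U x x else 0)"
    by blast
  have le: "real (wdeg n) \<le> t" if "real (wdeg n) < h" for n
  proof -
    have "int (wdeg n) < \<lceil>h\<rceil>" using that by (simp add: less_ceiling_iff)
    then have "int (wdeg n) \<le> \<lceil>h\<rceil> - 1" by simp
    then show ?thesis unfolding t_def by (metis of_int_le_iff of_int_of_nat_eq)
  qed
  show ?thesis
  proof (rule that[OF T(1)])
    show "t < h" unfolding t_def by linarith
    fix n assume n: "real (wdeg n) < h"
    have m1: "per_poly const_funs t (\<lambda>x' y. - 1 * T x' y)"
      by (rule per_poly_cmult[OF coeff_space_const_funs T(1)])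
    have "Dn n (\<lambda>x' y. - 1 * T x' y + T x' y) x x = Dn n (\<lambda>x' y. - 1 * T x' y) x x + Dn n T x x"
      using Dn_add[OF per_poly_const_imp_periodic[OF m1] per_poly_const_imp_periodic[OF T(1)]]
        by simp
    moreover have "Dn n (\<lambda>_ _. 0) x x = (0 :: real)"
      using Dn_shift_monom2[of "fst n" "snd n" 0 x 0 0] by simp
    ultimately have "Dn n (\<lambda>x' y. - 1 * T x' y) x x = - Dn n U x x"
      using T(2)[of n] le[OF n] by (simp add: N_def)
    moreover have "Dn n (\<lambda>x' y. U x' y + - 1 * T x' y) x x
      = Dn n U x x + Dn n (\<lambda>x' y. - 1 * T x' y) x x"
      using Dn_add[OF per_poly_mono[OF assms order_refl max.cobounded1[of r t]]
        per_poly_mono[OF per_poly_const_imp_periodic[OF m1] order_refl max.cobounded2[of t r]]]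
          by simp
    ultimately show "Dn n (\<lambda>x' y. U x' y + - 1 * T x' y) x x = 0" by simp
  qed
qed

subsection \<open>Degree bookkeeping\<close>

lemma periodic_fun_split:
  assumes "f \<in> periodic_funs"
  obtains g where "g \<in> mean_free_funs" and "\<And>x. f x = g x + mean f"
  using assms that[of "\<lambda>x. f x - mean f"]
  by (auto simp: periodic_funs_def mean_free_funs_def smooth_diff mean_diff)

lemma per_poly_split:
  assumes "per_poly periodic_funs r U"
  shows "\<exists>A B. per_poly mean_free_funs r A \<and> per_poly const_funs r B \<and> U = (\<lambda>x' y. A x' y + B x' y)"
  using assms
proof (induction rule: per_poly.induct)
  case zero
  show ?case by (intro exI[of _ "\<lambda>_ _. 0"]) (simp add: per_poly.zero)
next
  case (step U f n)
  then obtain A B where AB: "per_poly mean_free_funs r A" "per_poly const_funs r B"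
    "U = (\<lambda>x' y. A x' y + B x' y)" by blast
  obtain g where g: "g \<in> mean_free_funs" "\<And>x. f x = g x + mean f"
    using periodic_fun_split[OF step.hyps(2)] by blast
  have "(\<lambda>_. mean f) \<in> const_funs" by (simp add: const_funs_def)
  with AB g step.hyps(3) show ?case
    by (intro exI[of _ "\<lambda>x' y. A x' y + g x' * monom2 y n"] exI[of _
      "\<lambda>x' y. B x' y + mean f * monom2 y n"] conjI)
      (auto intro!: per_poly.step[where f =
        "\<lambda>_. mean f"] per_poly.step[where f = g] simp: fun_eq_iff algebra_simps)
qed

text \<open>Here s stands for the homogeneity. The mean-free allowance s - \<alpha> is fixed, while
  \<delta> records the gain of the constant part, the quantity that products and D1 change.\<close>

definition split_deg :: "real \<Rightarrow> real \<Rightarrow> real \<Rightarrow> (plane \<Rightarrow> plane \<Rightarrow> real) \<Rightarrow> bool" where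
  "split_deg \<alpha> s \<delta> U \<longleftrightarrow> (\<exists>A B. per_poly mean_free_funs (s - \<alpha>) A \<and> per_poly const_funs (s - \<delta>) B
    \<and> U = (\<lambda>x' y. A x' y + B x' y))"

lemma split_deg_mean_free: "per_poly mean_free_funs (s - \<alpha>) A \<Longrightarrow> split_deg \<alpha> s \<delta> A"
  unfolding split_deg_def by (intro exI[of _ A] exI[of _ "\<lambda>_ _. 0"]) (simp add: per_poly.zero)

lemma split_deg_const: "per_poly const_funs (s - \<delta>) B \<Longrightarrow> split_deg \<alpha> s \<delta> B"
  unfolding split_deg_def by (intro exI[of _ B] exI[of _ "\<lambda>_ _. 0"]) (simp add: per_poly.zero)

lemma split_deg_mono: "split_deg \<alpha> s \<delta> U \<Longrightarrow> \<delta>' \<le> \<delta> \<Longrightarrow> split_deg \<alpha> s \<delta>' U"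
  unfolding split_deg_def using per_poly_mono[OF _ order_refl, of const_funs "s - \<delta>" _ "s - \<delta>'"]
    by fastforce

lemma split_deg_add:
  assumes "split_deg \<alpha> s \<delta> U" and "split_deg \<alpha> s \<delta> V"
  shows "split_deg \<alpha> s \<delta> (\<lambda>x' y. U x' y + V x' y)"
proof -
  obtain A B A' B' where "per_poly mean_free_funs (s - \<alpha>) A" "per_poly const_funs (s - \<delta>) B"
    "U = (\<lambda>x' y. A x' y + B x' y)"
     "per_poly mean_free_funs (s - \<alpha>) A'" "per_poly const_funs (s - \<delta>) B'"
       "V = (\<lambda>x' y. A' x' y + B' x' y)"
    using assms unfolding split_deg_def by blast
  then show ?thesis unfolding split_deg_def
    by (intro exI[of _ "\<lambda>x' y. A x' y + A' x' y"] exI[of _ "\<lambda>x' y. B x' y + B' x' y"])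
      (auto intro!: per_poly_add simp: fun_eq_iff)
qed

text \<open>The product of the mean-free parts is split again; both of its pieces have degree at
  most s + s' - 2 \<alpha>, which costs the constant part the cap \<delta>'' \<le> 2 \<alpha>. Mixed
  products stay mean-free and the constant parts add their gains.\<close>

lemma split_deg_mult:
  assumes "split_deg \<alpha> s \<delta> U" and "split_deg \<alpha> s' \<delta>' V"
    and "\<delta>'' \<le> \<delta> + \<delta>'" and "\<delta>'' \<le> 2 * \<alpha>" and "0 \<le> \<delta>" and "0 \<le> \<delta>'" and "0 \<le> \<alpha>"
  shows "split_deg \<alpha> (s + s') \<delta>'' (\<lambda>x' y. U x' y * V x' y)"
proof -
  obtain A B A' B' where U: "per_poly mean_free_funs (s - \<alpha>) A" "per_poly const_funs (s - \<delta>) B"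
    "U = (\<lambda>x' y. A x' y + B x' y)"
    and V: "per_poly mean_free_funs (s' - \<alpha>) A'" "per_poly const_funs (s' - \<delta>') B'"
      "V = (\<lambda>x' y. A' x' y + B' x' y)"
    using assms unfolding split_deg_def by blast
  obtain A'' B'' where AA: "per_poly mean_free_funs ((s - \<alpha>) + (s' - \<alpha>)) A''"
    "per_poly const_funs ((s - \<alpha>) + (s' - \<alpha>)) B''"
      "(\<lambda>x' y. A x' y * A' x' y) = (\<lambda>x' y. A'' x' y + B'' x' y)"
    using per_poly_split[OF per_poly_mult_periodic[OF per_poly_mean_free_imp_periodic[OF U(1)]
      per_poly_mean_free_imp_periodic[OF V(1)]]] by blast
  have 1: "split_deg \<alpha> (s + s') \<delta>'' A''"
    by (rule split_deg_mean_free, rule per_poly_mono[OF AA(1)]) (use assms in auto)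
  have 2: "split_deg \<alpha> (s + s') \<delta>'' B''"
    by (rule split_deg_const, rule per_poly_mono[OF AA(2)]) (use assms in auto)
  have 3: "split_deg \<alpha> (s + s') \<delta>'' (\<lambda>x' y. A x' y * B' x' y)"
    by (rule split_deg_mean_free, rule per_poly_mono[OF per_poly_mult_mean_free_const[OF U(1)
      V(2)]]) (use assms in auto)
  have 4: "split_deg \<alpha> (s + s') \<delta>'' (\<lambda>x' y. A' x' y * B x' y)"
    by (rule split_deg_mean_free, rule per_poly_mono[OF per_poly_mult_mean_free_const[OF V(1)
      U(2)]]) (use assms in auto)
  have 5: "split_deg \<alpha> (s + s') \<delta>'' (\<lambda>x' y. B x' y * B' x' y)"
    by (rule split_deg_const, rule per_poly_mono[OF per_poly_mult_const[OF U(2) V(2)]])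
      (use assms in auto)
  have "U x' y * V x' y = ((A'' x' y + B'' x' y) + A x' y * B' x' y) +
    (A' x' y * B x' y + B x' y * B' x' y)" for x' y
    using fun_cong[OF fun_cong[OF AA(3), of x'], of y] by (simp add: U(3) V(3) algebra_simps)
  then show ?thesis
    using split_deg_add[OF split_deg_add[OF split_deg_add[OF 1 2] 3] split_deg_add[OF 4 5]] by simp
qed

text \<open>Derivatives may fall on a mean-free coefficient and then lower no degree, so only the
  constant part gains 2.\<close>

lemma split_deg_D1:
  assumes "split_deg \<alpha> s \<delta> U"
  shows "split_deg \<alpha> s (\<delta> + 2) (D1 (D1 U))"
proof -
  obtain A B where AB: "per_poly mean_free_funs (s - \<alpha>) A" "per_poly const_funs (s - \<delta>) B" and U:
    "U = (\<lambda>x' y. A x' y + B x' y)"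
    using assms unfolding split_deg_def by blast
  note A = per_poly_D(1)[OF coeff_space_mean_free_funs AB(1)] and B
    = per_poly_D(1)[OF coeff_space_const_funs AB(2)]
  have "D1 (D1 U) = (\<lambda>x' y. D1 (D1 A) x' y + D1 (D1 B) x' y)"
    unfolding U by (simp add: D_add(1) per_poly_regular[OF per_poly_mean_free_imp_periodic[OF
      AB(1)]] per_poly_regular[OF per_poly_const_imp_periodic[OF AB(2)]]
        per_poly_regular[OF per_poly_mean_free_imp_periodic[OF A]] per_poly_regular[OF
          per_poly_const_imp_periodic[OF B]])
  moreover have "per_poly mean_free_funs (s - \<alpha>) (D1 (D1 A))"
    "per_poly const_funs (s - (\<delta> + 2)) (D1 (D1 B))"
    using per_poly_D(1)[OF coeff_space_mean_free_funs A] per_poly_D1_D1_const[OF AB(2)]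
      by (simp_all add: algebra_simps)
  ultimately show ?thesis unfolding split_deg_def by blast
qed

text \<open>Used with \<open>s = \<bar>\<beta>\<bar>\<close>, \<open>b = [\<beta>] + 1\<close> and with \<open>\<theta> = 0\<close> for \<open>\<Pi>\<close>, \<open>\<theta> = 2\<close> for \<open>D\<^sub>1\<^sup>2 \<Pi>\<close> and \<open>\<Pi>\<^sup>-\<close>.
  All three parameters are additive under products; \<open>b = 0\<close> means that only purely polynomial
  factors are involved, and \<open>b > 0\<close> provides the strict inequality for the degree of the mean.\<close>

definition graded :: "real \<Rightarrow> real \<Rightarrow> real \<Rightarrow> int \<Rightarrow> (plane \<Rightarrow> plane \<Rightarrow> real) \<Rightarrow> bool" where
  "graded \<alpha> \<theta> s b U \<longleftrightarrow> U = (\<lambda>_ _. 0) \<or> (b = 0 \<and> per_poly const_funs (s - \<theta>) U) \<or> (b > 0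
    \<and> (\<exists>\<delta>>\<theta>. split_deg \<alpha> s \<delta> U))"

lemma graded_zero [simp]: "graded \<alpha> \<theta> s b (\<lambda>_ _. 0)"
  by (simp add: graded_def)

lemma graded_neg: "graded \<alpha> \<theta> s b U \<Longrightarrow> b < 0 \<Longrightarrow> U = (\<lambda>_ _. 0)"
  by (auto simp: graded_def)

lemma graded_nonpos: "graded \<alpha> \<theta> s b U \<Longrightarrow> b \<le> 0 \<Longrightarrow> per_poly const_funs (s - \<theta>) U"
  by (auto simp: graded_def per_poly.zero)

lemma graded_pos: "graded \<alpha> \<theta> s b U \<Longrightarrow> b > 0 \<Longrightarrow> \<exists>\<delta>>\<theta>. split_deg \<alpha> s \<delta> U"
  unfolding graded_def using split_deg_const[OF per_poly.zero] gt_ex[of \<theta>] by blast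

lemma graded_split: "graded \<alpha> \<theta> s b U \<Longrightarrow> split_deg \<alpha> s \<theta> U"
  unfolding graded_def using split_deg_const[OF per_poly.zero] split_deg_const split_deg_mono
    less_imp_le by blast

lemma graded_add:
  assumes "graded \<alpha> \<theta> s b U" and "graded \<alpha> \<theta> s b V"
  shows "graded \<alpha> \<theta> s b (\<lambda>x' y. U x' y + V x' y)"
proof (cases "b > 0")
  case True
  obtain \<delta> \<delta>' where \<delta>: "\<delta> > \<theta>" "split_deg \<alpha> s \<delta> U" "\<delta>' > \<theta>" "split_deg \<alpha> s \<delta>' V"
    using assms graded_pos True by meson
  have "split_deg \<alpha> s (min \<delta> \<delta>') (\<lambda>x' y. U x' y + V x' y)"
    by (intro split_deg_add split_deg_mono[OF \<delta>(2)] split_deg_mono[OF \<delta>(4)]) auto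
  moreover have "\<theta> < min \<delta> \<delta>'" using \<delta> by simp
  ultimately show ?thesis unfolding graded_def using True by blast
next
  case False
  then have "per_poly const_funs (s - \<theta>) (\<lambda>x' y. U x' y + V x' y)"
    using assms by (intro per_poly_add graded_nonpos) auto
  moreover have "b \<noteq> 0 \<Longrightarrow> U = (\<lambda>_ _. 0) \<and> V = (\<lambda>_ _. 0)"
    using graded_neg[OF assms(1)] graded_neg[OF assms(2)] False by linarith
  ultimately show ?thesis unfolding graded_def by auto
qed

lemma graded_sum:
  "(\<And>i. i \<in> I \<Longrightarrow> graded \<alpha> \<theta> s b (U i)) \<Longrightarrow> graded \<alpha> \<theta> s b (\<lambda>x' y. \<Sum>i\<in>I. U i x' y)"
  by (induction I rule: infinite_finite_induct) (simp_all add: graded_add)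

text \<open>If b + b' > 0, one factor has positive bracket parameter, and its surplus over \<theta>
  or \<theta>' survives in the sum. The cap 2 \<alpha> leaves it strict because \<theta> + \<theta>'
  < 2 \<alpha>; with \<theta> = 0 and \<theta>' = 2 this is the condition \<alpha> > 1.\<close>

lemma graded_mult:
  assumes "graded \<alpha> \<theta> s b U" and "graded \<alpha> \<theta>' s' b' V" and "0 \<le> \<theta>" "0 \<le> \<theta>'" "\<theta> + \<theta>' < 2 * \<alpha>"
  shows "graded \<alpha> (\<theta> + \<theta>') (s + s') (b + b') (\<lambda>x' y. U x' y * V x' y)"
proof (cases "U = (\<lambda>_ _. 0) \<or> V = (\<lambda>_ _. 0)")
  case False
  then have b: "b \<ge> 0" "b' \<ge> 0" using assms by (auto simp: graded_def)
  show ?thesis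
  proof (cases "b = 0 \<and> b' = 0")
    case True
    then have "per_poly const_funs (s - \<theta>) U" "per_poly const_funs (s' - \<theta>') V"
      using assms graded_nonpos by auto
    from per_poly_mult_const[OF this] True show ?thesis
      by (simp add: graded_def algebra_simps)
  next
    case False
    have "\<exists>\<delta> \<delta>'. \<delta> \<ge> \<theta> \<and> \<delta>' \<ge> \<theta>' \<and> \<delta> + \<delta>' > \<theta> + \<theta>' \<and> split_deg \<alpha> s \<delta> U \<and> split_deg \<alpha> s' \<delta>' V"
    proof (cases "b = 0")
      case True
      then obtain \<delta>' where "\<delta>' > \<theta>'" "split_deg \<alpha> s' \<delta>' V"
        using False b assms(2) graded_pos[of \<alpha> \<theta>' s' b' V] by auto
      then show ?thesis using graded_split[OF assms(1)] by (intro exI[of _ \<theta>] exI[of _ \<delta>']) auto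
    next
      case False
      then obtain \<delta> where "\<delta> > \<theta>" "split_deg \<alpha> s \<delta> U"
        using b assms(1) graded_pos[of \<alpha> \<theta> s b U] by auto
      then show ?thesis using graded_split[OF assms(2)] by (intro exI[of _ \<delta>] exI[of _ \<theta>']) auto
    qed
    then obtain \<delta> \<delta>' where \<delta>: "\<delta> \<ge> \<theta>" "\<delta>' \<ge> \<theta>'" "\<delta> + \<delta>' > \<theta> + \<theta>'" "split_deg \<alpha> s \<delta> U"
      "split_deg \<alpha> s' \<delta>' V"
      by blast
    have "split_deg \<alpha> (s + s') (min (\<delta> + \<delta>') (2 * \<alpha>)) (\<lambda>x' y. U x' y * V x' y)"
      by (rule split_deg_mult[OF \<delta>(4,5)]) (use assms \<delta> in auto)
    moreover have "\<theta> + \<theta>' < min (\<delta> + \<delta>') (2 * \<alpha>)" using \<delta> assms by simp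
    moreover have "b + b' > 0" using b False by linarith
    ultimately show ?thesis unfolding graded_def by blast
  qed
qed auto

lemma graded_D1:
  assumes "graded \<alpha> 0 s b U"
  shows "graded \<alpha> 2 s b (D1 (D1 U))"
proof -
  have "per_poly const_funs (s - 2) (D1 (D1 U))" if "per_poly const_funs s U"
    using per_poly_D1_D1_const[OF that] .
  moreover have "\<exists>\<delta>>2. split_deg \<alpha> s \<delta> (D1 (D1 U))" if "\<delta> > 0" "split_deg \<alpha> s \<delta> U" for \<delta>
    using split_deg_D1[OF that(2)] that(1) by (intro exI[of _ "\<delta> + 2"]) auto
  ultimately show ?thesis
    using assms unfolding graded_def by auto
qed

lemma split_deg_per_poly:
  assumes "split_deg \<alpha> s \<delta> U"
  shows "per_poly periodic_funs (max (s - \<alpha>) (s - \<delta>)) U"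
proof -
  obtain A B where AB: "per_poly mean_free_funs (s - \<alpha>) A" "per_poly const_funs (s - \<delta>) B" and U:
    "U = (\<lambda>x' y. A x' y + B x' y)"
    using assms unfolding split_deg_def by blast
  show ?thesis
    unfolding U
    by (rule per_poly_add[OF per_poly_mono[OF per_poly_const_imp_periodic[OF AB(2)]]
      per_poly_mono[OF per_poly_mean_free_imp_periodic[OF AB(1)]]]) auto
qed

subsection \<open>Multi-indices\<close>

lemma bracket_add: "bracket (\<beta> + \<gamma>) = bracket \<beta> + bracket \<gamma>"
proof -
  have fin: "finite {k. int k * int (Poly_Mapping.lookup \<beta> (VK k)) \<noteq> 0}"
    "finite {n. int (Poly_Mapping.lookup \<beta> (VN n)) \<noteq> 0}" for \<beta> :: mindex
    using finite_subset[OF _ finite_lookup_VK[of \<beta>]] finite_lookup_VN[of \<beta>]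
      by (auto simp: subset_iff)
  show ?thesis
    unfolding bracket_def
      by (simp add: Poly_Mapping.lookup_add distrib_left Sum_any.distrib[OF fin(1) fin(1)]
        Sum_any.distrib[OF fin(2) fin(2)])
qed

text \<open>Because of its summand \<alpha>, only the homogeneity minus \<alpha> is additive, whence
  the shifts by \<alpha> below.\<close>

lemma homog_add: "homog \<alpha> (\<beta> + \<gamma>) = homog \<alpha> \<beta> + homog \<alpha> \<gamma> - \<alpha>"
proof -
  have fin: "finite {k. real k * real (Poly_Mapping.lookup \<beta> (VK k)) \<noteq> 0}"
      "finite {n. (real (wdeg (pair_of n)) - \<alpha>) * real (Poly_Mapping.lookup \<beta> (VN n)) \<noteq> 0}"
        for \<beta> :: mindex
    using finite_subset[OF _ finite_lookup_VK[of \<beta>]] finite_subset[OF _ finite_lookup_VN[of \<beta>]]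
      by (auto simp: subset_iff)
  show ?thesis
    unfolding homog_def by (simp add: Poly_Mapping.lookup_add distrib_left Sum_any.distrib[OF
      fin(1) fin(1)] Sum_any.distrib[OF fin(2) fin(2)])
qed

text \<open>Homogeneity and bracket ignore z_0, so neither falls along the recursion when k = 0;
  this count falls for every k.\<close>

definition ksize :: "mindex \<Rightarrow> nat" where
  "ksize \<beta> = Sum_any (\<lambda>k. Poly_Mapping.lookup \<beta> (VK k))"

lemma ksize_add: "ksize (\<beta> + \<gamma>) = ksize \<beta> + ksize \<gamma>"
  unfolding ksize_def Poly_Mapping.lookup_add
    by (rule Sum_any.distrib[OF finite_lookup_VK finite_lookup_VK])

lemma Sum_any_single: "Sum_any (\<lambda>j. if j = k then c else 0) = c"
  by (subst Sum_any.expand_superset[of "{k}"]) auto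

lemma lookup_unit:
  "Poly_Mapping.lookup (unitK k) (VK j) = (if j = k then 1 else 0)"
    "Poly_Mapping.lookup (unitK k) (VN n) = 0"
  "Poly_Mapping.lookup (unitN n) (VK j) = 0"
    "Poly_Mapping.lookup (unitN n) (VN m) = (if m = n then 1 else 0)"
  by (auto simp: unitK_def unitN_def Poly_Mapping.lookup_single when_def)

lemma unit_values:
  "bracket (unitK k) = int k" "homog \<alpha> (unitK k) = \<alpha> * real k + \<alpha>" "ksize (unitK k) = 1"
  "bracket (unitN n) = - 1" "homog \<alpha> (unitN n) = real (wdeg (pair_of n))"
  "bracket 0 = 0" "homog \<alpha> 0 = \<alpha>"
  by (simp_all add: bracket_def homog_def ksize_def lookup_unit if_distrib[of int] if_distrib[of
    real]
      if_distrib[of "\<lambda>t. _ * t"] Sum_any_single cong: if_cong)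

lemma unitN_inj: "unitN m = unitN n \<longleftrightarrow> m = n"
  by (metis lookup_unit(4) zero_neq_one)

subsection \<open>The right-hand side\<close>

text \<open>The parameters of the factors may vary with the decomposition as long as their sums do
  not. The alternative X \<gamma> = 0 is for the factor z_k, which has a single nonzero
  component.\<close>

lemma graded_ps_times:
  assumes "\<And>\<gamma> \<gamma>'. \<gamma> + \<gamma>' = \<beta> \<Longrightarrow> X \<gamma> = (\<lambda>_ _. 0) \<or>
      (\<exists>s' s'' b' b''. graded \<alpha> \<theta> s' b' (X \<gamma>) \<and> graded \<alpha> \<theta>' s'' b'' (Y \<gamma>') \<and> s' + s'' = s
        \<and> b' + b'' = b)"
    and "0 \<le> \<theta>" "0 \<le> \<theta>'" "\<theta> + \<theta>' < 2 * \<alpha>"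
  shows "graded \<alpha> (\<theta> + \<theta>') s b (\<lambda>x' y. ps_times (\<lambda>\<gamma>. X \<gamma> x' y) (\<lambda>\<gamma>. Y \<gamma> x' y) \<beta>)"
proof -
  have "graded \<alpha> (\<theta> + \<theta>') s b (\<lambda>x' y. \<Sum>z\<in>{(\<gamma>, \<gamma>'). \<gamma> + \<gamma>' = \<beta>}. X (fst z) x' y * Y (snd z) x' y)"
  proof (rule graded_sum)
    fix z assume "z \<in> {(\<gamma>, \<gamma>'). \<gamma> + \<gamma>' = \<beta>}"
    then have "fst z + snd z = \<beta>" by auto
    from assms(1)[OF this] show "graded \<alpha> (\<theta> + \<theta>') s b (\<lambda>x' y. X (fst z) x' y * Y (snd z) x' y)"
      using graded_mult[OF _ _ assms(2-4)] by auto
  qed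
  then show ?thesis unfolding ps_times_def by (simp add: case_prod_beta)
qed

context
  fixes \<alpha> :: real and \<phi> :: "mindex \<Rightarrow> plane \<Rightarrow> plane \<Rightarrow> real" and \<xi> :: "plane \<Rightarrow> real"
  assumes \<alpha>: "1 < \<alpha>"
begin

text \<open>For k factors the homogeneities add up to |\<beta>| - \<alpha> + k \<alpha> and the
  numbers [\<gamma>] + 1 to [\<beta>] + k. At k = 0 and \<beta> = 0 both sums are 0, matching the
  unit.\<close>

lemma graded_ps_power:
  assumes "\<And>\<gamma>. ksize \<gamma> \<le> ksize \<beta> \<Longrightarrow> graded \<alpha> 0 (homog \<alpha> \<gamma>) (bracket \<gamma> + 1) (\<phi> \<gamma>)"
  shows "graded \<alpha> 0 (homog \<alpha> \<beta> - \<alpha> + real k * \<alpha>) (bracket \<beta> + int k) (\<lambda>x' y. ps_power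
    (\<lambda>\<gamma>. \<phi> \<gamma> x' y) k \<beta>)"
  using assms
proof (induction k arbitrary: \<beta>)
  case 0
  show ?case
    using \<alpha> by (cases "\<beta> = 0") (auto simp: ps_one_def unit_values graded_def intro!: per_poly_const)
next
  case (Suc k)
  have "graded \<alpha> (0 + 0) (homog \<alpha> \<beta> - \<alpha> + real (Suc k) * \<alpha>) (bracket \<beta> + int (Suc k))
      (\<lambda>x' y. ps_times (\<lambda>\<gamma>. \<phi> \<gamma> x' y) (\<lambda>\<gamma>. ps_power (\<lambda>\<gamma>. \<phi> \<gamma> x' y) k \<gamma>) \<beta>)"
  proof (rule graded_ps_times, rule disjI2, intro exI conjI)
    fix \<gamma> \<gamma>' assume \<beta>: "\<gamma> + \<gamma>' = \<beta>"
    show "graded \<alpha> 0 (homog \<alpha> \<gamma>) (bracket \<gamma> + 1) (\<phi> \<gamma>)"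
      by (rule Suc.prems) (simp flip: \<beta> add: ksize_add)
    show "graded \<alpha> 0 (homog \<alpha> \<gamma>' - \<alpha> + real k * \<alpha>) (bracket \<gamma>' + int k) (\<lambda>x' y. ps_power
      (\<lambda>\<gamma>. \<phi> \<gamma> x' y) k \<gamma>')"
      by (rule Suc.IH, rule Suc.prems) (simp flip: \<beta> add: ksize_add)
    show "homog \<alpha> \<gamma> + (homog \<alpha> \<gamma>' - \<alpha> + real k * \<alpha>) = homog \<alpha> \<beta> - \<alpha> + real (Suc k) * \<alpha>"
      "bracket \<gamma> + 1 + (bracket \<gamma>' + int k) = bracket \<beta> + int (Suc k)"
      by (simp_all flip: \<beta> add: homog_add bracket_add algebra_simps)
  qed (use \<alpha> in auto)
  then show ?case by simp
qed

lemma graded_Pi_minus: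
  assumes "\<And>\<gamma>. ksize \<gamma> < ksize \<beta> \<Longrightarrow> graded \<alpha> 0 (homog \<alpha> \<gamma>) (bracket \<gamma> + 1) (\<phi> \<gamma>)"
    and "\<xi> \<in> mean_free_funs"
  shows "graded \<alpha> 2 (homog \<alpha> \<beta>) (bracket \<beta> + 1) (\<lambda>x' y. Pi_minus \<xi> (\<lambda>x' y \<gamma>. \<phi> \<gamma> x' y) x' y \<beta>)"
proof -
  let ?Q = "\<lambda>k x' y. ps_times (ps_power (\<lambda>\<gamma>. \<phi> \<gamma> x' y) k) (\<lambda>\<gamma>. D1 (D1 (\<phi> \<gamma>)) x' y)"
  let ?K = "{k. Poly_Mapping.lookup \<beta> (VK k) \<noteq> 0}"
  have summand: "graded \<alpha> 2 (homog \<alpha> \<beta>) (bracket \<beta> + 1) (\<lambda>x' y. ps_times (ps_z k) (?Q k x' y) \<beta>)"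
    for k
  proof -
    have "graded \<alpha> (0 + 2) (homog \<alpha> \<beta>) (bracket \<beta> + 1) (\<lambda>x' y. ps_times (\<lambda>\<gamma>.
      (\<lambda>_ _. ps_z k \<gamma>) x' y) (\<lambda>\<gamma>. (\<lambda>x' y. ?Q k x' y \<gamma>) x' y) \<beta>)"
    proof (rule graded_ps_times)
      fix \<gamma> \<gamma>' assume \<beta>: "\<gamma> + \<gamma>' = \<beta>"
      show "(\<lambda>_ _. ps_z k \<gamma>) = (\<lambda>_ _. 0 :: real) \<or> (\<exists>s' s'' b' b''. graded \<alpha> 0 s' b'
        (\<lambda>_ _. ps_z k \<gamma>) \<and>
          graded \<alpha> 2 s'' b'' (\<lambda>x' y. ?Q k x' y \<gamma>') \<and> s' + s'' = homog \<alpha> \<beta> \<and> b' + b''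
            = bracket \<beta> + 1)"
      proof (cases "\<gamma> = unitK k")
        case True
        have small: "graded \<alpha> 0 (homog \<alpha> \<kappa>) (bracket \<kappa> + 1) (\<phi> \<kappa>)" if "ksize \<kappa> \<le> ksize \<gamma>'" for \<kappa>
          by (rule assms(1)) (use that in \<open>simp flip: \<beta> add: True ksize_add unit_values\<close>)
        have "graded \<alpha> (0 + 2) (homog \<alpha> \<beta>) (bracket \<beta> + 1) (\<lambda>x' y. ps_times (\<lambda>\<gamma>. ps_power
          (\<lambda>\<gamma>. \<phi> \<gamma> x' y) k \<gamma>) (\<lambda>\<gamma>. D1 (D1 (\<phi> \<gamma>)) x' y) \<gamma>')"
        proof (rule graded_ps_times, rule disjI2, intro exI conjI)
          fix \<kappa> \<kappa>' assume \<gamma>': "\<kappa> + \<kappa>' = \<gamma>'"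
          show "graded \<alpha> 0 (homog \<alpha> \<kappa> - \<alpha> + real k * \<alpha>) (bracket \<kappa> + int k) (\<lambda>x' y. ps_power
            (\<lambda>\<gamma>. \<phi> \<gamma> x' y) k \<kappa>)"
            by (rule graded_ps_power, rule small) (simp flip: \<gamma>' add: ksize_add)
          show "graded \<alpha> 2 (homog \<alpha> \<kappa>') (bracket \<kappa>' + 1) (D1 (D1 (\<phi> \<kappa>')))"
            by (rule graded_D1, rule small) (simp flip: \<gamma>' add: ksize_add)
          show "homog \<alpha> \<kappa> - \<alpha> + real k * \<alpha> + homog \<alpha> \<kappa>' = homog \<alpha> \<beta>"
            "bracket \<kappa> + int k + (bracket \<kappa>' + 1) = bracket \<beta> + 1"
            by (simp_all flip: \<beta> \<gamma>' add: True homog_add bracket_add unit_values algebra_simps)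
        qed (use \<alpha> in auto)
        \<comment> \<open>z_k enters as a scalar with all parameters zero: the amounts k \<alpha>
          and k that it adds to homogeneity and bracket are already in the parameters of the k-th
          power.\<close>
        moreover have "graded \<alpha> 0 0 0 (\<lambda>_ _. ps_z k \<gamma>)"
          by (simp add: graded_def per_poly_const)
        ultimately show ?thesis
          by (intro disjI2 exI[of _ "0 :: real"] exI[of _ "0 :: int"] exI[of _
            "homog \<alpha> \<beta>"] exI[of _ "bracket \<beta> + 1"]) simp
      qed (simp add: ps_z_def)
    qed (use \<alpha> in auto)
    then show ?thesis by simp
  qed
  have sum: "Sum_any (\<lambda>k. ps_times (ps_z k) (?Q k x' y) \<beta>)
    = (\<Sum>k\<in>?K. ps_times (ps_z k) (?Q k x' y) \<beta>)" for x' y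
    by (rule Sum_any.expand_superset[OF finite_lookup_VK]) (use ps_times_z_support in blast)
  have "graded \<alpha> 2 (homog \<alpha> \<beta>) (bracket \<beta> + 1) (\<lambda>x' y. \<xi> x' * ps_one \<beta>)"
  proof (cases "\<beta> = 0")
    case True
    have "per_poly mean_free_funs 0 (\<lambda>x' y. \<xi> x')"
      using per_poly_monom[OF assms(2), of "(0, 0)" 0] by (simp add: wdeg_def monom2_def)
    \<comment> \<open>The constant part is zero, so 3 is an arbitrary value above 2; the mean-free
      part has degree 0 = |0| - \<alpha>.\<close>
    then have "split_deg \<alpha> \<alpha> 3 (\<lambda>x' y. \<xi> x')" by (intro split_deg_mean_free) simp
    then show ?thesis by (auto simp: True graded_def unit_values ps_one_def intro!: exI[of _ 3])
  qed (simp add: ps_one_def)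
  then have "graded \<alpha> 2 (homog \<alpha> \<beta>) (bracket \<beta> + 1)
     (\<lambda>x' y. (\<Sum>k\<in>?K. ps_times (ps_z k) (?Q k x' y) \<beta>) + \<xi> x' * ps_one \<beta>)"
    by (intro graded_add graded_sum summand)
  then show ?thesis
    unfolding Pi_minus_def component_def sum .
qed

end

lemma ps_power_cong:
  "(\<And>\<gamma>. ksize \<gamma> \<le> ksize \<beta> \<Longrightarrow> \<pi> \<gamma> = \<pi>' \<gamma>) \<Longrightarrow> ps_power \<pi> k \<beta> = ps_power \<pi>' k \<beta>"
proof (induction k arbitrary: \<beta>)
  case (Suc k)
  show ?case
    unfolding ps_power.simps ps_times_def
  proof (rule sum.cong, rule refl, clarify)
    fix \<gamma> \<gamma>' assume "\<beta> = \<gamma> + \<gamma>'"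
    then have "ksize \<gamma> \<le> ksize \<beta>" "ksize \<gamma>' \<le> ksize \<beta>" by (simp_all add: ksize_add)
    then show "\<pi> \<gamma> * ps_power \<pi> k \<gamma>' = \<pi>' \<gamma> * ps_power \<pi>' k \<gamma>'"
      using Suc.IH[of \<gamma>'] Suc.prems by simp
  qed
qed simp

text \<open>The factor z_k uses up one unit of \<open>ksize\<close>, so all components that matter
  have smaller \<open>ksize\<close>. This is the locality required by the recursion in
  \<open>model_exists\<close>.\<close>

lemma Pi_minus_cong:
  assumes "\<And>\<gamma>. ksize \<gamma> < ksize \<beta> \<Longrightarrow> \<phi> \<gamma> = \<phi>' \<gamma>"
  shows "Pi_minus \<xi> (\<lambda>x' y \<gamma>. \<phi> \<gamma> x' y) x' y \<beta> = Pi_minus \<xi> (\<lambda>x' y \<gamma>. \<phi>' \<gamma> x' y) x' y \<beta>"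
proof -
  have "ps_times (ps_z k) (ps_times (ps_power (\<lambda>\<gamma>. \<phi> \<gamma> x' y) k) (\<lambda>\<gamma>. D1 (D1 (\<phi> \<gamma>)) x' y)) \<beta>
      = ps_times (ps_z k) (ps_times (ps_power (\<lambda>\<gamma>. \<phi>' \<gamma> x' y) k) (\<lambda>\<gamma>. D1 (D1 (\<phi>' \<gamma>)) x' y)) \<beta>" for k
    unfolding ps_times_def[of "ps_z k"]
  proof (rule sum.cong, rule refl, clarify)
    fix \<gamma> \<gamma>' assume \<beta>: "\<beta> = \<gamma> + \<gamma>'"
    show "ps_z k \<gamma> * ps_times (ps_power (\<lambda>\<gamma>. \<phi> \<gamma> x' y) k) (\<lambda>\<gamma>. D1 (D1 (\<phi> \<gamma>)) x' y) \<gamma>'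
        = ps_z k \<gamma> * ps_times (ps_power (\<lambda>\<gamma>. \<phi>' \<gamma> x' y) k) (\<lambda>\<gamma>. D1 (D1 (\<phi>' \<gamma>)) x' y) \<gamma>'"
    proof (cases "\<gamma> = unitK k")
      case True
      have small: "\<phi> \<kappa> = \<phi>' \<kappa>" if "ksize \<kappa> \<le> ksize \<gamma>'" for \<kappa>
        by (rule assms) (use that in \<open>simp add: \<beta> True ksize_add unit_values\<close>)
      have "ps_times (ps_power (\<lambda>\<gamma>. \<phi> \<gamma> x' y) k) (\<lambda>\<gamma>. D1 (D1 (\<phi> \<gamma>)) x' y) \<gamma>'
        = ps_times (ps_power (\<lambda>\<gamma>. \<phi>' \<gamma> x' y) k) (\<lambda>\<gamma>. D1 (D1 (\<phi>' \<gamma>)) x' y) \<gamma>'"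
        unfolding ps_times_def
      proof (rule sum.cong, rule refl, clarify)
        fix \<kappa> \<kappa>' assume \<gamma>': "\<gamma>' = \<kappa> + \<kappa>'"
        have "ps_power (\<lambda>\<gamma>. \<phi> \<gamma> x' y) k \<kappa> = ps_power (\<lambda>\<gamma>. \<phi>' \<gamma> x' y) k \<kappa>"
          by (rule ps_power_cong) (simp add: small \<gamma>' ksize_add)
        moreover have "\<phi> \<kappa>' = \<phi>' \<kappa>'" by (rule small) (simp add: \<gamma>' ksize_add)
        ultimately show "ps_power (\<lambda>\<gamma>. \<phi> \<gamma> x' y) k \<kappa> * D1 (D1 (\<phi> \<kappa>')) x' y
            = ps_power (\<lambda>\<gamma>. \<phi>' \<gamma> x' y) k \<kappa> * D1 (D1 (\<phi>' \<kappa>')) x' y" by simp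
      qed
      then show ?thesis by simp
    qed (simp add: ps_z_def)
  qed
  then show ?thesis unfolding Pi_minus_def component_def by simp
qed

subsection \<open>Construction of the model\<close>

lemma expandsI:
  assumes "finite F" and "\<And>n. n \<notin> F \<Longrightarrow> c n = (\<lambda>_. 0)" and
    "\<And>x' y. U x' y = (\<Sum>n\<in>F. c n x' * monom2 y n)"
  shows "expands U c"
  unfolding expands_def
proof (intro conjI allI)
  have sub: "{n. c n \<noteq> (\<lambda>_. 0)} \<subseteq> F" using assms(2) by blast
  then show "finite {n. c n \<noteq> (\<lambda>_. 0)}" using assms(1) finite_subset by blast
  show "U x' y = (\<Sum>n\<in>{n. c n \<noteq> (\<lambda>_. 0)}. c n x' * monom2 y n)" for x' y
    unfolding assms(3) by (rule sum.mono_neutral_right[OF assms(1) sub]) auto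
qed

lemma per_poly_expands:
  assumes "coeff_space K" and "per_poly K r U"
  shows "\<exists>c. expands U c \<and> (\<forall>n. c n \<in> K) \<and> (\<forall>n. c n \<noteq> (\<lambda>_. 0) \<longrightarrow> real (wdeg n) \<le> r)"
  using assms(2)
proof (induction rule: per_poly.induct)
  case zero
  have "expands (\<lambda>_ _. 0) (\<lambda>_ _. 0)" by (simp add: expands_def)
  then show ?case using assms(1) by (intro exI[of _ "\<lambda>_ _. 0"]) (simp add: coeff_space_def)
next
  case (step U f n)
  then obtain c where c: "expands U c" "\<And>m. c m \<in> K" "\<And>m. c m \<noteq> (\<lambda>_. 0) \<Longrightarrow> real (wdeg m) \<le> r"
    by blast
  let ?S = "{m. c m \<noteq> (\<lambda>_. 0)}"
  let ?c = "\<lambda>m x. c m x + (if m = n then f x else 0)"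
  have fin: "finite ?S" using c(1) by (simp add: expands_def)
  have "expands (\<lambda>x' y. U x' y + f x' * monom2 y n) ?c"
  proof (rule expandsI[where F = "insert n ?S"])
    fix x' y
    have "U x' y = (\<Sum>m\<in>?S. c m x' * monom2 y m)"
      using c(1) unfolding expands_def by blast
    also have "\<dots> = (\<Sum>m\<in>insert n ?S. c m x' * monom2 y m)"
      by (rule sum.mono_neutral_left) (use fin in auto)
    finally show "U x' y + f x' * monom2 y n = (\<Sum>m\<in>insert n ?S. ?c m x' * monom2 y m)"
      using fin by (simp add: distrib_right sum.distrib if_distrib[of
        "\<lambda>t. t * _"] sum.delta cong: if_cong del: sum.insert)
  qed (use fin in auto)
  moreover have "?c m \<in> K" for m
    using c(2)[of m] step.hyps(2) assms(1) by (cases "m = n") (simp_all add: coeff_space_def)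
  moreover have "real (wdeg m) \<le> r" if "?c m \<noteq> (\<lambda>_. 0)" for m
    using that c(3)[of m] step.hyps(3) by (cases "m = n") auto
  ultimately show ?case by (intro exI[of _ ?c]) blast
qed

lemma per_poly_periodic_polynomial: "per_poly periodic_funs r U \<Longrightarrow> periodic_polynomial U"
  using per_poly_expands[OF coeff_space_periodic_funs]
    unfolding periodic_polynomial_def periodic_funs_def by blast

lemma per_poly_ydeg_less:
  assumes "per_poly periodic_funs r U" and "r < h"
  shows "ydeg U < ereal h"
proof -
  obtain c where c: "expands U c" "\<And>n. c n \<noteq> (\<lambda>_. 0) \<Longrightarrow> real (wdeg n) \<le> r"
    using per_poly_expands[OF coeff_space_periodic_funs assms(1)] by blast
  let ?S = "{n. c n \<noteq> (\<lambda>_. 0)}"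
  have "real (Max (wdeg ` ?S)) < h" if "?S \<noteq> {}"
  proof -
    have "Max (wdeg ` ?S) \<in> wdeg ` ?S"
      using c(1) that by (intro Max_in) (auto simp: expands_def)
    then show ?thesis using c(2) assms(2) by fastforce
  qed
  then show ?thesis
    unfolding ydeg_def ycoeffs_eq[OF c(1)] Let_def by simp
qed

lemma per_poly_const_polynomial: "per_poly const_funs r U \<Longrightarrow> real_polynomial_function (\<lambda>y. U x' y)"
proof (induction rule: per_poly.induct)
  case (step U f n)
  have "real_polynomial_function (\<lambda>y :: plane. fst y)"
    "real_polynomial_function (\<lambda>y :: plane. snd y)"
    by (auto intro: real_polynomial_function.intros bounded_linear_fst bounded_linear_snd)
  then have "real_polynomial_function (\<lambda>y. monom2 y n)"
    unfolding monom2_def by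
      (intro real_polynomial_function.intros(4) real_polynomial_function_power)
  then show ?case
    by (intro real_polynomial_function.intros(3) real_polynomial_function.intros(4)
      real_polynomial_function.intros(2) step.IH)
qed (simp add: real_polynomial_function.intros(2))

section \<open>Recursion over multi-indices\<close>

lemma Dn_zero: "Dn n (\<lambda>_ _. 0) = (\<lambda>_ _. 0)"
  using Dn_shift_monom2[of "fst n" "snd n" 0 0 0 0] by simp

text \<open>Only the mean-free part is inverted, at no cost in degree; the constant part goes
  straight into p. The Taylor polynomial T has degree t < h, and \<open>heat\<close> lowers it by 2,
  so its contribution to p stays below h - 2, while the constant part of the solution has gain h -
  t.\<close>

lemma model_step:
  assumes "split_deg \<alpha> h \<delta> F" and "\<delta> > 2"
  obtains U p \<delta>' t where "\<delta>' > 0" "split_deg \<alpha> h \<delta>' U" "per_poly const_funs t p" "t < h - 2"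
    "\<And>x' y. heat U x' y + p x' y = F x' y" "\<And>n. real (wdeg n) < h \<Longrightarrow> Dn n U x x = 0"
proof -
  obtain A B where A: "per_poly mean_free_funs (h - \<alpha>) A" and B:
    "per_poly const_funs (h - \<delta>) B" and F: "F = (\<lambda>x' y. A x' y + B x' y)"
    using assms(1) unfolding split_deg_def by blast
  obtain V where V: "per_poly mean_free_funs (h - \<alpha>) V" "heat V = A"
    using heat_solve[OF A] by blast
  obtain T t where T: "per_poly const_funs t T" "t < h" "\<And>n. real (wdeg n) < h
    \<Longrightarrow> Dn n (\<lambda>x' y. V x' y + - 1 * T x' y) x x = 0"
    using taylor_remainder[OF per_poly_mean_free_imp_periodic[OF V(1)]] by blast
  let ?U = "\<lambda>x' y. V x' y + - 1 * T x' y"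
  let ?p = "\<lambda>x' y. B x' y + heat T x' y"
  have T': "per_poly const_funs t (\<lambda>x' y. - 1 * T x' y)"
    by (rule per_poly_cmult[OF coeff_space_const_funs T(1)])
  show ?thesis
  proof (rule that)
    show "h - t > 0" using T(2) by simp
    show "split_deg \<alpha> h (h - t) ?U"
      unfolding split_deg_def using V(1) T'
        by (intro exI[of _ V] exI[of _ "\<lambda>x' y. - 1 * T x' y"]) simp
    show "per_poly const_funs (max (h - \<delta>) (t - 2)) ?p"
      by (rule per_poly_add[OF per_poly_mono[OF per_poly_heat_const[OF T(1)]] per_poly_mono[OF
        B]]) auto
    show "max (h - \<delta>) (t - 2) < h - 2" using T(2) assms(2) by simp
    have "heat ?U = (\<lambda>x' y. heat V x' y + - 1 * heat T x' y)"
      using heat_add[OF per_poly_mean_free_imp_periodic[OF V(1)] per_poly_const_imp_periodic[OF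
        T']] heat_cmult[OF per_poly_const_imp_periodic[OF T(1)], of "- 1"] by simp
    then show "heat ?U x' y + ?p x' y = F x' y" for x' y
      by (simp add: V(2) F)
  qed (rule T(3))
qed

text \<open>Here \<open>p\<close> is the component of \<open>P\<^sub>x\<close>; it does not enter the recursion. For multi-indices that
  are not populated, \<open>\<Pi>\<^sup>-\<close> is a polynomial in \<open>y\<close> alone and equals \<open>p\<close>.\<close>

definition model_spec ::
  "real \<Rightarrow> (plane \<Rightarrow> real) \<Rightarrow> plane \<Rightarrow> (mindex \<Rightarrow> plane \<Rightarrow> plane \<Rightarrow> real) \<Rightarrow> mindex \<Rightarrow>
    (plane \<Rightarrow> plane \<Rightarrow> real) \<Rightarrow> bool" where
  "model_spec \<alpha> \<xi> x \<phi> \<beta> U \<longleftrightarrow>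
     (\<forall>n. \<beta> = unitN n \<longrightarrow> U = (\<lambda>_ y. monom2 (y - x) (pair_of n))) \<and>
     (\<not> populated \<beta> \<longrightarrow> U = (\<lambda>_ _. 0)) \<and>
     graded \<alpha> 0 (homog \<alpha> \<beta>) (bracket \<beta> + 1) U \<and>
     (\<forall>n. real (wdeg n) < homog \<alpha> \<beta> \<longrightarrow> Dn n U x x = 0) \<and>
     (\<exists>p t. per_poly const_funs t p \<and> (\<forall>x' y. heat U x' y + p x' y = Pi_minus \<xi>
       (\<lambda>x' y \<gamma>. \<phi> \<gamma> x' y) x' y \<beta>) \<and>
        (populated \<beta> \<and> \<not> purely_polynomial \<beta> \<longrightarrow> t < homog \<alpha> \<beta> - 2))"

lemma model_spec_exists:
  assumes \<alpha>: "1 < \<alpha>" and \<xi>: "\<xi> \<in> mean_free_funs"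
    and \<phi>: "\<And>\<gamma>. ksize \<gamma> < ksize \<beta> \<Longrightarrow> graded \<alpha> 0 (homog \<alpha> \<gamma>) (bracket \<gamma> + 1) (\<phi> \<gamma>)"
  shows "\<exists>U. model_spec \<alpha> \<xi> x \<phi> \<beta> U"
proof -
  let ?F = "\<lambda>x' y. Pi_minus \<xi> (\<lambda>x' y \<gamma>. \<phi> \<gamma> x' y) x' y \<beta>"
  have F: "graded \<alpha> 2 (homog \<alpha> \<beta>) (bracket \<beta> + 1) ?F"
    by (rule graded_Pi_minus[OF \<alpha> \<phi> \<xi>])
  \<comment> \<open>A negative bracket makes the right-hand side independent of the periodic
    variable; if U is too, the whole defect can serve as p.\<close>
  have *: "\<exists>p t. per_poly const_funs t p \<and> (\<forall>x' y. heat U x' y + p x' y = ?F x' y)"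
    if "per_poly const_funs r U" "bracket \<beta> < 0" for U r
  proof -
    have "per_poly const_funs (homog \<alpha> \<beta> - 2) ?F" using F that(2)
      by (intro graded_nonpos[OF F]) simp
    then have "per_poly const_funs (max (homog \<alpha> \<beta> - 2) (r - 2)) (\<lambda>x' y. ?F x' y - heat U x' y)"
      by (intro per_poly_diff coeff_space_const_funs) (auto
        intro: per_poly_mono per_poly_heat_const[OF that(1)])
    then show ?thesis
      by (intro exI[of _ "\<lambda>x' y. ?F x' y - heat U x' y"] exI[of _
        "max (homog \<alpha> \<beta> - 2) (r - 2)"]) simp
  qed
  consider (pure) n where "\<beta> = unitN n" | (neg) "\<not> populated \<beta>" | (pos) "\<not> purely_polynomial \<beta>"
    "bracket \<beta> \<ge> 0"
    unfolding populated_def purely_polynomial_def by blast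
  then show ?thesis
  proof cases
    case (pure n)
    let ?U = "\<lambda>_ y. monom2 (y - x) (pair_of n)"
    have "populated \<beta>" "purely_polynomial \<beta>"
      using pure by (auto simp: populated_def purely_polynomial_def)
    moreover have "graded \<alpha> 0 (homog \<alpha> \<beta>) (bracket \<beta> + 1) ?U"
      using per_poly_shift_monom2[of "pair_of n" x] by (simp add: pure graded_def unit_values)
    moreover have "Dn m ?U x x = 0" if "real (wdeg m) < homog \<alpha> \<beta>" for m
      using Dn_shift_monom2_base(1)[of m "pair_of n" 1 x] that by (auto simp: pure unit_values)
    moreover have "\<exists>p t. per_poly const_funs t p \<and> (\<forall>x' y. heat ?U x' y + p x' y = ?F x' y)"
      by (rule *[OF per_poly_shift_monom2]) (simp add: pure unit_values)
    ultimately show ?thesis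
      by (intro exI[of _ ?U]) (auto simp: model_spec_def pure unitN_inj)
  next
    case neg
    then have "\<beta> \<noteq> unitN n" "bracket \<beta> < 0" for n
      by (auto simp: populated_def purely_polynomial_def)
    then show ?thesis
      using neg *[OF per_poly.zero[of const_funs 0]]
      by (intro exI[of _ "\<lambda>_ _. 0"]) (simp add: model_spec_def Dn_zero)
  next
    case pos
    then obtain \<delta> where \<delta>: "\<delta> > 2" "split_deg \<alpha> (homog \<alpha> \<beta>) \<delta> ?F"
      using graded_pos[OF F] by auto
    obtain U p \<delta>' t where U: "\<delta>' > 0" "split_deg \<alpha> (homog \<alpha> \<beta>) \<delta>' U" "per_poly const_funs t p"
      "t < homog \<alpha> \<beta> - 2"
        "\<And>x' y. heat U x' y + p x' y = ?F x' y" "\<And>n. real (wdeg n) < homog \<alpha> \<beta> \<Longrightarrow> Dn n U x x = 0"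
      by (rule model_step[OF \<delta>(2,1), where x = x]) (rule that)
    have "populated \<beta>" "\<beta> \<noteq> unitN n" for n
      using pos by (auto simp: populated_def purely_polynomial_def)
    moreover have "graded \<alpha> 0 (homog \<alpha> \<beta>) (bracket \<beta> + 1) U"
      using U(1,2) pos by (auto simp: graded_def)
    moreover have "\<exists>p t. per_poly const_funs t p \<and> (\<forall>x' y. heat U x' y + p x' y = ?F x' y) \<and> t
      < homog \<alpha> \<beta> - 2"
      using U(3-5) by blast
    ultimately show ?thesis
      using U(6) pos(1) by (intro exI[of _ U]) (simp add: model_spec_def)
  qed
qed

text \<open>The specification at \<beta> reads \<phi> only through \<open>Pi_minus\<close>, that is,
  at smaller \<open>ksize\<close>, so choice along this measure applies. It contains
  \<open>graded\<close> because the step needs that invariant of all smaller components.\<close>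

lemma model_exists:
  assumes \<alpha>: "1 < \<alpha>" and \<xi>: "\<xi> \<in> mean_free_funs"
  shows "\<exists>\<phi>. \<forall>\<beta>. model_spec \<alpha> \<xi> x \<phi> \<beta> (\<phi> \<beta>)"
proof (rule dependent_wf_choice[where R = "Wellfounded.measure ksize"])
  fix \<phi> \<phi>' :: "mindex \<Rightarrow> plane \<Rightarrow> plane \<Rightarrow> real" and \<beta> U
  assume "\<And>\<gamma>. (\<gamma>, \<beta>) \<in> Wellfounded.measure ksize \<Longrightarrow> \<phi> \<gamma> = \<phi>' \<gamma>"
  then have "Pi_minus \<xi> (\<lambda>x' y \<gamma>. \<phi> \<gamma> x' y) x' y \<beta> = Pi_minus \<xi> (\<lambda>x' y \<gamma>. \<phi>' \<gamma> x' y) x' y \<beta>"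
    for x' y
    by (intro Pi_minus_cong) simp
  then show "model_spec \<alpha> \<xi> x \<phi> \<beta> U = model_spec \<alpha> \<xi> x \<phi>' \<beta> U"
    by (simp add: model_spec_def)
next
  fix \<phi> :: "mindex \<Rightarrow> plane \<Rightarrow> plane \<Rightarrow> real" and \<beta>
  assume "\<And>\<gamma>. (\<gamma>, \<beta>) \<in> Wellfounded.measure ksize \<Longrightarrow> model_spec \<alpha> \<xi> x \<phi> \<gamma> (\<phi> \<gamma>)"
  then show "\<exists>U. model_spec \<alpha> \<xi> x \<phi> \<beta> U"
    by (intro model_spec_exists[OF \<alpha> \<xi>]) (simp add: model_spec_def)
qed simp

theorem proposition3p7:
  fixes \<alpha> :: real and \<xi> :: "real \<times> real \<Rightarrow> real" and x :: "real \<times> real"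
  assumes "1 < \<alpha>" and "\<alpha> < 2"
    and "smooth \<xi>" and "periodic \<xi>"
    and "integral ({0..<1} \<times> {0..<1}) \<xi> = 0"
  shows "\<exists>(\<Pi>\<^sub>x :: real \<times> real \<Rightarrow> real \<times> real \<Rightarrow> pseries) (P\<^sub>x :: real \<times> real \<Rightarrow> pseries).
      (\<forall>x' y. \<Pi>\<^sub>x x' y \<in> Tstar) \<and>
      (\<forall>\<beta>. periodic_polynomial (component \<Pi>\<^sub>x \<beta>)) \<and>
      (\<forall>\<beta>. real_polynomial_function (\<lambda>y. P\<^sub>x y \<beta>)) \<and>
      (\<forall>\<beta> x' y. D2 (component \<Pi>\<^sub>x \<beta>) x' y - D1 (D1 (component \<Pi>\<^sub>x \<beta>)) x' y + P\<^sub>x y \<beta> = Pi_minus \<xi> \<Pi>\<^sub>x x' y \<beta>) \<and>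
      (\<forall>\<beta> n. real (wdeg n) < homog \<alpha> \<beta> \<longrightarrow> Dn n (component \<Pi>\<^sub>x \<beta>) x x = 0) \<and>
      (\<forall>n x' y. component \<Pi>\<^sub>x (unitN n) x' y = monom2 (y - x) (pair_of n)) \<and>
      (\<forall>\<beta>. \<not> purely_polynomial \<beta> \<longrightarrow> ydeg (component \<Pi>\<^sub>x \<beta>) < ereal (homog \<alpha> \<beta>)) \<and>
      (\<forall>\<beta>. populated \<beta> \<and> \<not> purely_polynomial \<beta> \<longrightarrow>
         ydeg (\<lambda>_ y. P\<^sub>x y \<beta>) < ereal (homog \<alpha> \<beta> - 2))"
proof -
  have "\<xi> \<in> mean_free_funs"
    using assms(3-5) by (simp add: mean_free_funs_def mean_half_open)
  then obtain \<phi> where \<phi>: "\<And>\<beta>. model_spec \<alpha> \<xi> x \<phi> \<beta> (\<phi> \<beta>)"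
    using model_exists[OF assms(1)] by blast
  let ?\<Pi> = "\<lambda>x' y \<gamma>. \<phi> \<gamma> x' y"
  have comp: "component ?\<Pi> \<beta> = \<phi> \<beta>" for \<beta>
    by (simp add: component_def fun_eq_iff)
  have graded: "graded \<alpha> 0 (homog \<alpha> \<beta>) (bracket \<beta> + 1) (\<phi> \<beta>)" for \<beta>
    using \<phi>[of \<beta>] by (simp add: model_spec_def)
  have nonpop: "\<phi> \<beta> = (\<lambda>_ _. 0)" if "\<not> populated \<beta>" for \<beta>
    using \<phi>[of \<beta>] that by (simp add: model_spec_def)
  have "\<forall>\<beta>. \<exists>p t. per_poly const_funs t p \<and> (\<forall>x' y. heat (\<phi> \<beta>) x' y + p x' y
    = Pi_minus \<xi> ?\<Pi> x' y \<beta>) \<and>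
        (populated \<beta> \<and> \<not> purely_polynomial \<beta> \<longrightarrow> t < homog \<alpha> \<beta> - 2)"
    using \<phi> by (simp add: model_spec_def)
  then obtain p t where p: "\<And>\<beta>. per_poly const_funs (t \<beta>) (p \<beta>)"
      "\<And>\<beta> x' y. heat (\<phi> \<beta>) x' y + p \<beta> x' y = Pi_minus \<xi> ?\<Pi> x' y \<beta>"
      "\<And>\<beta>. populated \<beta> \<and> \<not> purely_polynomial \<beta> \<Longrightarrow> t \<beta> < homog \<alpha> \<beta> - 2"
    by metis
  \<comment> \<open>Constant coefficients remove the dependence on x', so evaluation at the
    arbitrary point 0 gives a function of y alone.\<close>
  have p0: "p \<beta> 0 y = p \<beta> x' y" for \<beta> x' y
    by (rule per_poly_const_indep[OF p(1)])
  have deg: "ydeg (\<phi> \<beta>) < ereal (homog \<alpha> \<beta>)" if "\<not> purely_polynomial \<beta>" for \<beta>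
  proof (cases "populated \<beta>")
    case True
    then have "bracket \<beta> + 1 > 0"
      using that by (simp add: populated_def)
    then obtain \<delta> where "\<delta> > 0" "split_deg \<alpha> (homog \<alpha> \<beta>) \<delta> (\<phi> \<beta>)"
      using graded_pos[OF graded[of \<beta>]] by blast
    \<comment> \<open>The larger of |\<beta>| - \<alpha> and |\<beta>| - \<delta> lies below
      |\<beta>| since \<alpha> and \<delta> are positive.\<close>
    then show ?thesis
      using assms(1) by (intro per_poly_ydeg_less[OF split_deg_per_poly]) auto
  next
    case False
    \<comment> \<open>Zero meets every degree bound, even a negative one.\<close>
    then show ?thesis
      using nonpop per_poly_ydeg_less[OF per_poly.zero, of "homog \<alpha> \<beta> - 1" "homog \<alpha> \<beta>"] by simp
  qed
  show ?thesis
  proof (rule exI[of _ ?\<Pi>], rule exI[of _ "\<lambda>y \<beta>. p \<beta> 0 y"], unfold comp, intro conjI allI impI)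
    show "?\<Pi> x' y \<in> Tstar" for x' y
      using nonpop unfolding Tstar_def by fastforce
    show "periodic_polynomial (\<phi> \<beta>)" for \<beta>
      by (rule per_poly_periodic_polynomial[OF split_deg_per_poly[OF graded_split[OF graded]]])
    show "real_polynomial_function (\<lambda>y. p \<beta> 0 y)" for \<beta>
      by (rule per_poly_const_polynomial[OF p(1)])
    show "D2 (\<phi> \<beta>) x' y - D1 (D1 (\<phi> \<beta>)) x' y + p \<beta> 0 y = Pi_minus \<xi> ?\<Pi> x' y \<beta>" for \<beta> x' y
      using p(2)[of \<beta> x' y] p0[of \<beta> y x'] by (simp add: heat_def)
    show "Dn n (\<phi> \<beta>) x x = 0" if "real (wdeg n) < homog \<alpha> \<beta>" for \<beta> n
      using \<phi>[of \<beta>] that unfolding model_spec_def by blast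
    show "\<phi> (unitN n) x' y = monom2 (y - x) (pair_of n)" for n x' y
      using \<phi>[of "unitN n"] by (simp add: model_spec_def unitN_inj)
    show "ydeg (\<phi> \<beta>) < ereal (homog \<alpha> \<beta>)" if "\<not> purely_polynomial \<beta>" for \<beta>
      by (rule deg[OF that])
    show "ydeg (\<lambda>_ y. p \<beta> 0 y) < ereal (homog \<alpha> \<beta> - 2)" if
      "populated \<beta> \<and> \<not> purely_polynomial \<beta>" for \<beta>
    proof -
      have "(\<lambda>_ y. p \<beta> 0 y) = p \<beta>" using p0 by (simp add: fun_eq_iff)
      then show ?thesis
        using per_poly_ydeg_less[OF per_poly_const_imp_periodic[OF p(1)] p(3)[OF that]] by simp
    qed
  qed
qed

end
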